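(* Let $G$ be a connected graph with $2h_G\le N_G$ and $N_G\ge5$. Suppose that $D^n_G(e_1,\dots,e_n)$ is the result of the denominator reduction after $n<N_G$ steps. Then for every prime power $q$, $$c_2(G)_q\equiv(-1)^n[D^n_G(e_1,\dots,e_n)]_q\mod q .$$ If such a graph $G$ has weight drop, then $c_2(G)_q\equiv0\mod q$ for every prime power $q$. Likewise, if $G$ is a connected graph with $2h_G<N_G$ and $N_G\ge4$, then $c_2(G)_q\equiv0\mod q$ for every prime power $q$.
   Context: Graphs are finite, possibly with multiple edges and self-loops. $N_G$ is the number of edges and $h_G$ the number of loops (first Betti number) of $G$. The graph polynomial is $\Psi_G=\sum_T\prod_{e\notin T}\alpha_e$, summed over spanning trees $T$ of $G$. Dodgson polynomials: orient the edges of $G$ and let $\mathcal{E}_G$ be the edge-by-vertex incidence matrix ($(\mathcal{E}_G)_{e,v}=1$ if $e$ begins at $v$ and does not end there, $-1$ if $e$ ends at $v$ and does not begin there, $0$ otherwise). Let $A$ be the diagonal matrix with entries $\alpha_e$, and let $M_G$ be obtained from $\begin{pmatrix} A & \mathcal{E}_G\\ -\mathcal{E}_G^T & 0\end{pmatrix}$ by deleting the row and column indexed by one chosen vertex (all choices fixed once and for all). For sets of edges $I,J,K$ with $|I|=|J|$, $\Psi^{I,J}_{G,K}$ is the determinant of the matrix obtained from $M_G$ by removing the rows indexed by $I$ and the columns indexed by $J$, and setting $\alpha_e=0$ for $e\in K$ ($K$ omitted if empty). The five-invariant of distinct edges $i,j,k,l,m$ is, up to sign, $${}^5\Psi_G(i,j,k,l,m)=\pm\det\begin{pmatrix}\Psi^{ij,kl}_{G,m}&\Psi^{ik,jl}_{G,m}\\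 \Psi^{ijm,klm}_G&\Psi^{ikm,jlm}_G\end{pmatrix}.$$ Denominator reduction: given an ordering $e_1,\dots,e_{N_G}$ of the edges (write $\alpha_n=\alpha_{e_n}$), set $D^5_G(e_1,\dots,e_5)={}^5\Psi_G(e_1,\dots,e_5)$. If $n\ge5$ and $D^n_G(e_1,\dots,e_n)$ is defined and factorizes as a product of linear factors in $\alpha_{n+1}$, i.e. is of the form $(a\alpha_{n+1}+b)(c\alpha_{n+1}+d)$ with $a,b,c,d$ integer polynomials in the remaining variables (possibly with $a=0$ or $c=0$), set $D^{n+1}_G(e_1,\dots,e_{n+1})=\pm(ad-bc)$. $G$ is said to have weight drop if some $D^n_G(e_1,\dots,e_n)$ (for some ordering of the edges and some $n$ for which it is defined) vanishes identically. For polynomials with integer coefficients, $[P]_q$ is the number of zeros of $P$ over $\mathbb{F}_q$ in affine space; $[D^n_G(e_1,\dots,e_n)]_q$ is taken in affine space of dimension $N_G-n$ with coordinates the variables of the remaining edges, and $[\Psi_G]_q$ in dimension $N_G$. The invariant $c_2(G)_q\in\mathbb{Z}/q\mathbb{Z}$ is defined by $[\Psi_G]_q\equiv c_2(G)_q\,q^2\mod q^3$. *)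

theory Defs
  imports
    "HOL-Library.Poly_Mapping"
    "HOL-Library.FuncSet"
    "HOL-Library.Cardinality"
    "HOL-Number_Theory.Cong"
    "Graph_Theory.Digraph_Component"
    "Jordan_Normal_Form.Determinant"
begin

text \<open>
  A finite graph, with multiple edges and self-loops allowed, is a \<open>fin_digraph\<close>; the direction
  of its arcs is the chosen orientation.  Connectedness, Betti number and spanning trees below
  do not depend on this direction.  The library's \<open>forest\<close> and \<open>tree\<close> only exclude directed
  cycles and are therefore not used.
\<close>

definition betti :: "('v, 'e) pre_digraph \<Rightarrow> nat" where
  \<comment> \<open>the natural subtraction is exact: there are at most N + c vertices\<close>
  "betti G = card (arcs G) + card (pre_digraph.sccs_verts (with_proj (mk_symmetric G)))
     - card (verts G)"

definition undirected_cycle :: "('v, 'e) pre_digraph \<Rightarrow> 'v list \<Rightarrow> 'e list \<Rightarrow> bool" where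
  \<comment> \<open>a self-loop is a cycle of length 1, two parallel edges form a cycle of length 2\<close>
  "undirected_cycle G us cs \<longleftrightarrow>
     cs \<noteq> [] \<and> length us = length cs \<and> distinct us \<and> distinct cs \<and> set cs \<subseteq> arcs G \<and>
     (\<forall>i < length cs. {tail G (cs ! i), head G (cs ! i)} = {us ! i, us ! (Suc i mod length cs)})"

definition spanning_tree_arcs :: "('v, 'e) pre_digraph \<Rightarrow> 'e set \<Rightarrow> bool" where
  "spanning_tree_arcs G T \<longleftrightarrow>
     T \<subseteq> arcs G \<and> Digraph_Component.connected (G\<lparr>arcs := T\<rparr>) \<and>
     (\<nexists>us cs. undirected_cycle (G\<lparr>arcs := T\<rparr>) us cs)"


type_synonym 'e int_mpoly = "('e \<Rightarrow>\<^sub>0 nat) \<Rightarrow>\<^sub>0 int"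

definition Var :: "'e \<Rightarrow> 'e int_mpoly" where
  "Var e = Poly_Mapping.single (Poly_Mapping.single e 1) 1"

definition vars :: "'e int_mpoly \<Rightarrow> 'e set" where
  "vars P = (\<Union>m \<in> Poly_Mapping.keys P. Poly_Mapping.keys m)"

definition eval_mpoly :: "('e \<Rightarrow> 'f) \<Rightarrow> 'e int_mpoly \<Rightarrow> 'f::comm_ring_1" where
  "eval_mpoly x P = (\<Sum>m \<in> Poly_Mapping.keys P. of_int (Poly_Mapping.lookup P m) *
     (\<Prod>e \<in> Poly_Mapping.keys m. x e ^ Poly_Mapping.lookup m e))"

definition num_zeros :: "'f::{field,finite} itself \<Rightarrow> 'e set \<Rightarrow> 'e int_mpoly \<Rightarrow> nat" where
  \<comment> \<open>zeros in the affine space over the finite field \<open>'f\<close> with coordinates indexed by \<open>S\<close>\<close>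
  "num_zeros F S P = card {x \<in> S \<rightarrow>\<^sub>E (UNIV :: 'f set). eval_mpoly x P = 0}"

definition graph_poly :: "('v, 'e) pre_digraph \<Rightarrow> 'e int_mpoly" where
  "graph_poly G = (\<Sum>T | spanning_tree_arcs G T. \<Prod>e \<in> arcs G - T. Var e)"

definition has_c2 :: "'f::{field,finite} itself \<Rightarrow> ('v, 'e) pre_digraph \<Rightarrow> int \<Rightarrow> bool" where
  "has_c2 F G c \<longleftrightarrow>
     [int (num_zeros F (arcs G) (graph_poly G)) = c * int CARD('f) ^ 2] (mod int CARD('f) ^ 3)"

definition c2 :: "'f::{field,finite} itself \<Rightarrow> ('v, 'e) pre_digraph \<Rightarrow> int" where
  \<comment> \<open>the representative in \<open>{0..<q}\<close> of the class modulo \<open>q\<close>; meaningful only if some \<open>c\<close>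
      satisfies \<open>has_c2 F G c\<close>, in which case it is unique modulo \<open>q\<close>\<close>
  "c2 F G = (THE c. c \<in> {0..<int CARD('f)} \<and> has_c2 F G c)"


definition incidence :: "('v, 'e) pre_digraph \<Rightarrow> 'e \<Rightarrow> 'v \<Rightarrow> 'e int_mpoly" where
  "incidence G e v =
     (if tail G e = v \<and> head G e \<noteq> v then 1
      else if head G e = v \<and> tail G e \<noteq> v then - 1
      else 0)"

text \<open>
  The rows and columns of the matrix are labelled by edges and vertices; in \<open>graph_entry\<close>, the
  variables of the edges in \<open>K\<close> are set to 0.
\<close>

fun graph_entry ::
  "('v, 'e) pre_digraph \<Rightarrow> 'e set \<Rightarrow> 'e + 'v \<Rightarrow> 'e + 'v \<Rightarrow> 'e int_mpoly" where
  "graph_entry G K (Inl e) (Inl f) = (if e = f \<and> e \<notin> K then Var e else 0)"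
| "graph_entry G K (Inl e) (Inr v) = incidence G e v"
| "graph_entry G K (Inr v) (Inl e) = - incidence G e v"
| "graph_entry G K (Inr v) (Inr w) = 0"

text \<open>
  The lists \<open>es\<close> and \<open>vs\<close> fix the order of the edges and of the vertices other than the
  deleted one.
\<close>

definition dodgson ::
  "('v, 'e) pre_digraph \<Rightarrow> 'e list \<Rightarrow> 'v list \<Rightarrow> 'e set \<Rightarrow> 'e set \<Rightarrow> 'e set \<Rightarrow> 'e int_mpoly" where
  "dodgson G es vs I J K =
     (let rows = map Inl (filter (\<lambda>e. e \<notin> I) es) @ map Inr vs;
          cols = map Inl (filter (\<lambda>e. e \<notin> J) es) @ map Inr vs
      in det (mat (length rows) (length cols) (\<lambda>(r, c). graph_entry G K (rows ! r) (cols ! c))))"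

definition five_invariant ::
  "('v, 'e) pre_digraph \<Rightarrow> 'e list \<Rightarrow> 'v list \<Rightarrow> 'e \<Rightarrow> 'e \<Rightarrow> 'e \<Rightarrow> 'e \<Rightarrow> 'e \<Rightarrow> 'e int_mpoly" where
  "five_invariant G es vs i j k l m =
     det (mat_of_rows_list 2
       [[dodgson G es vs {i, j} {k, l} {m}, dodgson G es vs {i, k} {j, l} {m}],
        [dodgson G es vs {i, j, m} {k, l, m} {}, dodgson G es vs {i, k, m} {j, l, m} {}]])"

text \<open>
  \<open>denom_red G es vs ns D\<close>: the denominator reduction along the edges \<open>ns\<close> is defined and
  \<open>D\<close> is one of the two choices of sign of its result.
\<close>

inductive denom_red ::
  "('v, 'e) pre_digraph \<Rightarrow> 'e list \<Rightarrow> 'v list \<Rightarrow> 'e list \<Rightarrow> 'e int_mpoly \<Rightarrow> bool"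
  for G es vs where
  five: "\<lbrakk>distinct [i, j, k, l, m]; {i, j, k, l, m} \<subseteq> arcs G; s \<in> {1, - 1}\<rbrakk>
    \<Longrightarrow> denom_red G es vs [i, j, k, l, m] (s * five_invariant G es vs i j k l m)"
| step: "\<lbrakk>denom_red G es vs ns D; e \<in> arcs G - set ns;
     vars a \<union> vars b \<union> vars c \<union> vars d \<subseteq> arcs G - set (ns @ [e]);
     D = (a * Var e + b) * (c * Var e + d); s \<in> {1, - 1}\<rbrakk>
    \<Longrightarrow> denom_red G es vs (ns @ [e]) (s * (a * d - b * c))"

definition weight_drop :: "('v, 'e) pre_digraph \<Rightarrow> 'e list \<Rightarrow> 'v list \<Rightarrow> bool" where
  "weight_drop G es vs \<longleftrightarrow> (\<exists>ns. denom_red G es vs ns 0)"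

end

theory Submission
  imports Defs "Jordan_Normal_Form.Char_Poly"
begin

text \<open>
  Let \<open>E\<close> be a matrix with \<open>N\<close> rows, indexed by edges, and \<open>r\<close> columns, indexed by the vertices
  other than the deleted one. The matrix-tree theorem \<open>eval_graph_poly\<close> identifies the graph
  polynomial with the determinant of the configuration matrix of the incidence matrix. As
  \<open>h = N - r\<close>, the hypothesis \<open>2 * h \<le> N\<close> is \<open>N \<le> 2 * r\<close>. Write \<open>[P]\<close> for the number of zeros of \<open>P\<close>
  over the field with \<open>q\<close> elements.

  \<^emph>\<open>The graph polynomial modulo\<close> \<open>q\<^sup>3\<close>. A point \<open>x\<close> is a zero iff the kernel of the matrix
  at \<open>x\<close> is nontrivial. Its size \<open>m\<close> is a power of \<open>q\<close>, and modulo \<open>q\<^sup>3\<close> the indicator of \<open>m \<noteq> 1\<close> is,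
  up to a unit, a quadratic polynomial in \<open>m\<close> (\<open>indicator_mod_cube\<close>). Hence only the sums of \<open>m\<close>
  and of \<open>m\<^sup>2\<close> over all points matter. Exchanging the summations, these count solutions of
  equations that are linear in \<open>x\<close> and in the vertex parts once the edge parts of the kernel vectors are
  fixed; they are divisible by \<open>q ^ r\<close> and by the smaller one of \<open>q ^ r\<close> and \<open>q ^ (2 * r - N + 2)\<close>. So \<open>[\<Psi>]\<close>
  is congruent to \<open>q ^ N\<close> modulo \<open>q\<^sup>2\<close>, and modulo \<open>q\<^sup>3\<close> if \<open>N < 2 * r\<close>, for \<open>3 \<le> r\<close> (\<open>zero_count_config_minor\<close>).
  This gives the existence of \<open>c\<^sub>2\<close> and its vanishing for \<open>2 * h < N\<close>.

  \<^emph>\<open>Elimination of edges.\<close> Zeros of polynomials of degree one in a variable are counted fibre by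
  fibre; this yields a resultant, which Dodgson's identity factorizes into minors, and leading
  coefficients. Four eliminations give
  \<open>[\<Psi>] = q\<^sup>2 * ([D\<^sup>4] - q ^ (N - 4))\<close> modulo \<open>q\<^sup>3\<close>, where \<open>D\<^sup>4\<close> is a product of two minors whose
  resultant is the five-invariant (\<open>zero_count_eliminate_four\<close>). If \<open>D = (a * \<alpha> + b) * (c * \<alpha> + d)\<close>,
  then \<open>[D] = 2 * q ^ (N - n - 1) - [a * c] - [a * d - b * c]\<close> modulo \<open>q\<close>.

  \<^emph>\<open>Leading coefficients.\<close> To treat \<open>[a * c]\<close>, the eliminated edge \<open>e\<close> is replaced by a self-loop.
  The graph polynomial becomes \<open>\<alpha>\<close> times that of the graph without \<open>e\<close>, to which the strict
  inequality applies, so \<open>[\<Psi>]\<close> becomes \<open>0\<close> modulo \<open>q\<^sup>3\<close>. The denominator reduction of the new graph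
  is again defined, with result \<open>\<alpha>\<^sup>2 * a * c\<close> (\<open>denom_red_loop_at\<close>). The congruence for the previous step,
  applied to the new graph, therefore determines \<open>[a * c]\<close> as \<open>q ^ (N - n - 1)\<close> modulo \<open>q\<close>.

  By induction \<open>[\<Psi>] = (- 1) ^ n * q\<^sup>2 * ([D\<^sup>n] - q ^ (N - n))\<close> modulo \<open>q\<^sup>3\<close> for \<open>5 \<le> n \<le> N\<close>
  (\<open>denom_red_count\<close>). For \<open>n < N\<close> the correction \<open>q ^ (N - n)\<close> vanishes modulo \<open>q\<close>; for \<open>D\<^sup>n = 0\<close> the bracket
  is zero, also when \<open>n = N\<close>.
\<close>

section \<open>Integral polynomials in many variables\<close>

lemma monomial_eval_superset:
  fixes x :: "'e \<Rightarrow> 'f::comm_ring_1"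
  assumes "finite A" "Poly_Mapping.keys m \<subseteq> A"
  shows "(\<Prod>e\<in>Poly_Mapping.keys m. x e ^ Poly_Mapping.lookup m e) = (\<Prod>e\<in>A. x e ^ Poly_Mapping.lookup m e)"
  using assms by (intro prod.mono_neutral_left) (auto simp: in_keys_iff)

lemma monomial_eval_add:
  fixes x :: "'e \<Rightarrow> 'f::comm_ring_1"
  shows "(\<Prod>e\<in>Poly_Mapping.keys (m + m'). x e ^ Poly_Mapping.lookup (m + m') e)
    = (\<Prod>e\<in>Poly_Mapping.keys m. x e ^ Poly_Mapping.lookup m e)
      * (\<Prod>e\<in>Poly_Mapping.keys m'. x e ^ Poly_Mapping.lookup m' e)"
proof -
  let ?A = "Poly_Mapping.keys m \<union> Poly_Mapping.keys m'"
  have A: "finite ?A" "Poly_Mapping.keys (m + m') \<subseteq> ?A"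
    using keys_add[of m m'] by auto
  show ?thesis
    unfolding monomial_eval_superset[OF A] monomial_eval_superset[of ?A m, simplified]
      monomial_eval_superset[of ?A m', simplified]
    by (simp add: lookup_add power_add prod.distrib)
qed

lemma eval_mpoly_superset:
  assumes "finite A" "Poly_Mapping.keys P \<subseteq> A"
  shows "eval_mpoly x P = (\<Sum>m\<in>A. of_int (Poly_Mapping.lookup P m) *
     (\<Prod>e\<in>Poly_Mapping.keys m. x e ^ Poly_Mapping.lookup m e))"
  unfolding eval_mpoly_def using assms by (intro sum.mono_neutral_left) (auto simp: in_keys_iff)

lemma eval_mpoly_0: "eval_mpoly x 0 = 0"
  by (simp add: eval_mpoly_def)

lemma eval_mpoly_add: "eval_mpoly x (P + Q) = eval_mpoly x P + eval_mpoly x Q"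
proof -
  let ?A = "Poly_Mapping.keys P \<union> Poly_Mapping.keys Q"
  have A: "finite ?A" "Poly_Mapping.keys (P + Q) \<subseteq> ?A"
    using keys_add[of P Q] by auto
  show ?thesis
    unfolding eval_mpoly_superset[OF A] eval_mpoly_superset[of ?A P, simplified]
      eval_mpoly_superset[of ?A Q, simplified]
    by (simp add: lookup_add sum.distrib algebra_simps)
qed

lemma eval_mpoly_sum: "eval_mpoly x (\<Sum>i\<in>A. P i) = (\<Sum>i\<in>A. eval_mpoly x (P i))"
  by (induction A rule: infinite_finite_induct) (auto simp: eval_mpoly_0 eval_mpoly_add)

lemma eval_mpoly_single:
  "eval_mpoly x (Poly_Mapping.single m c) =
    of_int c * (\<Prod>e\<in>Poly_Mapping.keys m. x e ^ Poly_Mapping.lookup m e)"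
  by (cases "c = 0") (auto simp: eval_mpoly_def)

lemma mpoly_eq_sum_single:
  "P = (\<Sum>m\<in>Poly_Mapping.keys P. Poly_Mapping.single m (Poly_Mapping.lookup P m))"
proof (rule poly_mapping_eqI)
  fix k
  have "(\<Sum>m\<in>Poly_Mapping.keys P. Poly_Mapping.lookup (Poly_Mapping.single m (Poly_Mapping.lookup P m)) k)
      = (\<Sum>m\<in>Poly_Mapping.keys P. if m = k then Poly_Mapping.lookup P m else 0)"
    by (intro sum.cong) (auto simp: lookup_single when_def)
  then show "Poly_Mapping.lookup P k = Poly_Mapping.lookup
      (\<Sum>m\<in>Poly_Mapping.keys P. Poly_Mapping.single m (Poly_Mapping.lookup P m)) k"
    by (auto simp: lookup_sum in_keys_iff)
qed

lemma eval_mpoly_mult: "eval_mpoly x (P * Q) = eval_mpoly x P * eval_mpoly x Q"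
proof -
  let ?S = "\<lambda>P m. Poly_Mapping.single m (Poly_Mapping.lookup P m)"
  have single: "eval_mpoly x (?S P m * ?S Q m') = eval_mpoly x (?S P m) * eval_mpoly x (?S Q m')"
    for m m'
    by (simp add: mult_single eval_mpoly_single monomial_eval_add)
  have "P * Q = (\<Sum>m\<in>Poly_Mapping.keys P. ?S P m) * (\<Sum>m\<in>Poly_Mapping.keys Q. ?S Q m)"
    by (rule arg_cong2[OF mpoly_eq_sum_single mpoly_eq_sum_single])
  also have "eval_mpoly x \<dots> = (\<Sum>m\<in>Poly_Mapping.keys P. eval_mpoly x (?S P m))
      * (\<Sum>m\<in>Poly_Mapping.keys Q. eval_mpoly x (?S Q m))"
    by (simp add: sum_product eval_mpoly_sum single)
  also have "\<dots> = eval_mpoly x P * eval_mpoly x Q"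
    unfolding eval_mpoly_sum[symmetric]
    by (rule arg_cong2[OF mpoly_eq_sum_single[symmetric] mpoly_eq_sum_single[symmetric],
          of "\<lambda>a b. eval_mpoly x a * eval_mpoly x b"])
  finally show ?thesis .
qed

lemma eval_mpoly_1: "eval_mpoly x 1 = 1"
  using eval_mpoly_single[of x 0 1] by simp

interpretation eval_mpoly: comm_ring_hom "eval_mpoly x"
  by unfold_locales (simp_all add: eval_mpoly_0 eval_mpoly_1 eval_mpoly_add eval_mpoly_mult)

lemma eval_mpoly_Var [simp]: "eval_mpoly x (Var e) = x e"
  by (simp add: Var_def eval_mpoly_single)

lemma hom_eval_mpoly:
  assumes "comm_ring_hom h"
  shows "h (eval_mpoly x P) = eval_mpoly (\<lambda>e. h (x e)) P"
proof -
  interpret comm_ring_hom h by fact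
  show ?thesis
    by (simp add: eval_mpoly_def hom_distribs)
qed

lemma eval_mpoly_Var_id: "eval_mpoly Var P = P"
proof -
  have pow: "Var e ^ n = Poly_Mapping.single (Poly_Mapping.single e n) (1::int)" for e :: 'a and n
    by (induction n) (auto simp: Var_def mult_single single_add[symmetric])
  have prod: "(\<Prod>e\<in>A. Poly_Mapping.single (f e) (1::int)) = Poly_Mapping.single (\<Sum>e\<in>A. f e) 1"
    if "finite A" for A :: "'a set" and f :: "'a \<Rightarrow> 'a \<Rightarrow>\<^sub>0 nat"
    using that by (induction A) (auto simp: mult_single)
  have m: "(\<Sum>e\<in>Poly_Mapping.keys m. Poly_Mapping.single e (Poly_Mapping.lookup m e)) = m"
    for m :: "'a \<Rightarrow>\<^sub>0 nat"
  proof (rule poly_mapping_eqI)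
    fix k
    have "(\<Sum>e\<in>Poly_Mapping.keys m. Poly_Mapping.lookup (Poly_Mapping.single e (Poly_Mapping.lookup m e)) k)
      = (\<Sum>e\<in>Poly_Mapping.keys m. if e = k then Poly_Mapping.lookup m e else 0)"
      by (intro sum.cong) (auto simp: lookup_single when_def)
    then show "Poly_Mapping.lookup (\<Sum>e\<in>Poly_Mapping.keys m. Poly_Mapping.single e (Poly_Mapping.lookup m e)) k
        = Poly_Mapping.lookup m k"
      by (auto simp: lookup_sum in_keys_iff)
  qed
  have ofint: "of_int c * Poly_Mapping.single m (1::int) = Poly_Mapping.single m c"
    for m :: "'a \<Rightarrow>\<^sub>0 nat" and c
    using mult_single[of 0 c m 1] by (simp add: single_of_int[symmetric] del: single_of_int)
  have "eval_mpoly Var P = (\<Sum>m\<in>Poly_Mapping.keys P. Poly_Mapping.single m (Poly_Mapping.lookup P m))"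
    unfolding eval_mpoly_def by (simp add: pow prod m ofint)
  then show ?thesis
    by (rule trans[OF _ mpoly_eq_sum_single[symmetric]])
qed

lemma eval_mpoly_cong:
  assumes "\<And>e. e \<in> vars P \<Longrightarrow> x e = y e"
  shows "eval_mpoly x P = eval_mpoly y P"
  unfolding eval_mpoly_def
proof (intro sum.cong refl arg_cong2[of _ _ _ _ "(*)"] prod.cong)
  fix m e assume "m \<in> Poly_Mapping.keys P" "e \<in> Poly_Mapping.keys m"
  then have "x e = y e" by (intro assms) (auto simp: vars_def)
  then show "x e ^ Poly_Mapping.lookup m e = y e ^ Poly_Mapping.lookup m e" by simp
qed

text \<open>This bounds the variables of coefficients, without a description of the coefficients.\<close>

lemma eval_mpoly_closed:
  fixes x :: "'e \<Rightarrow> 'f::comm_ring_1" and C :: "'f set"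
  assumes add: "\<And>a b. a \<in> C \<Longrightarrow> b \<in> C \<Longrightarrow> a + b \<in> C"
    and mult: "\<And>a b. a \<in> C \<Longrightarrow> b \<in> C \<Longrightarrow> a * b \<in> C"
    and int: "\<And>n. of_int n \<in> C"
    and x: "\<And>e. e \<in> vars P \<Longrightarrow> x e \<in> C"
  shows "eval_mpoly x P \<in> C"
proof -
  have zero: "0 \<in> C" and one: "1 \<in> C"
    using int[of 0] int[of 1] by auto
  have sum: "(\<Sum>i\<in>A. f i) \<in> C" if "\<And>i. i \<in> A \<Longrightarrow> f i \<in> C" for A :: "('e \<Rightarrow>\<^sub>0 nat) set" and f :: "_ \<Rightarrow> 'f"
    using that by (induction A rule: infinite_finite_induct) (auto intro: zero add)
  have prod: "(\<Prod>i\<in>A. f i) \<in> C" if "\<And>i. i \<in> A \<Longrightarrow> f i \<in> C" for A :: "'e set" and f :: "_ \<Rightarrow> 'f"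
    using that by (induction A rule: infinite_finite_induct) (auto intro: one mult)
  have pow: "a ^ n \<in> C" if "a \<in> C" for a n
    using that by (induction n) (auto intro: one mult)
  show ?thesis
    unfolding eval_mpoly_def by (intro sum mult int prod pow x) (auto simp: vars_def)
qed

lemma vars_0 [simp]: "vars 0 = {}"
  by (simp add: vars_def)

lemma vars_of_int [simp]: "vars (of_int n) = {}"
  by (auto simp: vars_def single_of_int[symmetric] simp del: single_of_int split: if_splits)

lemma vars_1 [simp]: "vars 1 = {}"
  using vars_of_int[of 1] by (simp del: vars_of_int)

lemma vars_Var [simp]: "vars (Var e) = {e}"
  by (simp add: vars_def Var_def)

lemma vars_add: "vars (P + Q) \<subseteq> vars P \<union> vars Q"
  using keys_add[of P Q] by (auto simp: vars_def)

lemma vars_mult: "vars (P * Q) \<subseteq> vars P \<union> vars Q"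
proof
  fix e assume "e \<in> vars (P * Q)"
  then obtain m where m: "m \<in> Poly_Mapping.keys (P * Q)" "e \<in> Poly_Mapping.keys m"
    by (auto simp: vars_def)
  from m(1) obtain k l where "k \<in> Poly_Mapping.keys P" "l \<in> Poly_Mapping.keys Q" "m = k + l"
    using keys_mult[of P Q] by auto
  with m(2) show "e \<in> vars P \<union> vars Q"
    using keys_add[of k l] by (fastforce simp: vars_def)
qed

lemma vars_power: "vars (P ^ n) \<subseteq> vars P"
proof (induction n)
  case 0
  show ?case by simp
next
  case (Suc n)
  then show ?case using vars_mult[of P "P ^ n"] by auto
qed

lemma finite_vars: "finite (vars P)"
  by (simp add: vars_def)

text \<open>
  Only finitely many variables occur, and these can be numbered, which transports the question to
  polynomials whose monomials are linearly ordered.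
\<close>

lemma mpoly_mult_eq_0:
  fixes P Q :: "'e int_mpoly"
  assumes "P * Q = 0"
  shows "P = 0 \<or> Q = 0"
proof -
  define V where "V = vars P \<union> vars Q"
  have "finite V" by (simp add: V_def finite_vars)
  then obtain f :: "'e \<Rightarrow> nat" where f: "inj_on f V"
    using finite_imp_inj_to_nat_seg by metis
  define up :: "'e int_mpoly \<Rightarrow> nat int_mpoly" where "up = eval_mpoly (\<lambda>e. Var (f e))"
  define down :: "nat int_mpoly \<Rightarrow> 'e int_mpoly"
    where "down = eval_mpoly (\<lambda>n. Var (inv_into V f n))"
  have inv: "down (up R) = R" if "vars R \<subseteq> V" for R
  proof -
    have "down (up R) = eval_mpoly (\<lambda>e. Var (inv_into V f (f e))) R"
      unfolding up_def down_def
      by (subst hom_eval_mpoly[OF eval_mpoly.comm_ring_hom_axioms]) simp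
    also have "\<dots> = eval_mpoly Var R"
      using that f by (intro eval_mpoly_cong) auto
    finally show ?thesis by (simp add: eval_mpoly_Var_id)
  qed
  have "up P * up Q = 0"
    using assms by (simp add: up_def eval_mpoly_mult[symmetric])
  then have "up P = 0 \<or> up Q = 0" by simp
  then show ?thesis
    using inv[of P] inv[of Q] by (auto simp: V_def down_def)
qed

text \<open>
  The coefficients are taken in the ring of all polynomials, so that they can replace the given
  polynomials in a further step of a reduction.
\<close>

definition poly_in :: "'e \<Rightarrow> 'e int_mpoly \<Rightarrow> 'e int_mpoly poly" where
  "poly_in e = eval_mpoly (\<lambda>f. if f = e then [:0, 1:] else [:Var f:])"

interpretation poly_in: comm_ring_hom "poly_in e"
  unfolding poly_in_def by (rule eval_mpoly.comm_ring_hom_axioms)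

lemma poly_in_Var: "poly_in e (Var f) = (if f = e then [:0, 1:] else [:Var f:])"
  by (simp add: poly_in_def)

lemma comm_ring_hom_const_poly: "comm_ring_hom (\<lambda>a :: 'a::comm_ring_1. [:a:])"
  by unfold_locales (auto simp: one_pCons)

lemma comm_ring_hom_poly: "comm_ring_hom (\<lambda>p. poly p (a :: 'a::comm_ring_1))"
  by unfold_locales auto

lemma poly_in_const:
  assumes "e \<notin> vars P"
  shows "poly_in e P = [:P:]"
proof -
  have "poly_in e P = eval_mpoly (\<lambda>f. [:Var f:]) P"
    unfolding poly_in_def using assms by (intro eval_mpoly_cong) auto
  also have "\<dots> = [:eval_mpoly Var P:]"
    by (rule hom_eval_mpoly[OF comm_ring_hom_const_poly, symmetric])
  finally show ?thesis by (simp add: eval_mpoly_Var_id)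
qed

lemma poly_poly_in: "poly (poly_in e P) (Var e) = P"
proof -
  have "poly (poly_in e P) (Var e) = eval_mpoly Var P"
    unfolding poly_in_def
    by (subst hom_eval_mpoly[OF comm_ring_hom_poly]) (auto intro!: arg_cong2[of _ _ _ _ eval_mpoly])
  then show ?thesis by (simp add: eval_mpoly_Var_id)
qed

lemma poly_in_eq_0_iff: "poly_in e P = 0 \<longleftrightarrow> P = 0"
  using poly_poly_in[of e P] by auto

lemma vars_coeff_poly_in: "vars (coeff (poly_in e P) i) \<subseteq> vars P - {e}"
proof -
  let ?S = "vars P - {e}"
  have sum: "vars (\<Sum>i\<in>A. f i) \<subseteq> S" if "\<And>i. i \<in> A \<Longrightarrow> vars (f i) \<subseteq> S"
    for A S and f :: "nat \<Rightarrow> 'a int_mpoly"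
    using that
  proof (induction A rule: infinite_finite_induct)
    case (insert a A)
    then show ?case using vars_add[of "f a" "sum f A"] by auto
  qed auto
  let ?C = "{p. \<forall>i. vars (coeff p i) \<subseteq> ?S}"
  have "poly_in e P \<in> ?C"
    unfolding poly_in_def
  proof (rule eval_mpoly_closed)
    fix p q assume "p \<in> ?C" "q \<in> ?C"
    then have pq: "vars (coeff p i) \<subseteq> ?S" "vars (coeff q i) \<subseteq> ?S" for i by blast+
    show "p + q \<in> ?C"
      unfolding mem_Collect_eq coeff_add
    proof
      fix i show "vars (coeff p i + coeff q i) \<subseteq> ?S"
        using vars_add[of "coeff p i" "coeff q i"] pq[of i] by blast
    qed
    show "p * q \<in> ?C"
      unfolding mem_Collect_eq coeff_mult
    proof (intro allI sum)
      fix i j show "vars (coeff p j * coeff q (i - j)) \<subseteq> ?S"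
        using vars_mult[of "coeff p j" "coeff q (i - j)"] pq by blast
    qed
  next
    fix n
    have "coeff (of_int n) i = (if i = 0 then of_int n else (0 :: 'a int_mpoly))" for i
      by (simp add: of_int_poly coeff_pCons split: nat.splits)
    then show "of_int n \<in> ?C" by simp
  next
    fix f assume f: "f \<in> vars P"
    then show "(if f = e then [:0, 1:] else [:Var f:]) \<in> ?C"
      by (auto simp: coeff_pCons split: nat.splits)
  qed
  then show ?thesis by blast
qed

lemma linear_eq_0:
  assumes "a * Var f + b = 0" "f \<notin> vars a" "f \<notin> vars b"
  shows "a = 0 \<and> b = 0"
proof -
  have "poly_in f (a * Var f + b) = [:b, a:]"
    using assms(2,3) by (simp add: poly_in.hom_add poly_in.hom_mult poly_in_Var poly_in_const)
  with assms(1) show ?thesis by simp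
qed

text \<open>
  By \<open>mpoly_mult_eq_0\<close> the product of the leading coefficients does not vanish.
\<close>

lemma degree_poly_in_mult:
  assumes "P \<noteq> 0" "Q \<noteq> 0"
  shows "degree (poly_in e P) + degree (poly_in e Q) \<le> degree (poly_in e (P * Q))"
proof -
  have "lead_coeff (poly_in e P) \<noteq> 0" "lead_coeff (poly_in e Q) \<noteq> 0"
    using assms by (simp_all add: poly_in_eq_0_iff)
  then have "lead_coeff (poly_in e P) * lead_coeff (poly_in e Q) \<noteq> 0"
    using mpoly_mult_eq_0 by blast
  then have "coeff (poly_in e (P * Q)) (degree (poly_in e P) + degree (poly_in e Q)) \<noteq> 0"
    by (simp add: poly_in.hom_mult coeff_mult_degree_sum)
  then show ?thesis by (rule le_degree)
qed

lemma coeff_mult_top: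
  fixes p q :: "'a::comm_ring_1 poly"
  assumes "degree p \<le> i" "degree q \<le> j"
  shows "coeff (p * q) (i + j) = coeff p i * coeff q j"
proof -
  have "coeff p k * coeff q (i + j - k) = (if k = i then coeff p i * coeff q j else 0)" if "k \<le> i + j" for k
  proof (cases "k = i")
    case False
    then have "k > degree p \<or> i + j - k > degree q" using assms that by linarith
    then show ?thesis using False by (auto simp: coeff_eq_0)
  qed auto
  then show ?thesis by (simp add: coeff_mult)
qed

section \<open>Determinants indexed by lists\<close>

text \<open>
  Rows and columns are listed by labels, so that the removal of a row is the removal of an element of
  a list and the labels decide the entries.
\<close>

definition minor :: "('a \<Rightarrow> 'b \<Rightarrow> 'r::comm_ring_1) \<Rightarrow> 'a list \<Rightarrow> 'b list \<Rightarrow> 'r" where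
  "minor g rs cs = det (mat (length rs) (length cs) (\<lambda>(r, c). g (rs ! r) (cs ! c)))"

lemma minor_cong:
  assumes "\<And>r c. r \<in> set rs \<Longrightarrow> c \<in> set cs \<Longrightarrow> g r c = g' r c"
  shows "minor g rs cs = minor g' rs cs"
  unfolding minor_def using assms by (intro arg_cong[of _ _ det] cong_mat) auto

lemma minor_hom:
  assumes "comm_ring_hom h"
  shows "h (minor g rs cs) = minor (\<lambda>r c. h (g r c)) rs cs"
proof -
  interpret comm_ring_hom h by fact
  show ?thesis
    unfolding minor_def hom_det[symmetric] by (intro arg_cong[of _ _ det]) auto
qed

lemma minor_transpose:
  assumes "length rs = length cs"
  shows "minor (\<lambda>c r. g r c) cs rs = minor g rs cs"
proof -
  let ?A = "mat (length rs) (length cs) (\<lambda>(r, c). g (rs ! r) (cs ! c))"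
  have "det (transpose_mat ?A) = det ?A"
    by (rule det_transpose[of _ "length cs"]) (simp add: assms carrier_matI)
  moreover have "transpose_mat ?A = mat (length cs) (length rs) (\<lambda>(c, r). g (rs ! r) (cs ! c))"
    by (rule eq_matI) auto
  ultimately show ?thesis by (simp add: minor_def)
qed

lemma mat_delete_lists:
  assumes "i < length rs" "j < length cs"
  shows "mat_delete (mat (length rs) (length cs) (\<lambda>(r, c). g (rs ! r) (cs ! c))) i j
    = mat (length (take i rs @ drop (Suc i) rs)) (length (take j cs @ drop (Suc j) cs))
      (\<lambda>(r, c). g ((take i rs @ drop (Suc i) rs) ! r) ((take j cs @ drop (Suc j) cs) ! c))"
proof -
  have nth: "(take i xs @ drop (Suc i) xs) ! k = xs ! (if k < i then k else Suc k)"
    if "i < length xs" "k < length xs - 1" for i k and xs :: "'z list"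
    using that by (auto simp: nth_append)
  show ?thesis
    using assms by (intro eq_matI) (auto simp: mat_delete_def nth)
qed

lemma minor_expand_row:
  assumes "length (A @ r # B) = length cs"
  shows "minor g (A @ r # B) cs = (\<Sum>j<length cs. g r (cs ! j) * ((- 1) ^ (length A + j) *
    minor g (A @ B) (take j cs @ drop (Suc j) cs)))"
proof -
  let ?rs = "A @ r # B" let ?i = "length A"
  let ?M = "mat (length ?rs) (length cs) (\<lambda>(r, c). g (?rs ! r) (cs ! c))"
  have M: "?M \<in> carrier_mat (length cs) (length cs)" using assms by auto
  have "det ?M = (\<Sum>j<length cs. ?M $$ (?i, j) * cofactor ?M ?i j)"
    by (rule laplace_expansion_row[OF M]) (use assms in auto)
  also have "\<dots> = (\<Sum>j<length cs. g r (cs ! j) * ((- 1) ^ (length A + j) *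
    minor g (A @ B) (take j cs @ drop (Suc j) cs)))"
  proof (intro sum.cong refl)
    fix j assume "j \<in> {..<length cs}"
    then have j: "j < length cs" by simp
    have "mat_delete ?M ?i j = mat (length (A @ B)) (length (take j cs @ drop (Suc j) cs))
      (\<lambda>(r, c). g ((A @ B) ! r) ((take j cs @ drop (Suc j) cs) ! c))"
      using mat_delete_lists[of ?i ?rs j cs g] j by simp
    then have "det (mat_delete ?M ?i j) = minor g (A @ B) (take j cs @ drop (Suc j) cs)"
      unfolding minor_def by simp
    moreover have "?M $$ (?i, j) = g r (cs ! j)"
      using j by (simp add: nth_append)
    ultimately show "?M $$ (?i, j) * cofactor ?M ?i j = g r (cs ! j) * ((- 1) ^ (length A + j) *
      minor g (A @ B) (take j cs @ drop (Suc j) cs))"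
      by (simp add: cofactor_def)
  qed
  finally show ?thesis unfolding minor_def .
qed

text \<open>
  The Laplace expansions of both sides along the row of \<open>r\<close> differ by a sign only.
\<close>

lemma minor_front_row:
  assumes "length (A @ r # B) = length cs"
  shows "minor g (A @ r # B) cs = (- 1) ^ length A * minor g (r # A @ B) cs"
proof -
  show ?thesis
    using minor_expand_row[of "[]" r "A @ B" cs g] assms
    unfolding minor_expand_row[OF assms] by (simp add: power_add sum_distrib_left ac_simps)
qed

lemma minor_front_col:
  assumes "length rs = length (A @ c # B)"
  shows "minor g rs (A @ c # B) = (- 1) ^ length A * minor g rs (c # A @ B)"
  using minor_front_row[of A c B rs "\<lambda>c r. g r c"] assms
    minor_transpose[of rs "A @ c # B" g] minor_transpose[of rs "c # A @ B" g] by simp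

text \<open>A minor is an affine function of each of its entries; the slope is a cofactor.\<close>

lemma minor_change_entry:
  assumes len: "length (A @ r # B) = length (C @ c # D)"
    and same: "\<And>r' c'. r' \<in> set (A @ r # B) \<Longrightarrow> c' \<in> set (C @ c # D) \<Longrightarrow>
      \<not> (r' = r \<and> c' = c) \<Longrightarrow> g r' c' = g' r' c'"
    and r: "r \<notin> set (A @ B)" and c: "c \<notin> set (C @ D)"
  shows "minor g (A @ r # B) (C @ c # D) = minor g' (A @ r # B) (C @ c # D)
    + (- 1) ^ (length A + length C) * (g r c - g' r c) * minor g' (A @ B) (C @ D)"
proof -
  let ?cs = "C @ c # D"
  let ?m = "\<lambda>j. (- 1) ^ (length A + j) * minor g' (A @ B) (take j ?cs @ drop (Suc j) ?cs)"
  have m: "minor g (A @ B) cs' = minor g' (A @ B) cs'" if "set cs' \<subseteq> set ?cs" for cs'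
    by (rule minor_cong) (use that r in \<open>auto intro!: same\<close>)
  have "minor g (A @ r # B) ?cs - minor g' (A @ r # B) ?cs
    = (\<Sum>j<length ?cs. g r (?cs ! j) * ?m j) - (\<Sum>j<length ?cs. g' r (?cs ! j) * ?m j)"
    unfolding minor_expand_row[OF len]
    by (intro arg_cong2[of _ _ _ _ "(-)"] sum.cong refl)
      (subst m, auto dest: in_set_takeD in_set_dropD simp del: append_Cons)
  also have "\<dots> = (\<Sum>j<length ?cs. (g r (?cs ! j) - g' r (?cs ! j)) * ?m j)"
    by (simp add: sum_subtractf left_diff_distrib)
  also have "\<dots> = (\<Sum>j<length ?cs. if j = length C then (g r c - g' r c) * ?m j else 0)"
  proof (intro sum.cong refl)
    fix j assume j: "j \<in> {..<length ?cs}"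
    show "(g r (?cs ! j) - g' r (?cs ! j)) * ?m j
      = (if j = length C then (g r c - g' r c) * ?m j else 0)"
    proof (cases "j = length C")
      case False
      then have "?cs ! j \<in> set (C @ D)"
        using j by (auto simp: nth_append nth_Cons split: nat.splits)
      then have "g r (?cs ! j) = g' r (?cs ! j)"
        using c by (intro same) auto
      then show ?thesis using False by simp
    qed simp
  qed
  finally show ?thesis by (simp add: algebra_simps)
qed

lemma minor_eq_0_iff:
  fixes g :: "'a \<Rightarrow> 'b \<Rightarrow> 'f::field"
  assumes len: "length rs = length cs" and dist: "distinct cs"
  shows "minor g rs cs = 0 \<longleftrightarrow>
    (\<exists>v. (\<exists>c\<in>set cs. v c \<noteq> 0) \<and> (\<forall>r\<in>set rs. (\<Sum>c\<in>set cs. g r c * v c) = 0))"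
proof -
  let ?n = "length cs"
  let ?A = "mat (length rs) ?n (\<lambda>(r, c). g (rs ! r) (cs ! c))"
  have A: "?A \<in> carrier_mat ?n ?n" using len by auto
  have sum: "(\<Sum>c\<in>set cs. h c) = (\<Sum>j = 0..<?n. h (cs ! j))" for h :: "'b \<Rightarrow> 'f"
    using sum.reindex_bij_betw[OF bij_betw_nth[OF dist refl refl], of h]
    by (simp add: atLeast0LessThan)
  have prod: "(?A *\<^sub>v v) $ i = (\<Sum>j = 0..<?n. g (rs ! i) (cs ! j) * v $ j)"
    if "i < ?n" "v \<in> carrier_vec ?n" for i v
    using that len by (simp add: mult_mat_vec_def scalar_prod_def)
  have "det ?A = 0 \<longleftrightarrow> (\<exists>v. v \<in> carrier_vec ?n \<and> v \<noteq> 0\<^sub>v ?n \<and> ?A *\<^sub>v v = 0\<^sub>v ?n)"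
    by (rule det_0_iff_vec_prod_zero[OF A])
  also have "\<dots> \<longleftrightarrow> (\<exists>v. (\<exists>c\<in>set cs. v c \<noteq> 0) \<and> (\<forall>r\<in>set rs. (\<Sum>c\<in>set cs. g r c * v c) = 0))"
  proof
    assume "\<exists>v. v \<in> carrier_vec ?n \<and> v \<noteq> 0\<^sub>v ?n \<and> ?A *\<^sub>v v = 0\<^sub>v ?n"
    then obtain v where v: "v \<in> carrier_vec ?n" "v \<noteq> 0\<^sub>v ?n" "?A *\<^sub>v v = 0\<^sub>v ?n" by blast
    define w where "w c = v $ (SOME j. j < ?n \<and> cs ! j = c)" for c
    have w: "w (cs ! j) = v $ j" if j: "j < ?n" for j
    proof -
      have "(SOME i. i < ?n \<and> cs ! i = cs ! j) = j"
        using j dist by (intro some_equality) (auto simp: nth_eq_iff_index_eq)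
      then show ?thesis by (simp add: w_def)
    qed
    obtain j where j: "j < ?n" "v $ j \<noteq> 0"
      using v(1,2) eq_vecI[of v "0\<^sub>v ?n"] by auto
    have "w (cs ! j) \<noteq> 0" using w j by simp
    then have "\<exists>c\<in>set cs. w c \<noteq> 0" using j(1) by (intro bexI[of _ "cs ! j"]) auto
    moreover have "(\<Sum>c\<in>set cs. g r c * w c) = 0" if r: "r \<in> set rs" for r
    proof -
      obtain i where "i < length rs" "rs ! i = r" using r by (auto simp: in_set_conv_nth)
      then have i: "i < ?n" "rs ! i = r" by (simp_all add: len)
      have "(?A *\<^sub>v v) $ i = 0" using v(3) i(1) by simp
      then show ?thesis using prod[OF i(1) v(1)] i(2) w by (simp add: sum)
    qed
    ultimately show "\<exists>v. (\<exists>c\<in>set cs. v c \<noteq> 0) \<and> (\<forall>r\<in>set rs. (\<Sum>c\<in>set cs. g r c * v c) = 0)"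
      by blast
  next
    assume "\<exists>v. (\<exists>c\<in>set cs. v c \<noteq> 0) \<and> (\<forall>r\<in>set rs. (\<Sum>c\<in>set cs. g r c * v c) = 0)"
    then obtain w where w: "\<exists>c\<in>set cs. w c \<noteq> 0" "\<forall>r\<in>set rs. (\<Sum>c\<in>set cs. g r c * w c) = 0"
      by blast
    define v where "v = vec ?n (\<lambda>j. w (cs ! j))"
    have v: "v \<in> carrier_vec ?n" by (simp add: v_def)
    from w(1) obtain j where j: "j < ?n" "w (cs ! j) \<noteq> 0" by (auto simp: in_set_conv_nth)
    then have "v $ j \<noteq> 0\<^sub>v ?n $ j"
      by (simp add: v_def)
    then have "v \<noteq> 0\<^sub>v ?n" by auto
    moreover have "?A *\<^sub>v v = 0\<^sub>v ?n"
    proof (rule eq_vecI)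
      fix i assume "i < dim_vec (0\<^sub>v ?n :: 'f vec)"
      then have i: "i < ?n" by simp
      have "(\<Sum>j = 0..<?n. g (rs ! i) (cs ! j) * v $ j) = (\<Sum>c\<in>set cs. g (rs ! i) c * w c)"
        by (simp add: sum v_def)
      also have "\<dots> = 0" using w(2) i len by simp
      finally show "(?A *\<^sub>v v) $ i = 0\<^sub>v ?n $ i" using prod[OF i v] i by simp
    qed (use len in simp)
    ultimately show "\<exists>v. v \<in> carrier_vec ?n \<and> v \<noteq> 0\<^sub>v ?n \<and> ?A *\<^sub>v v = 0\<^sub>v ?n"
      using v by blast
  qed
  finally show ?thesis unfolding minor_def .
qed

lemma det_2x2:
  assumes "A \<in> carrier_mat 2 2"
  shows "det A = A $$ (0, 0) * A $$ (1, 1) - A $$ (0, 1) * A $$ (1, 0)"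
proof -
  have d: "det (mat_delete A 0 j) = A $$ (1, if j = 0 then 1 else 0)" if "j < 2" for j
  proof -
    have "mat_delete A 0 j \<in> carrier_mat 1 1" using mat_delete_carrier[OF assms, of 0 j] by simp
    then show ?thesis
      using that assms by (subst det_single) (auto simp: mat_delete_def)
  qed
  have "det A = (\<Sum>j<2. A $$ (0, j) * cofactor A 0 j)"
    by (rule laplace_expansion_row[OF assms]) simp
  then show ?thesis by (simp add: cofactor_def d numeral_2_eq_2)
qed

text \<open>
  The Desnanot--Jacobi identity for the first two rows and columns.  Replacing the first two
  columns of the identity matrix by those of the adjugate and multiplying with the matrix
  gives the identity up to a factor \<open>det X\<close>.
\<close>

lemma Desnanot_Jacobi_nonsingular:
  fixes X :: "'a::idom mat"
  assumes X: "X \<in> carrier_mat (2 + n) (2 + n)" and nz: "det X \<noteq> 0"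
  shows "det X * det (mat n n (\<lambda>(i, j). X $$ (i + 2, j + 2)))
    = det (mat_delete X 0 0) * det (mat_delete X 1 1) - det (mat_delete X 0 1) * det (mat_delete X 1 0)"
proof -
  let ?m = "2 + n"
  define d where "d = det X"
  define X22 where "X22 = mat n n (\<lambda>(i, j). X $$ (i + 2, j + 2))"
  define Y11 where "Y11 = mat 2 2 (\<lambda>(i, j). cofactor X j i)"
  define Y21 where "Y21 = mat n 2 (\<lambda>(i, j). cofactor X j (i + 2))"
  define Y where "Y = four_block_mat Y11 (0\<^sub>m 2 n) Y21 (1\<^sub>m n)"
  have Y: "Y \<in> carrier_mat ?m ?m"
    unfolding Y_def by (rule four_block_carrier_mat) (simp_all add: Y11_def)
  have adj: "(\<Sum>k = 0..<?m. X $$ (i, k) * cofactor X j k) = (if i = j then d else 0)"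
    if "i < ?m" "j < ?m" for i j
  proof -
    have "(X * adj_mat X) $$ (i, j) = (d \<cdot>\<^sub>m 1\<^sub>m ?m) $$ (i, j)"
      using adj_mat(2)[OF X] by (simp add: d_def)
    then show ?thesis
      using that X by (simp add: adj_mat_def scalar_prod_def)
  qed
  have Yadj: "Y $$ (k, j) = cofactor X j k" if "k < ?m" "j < 2" for k j
  proof -
    have "Suc (Suc (k - 2)) = k" if "\<not> k < 2" using that by simp
    then show ?thesis
      using that by (auto simp: Y_def Y11_def Y21_def)
  qed
  have Yid: "Y $$ (k, j) = (if k = j then 1 else 0)" if "k < ?m" "2 \<le> j" "j < ?m" for k j
    using that by (auto simp: Y_def Y11_def Y21_def)
  have XY: "X * Y = four_block_mat (d \<cdot>\<^sub>m 1\<^sub>m 2) (mat 2 n (\<lambda>(i, j). X $$ (i, j + 2))) (0\<^sub>m n 2) X22"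
    (is "_ = ?R")
  proof (rule eq_matI)
    fix i j assume "i < dim_row ?R" "j < dim_col ?R"
    then have ij: "i < ?m" "j < ?m" by (auto simp: X22_def)
    have eq: "(X * Y) $$ (i, j) = (\<Sum>k = 0..<?m. X $$ (i, k) * Y $$ (k, j))"
      using ij X Y by (simp add: scalar_prod_def)
    show "(X * Y) $$ (i, j) = ?R $$ (i, j)"
    proof (cases "j < 2")
      case True
      then have "(X * Y) $$ (i, j) = (if i = j then d else 0)"
        unfolding eq adj[OF ij, symmetric] by (intro sum.cong) (auto simp: Yadj)
      then show ?thesis using ij True by (auto simp: X22_def)
    next
      case False
      then have "(X * Y) $$ (i, j) = (\<Sum>k = 0..<?m. if k = j then X $$ (i, j) else 0)"
        unfolding eq by (intro sum.cong) (use ij in \<open>auto simp: Yid\<close>)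
      moreover have "Suc (Suc (k - 2)) = k" if "\<not> k < 2" for k using that by simp
      ultimately show ?thesis using ij False by (auto simp: X22_def)
    qed
  qed (use X Y in \<open>auto simp: X22_def\<close>)
  have "d * det Y = det (X * Y)"
    by (simp add: det_mult[OF X Y] d_def)
  also have "\<dots> = det (d \<cdot>\<^sub>m 1\<^sub>m 2) * det X22"
    unfolding XY by (rule det_four_block_mat_lower_left_zero) (auto simp: X22_def)
  also have "\<dots> = d * (d * det X22)"
    by (simp add: power2_eq_square)
  finally have "det Y = d * det X22"
    using nz by (simp add: d_def)
  moreover have "det Y = det Y11 * det (1\<^sub>m n)"
    unfolding Y_def by (rule det_four_block_mat_upper_right_zero) (auto simp: Y11_def Y21_def)
  moreover have "det Y11 = cofactor X 0 0 * cofactor X 1 1 - cofactor X 1 0 * cofactor X 0 1"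
    by (subst det_2x2) (auto simp: Y11_def)
  ultimately show ?thesis
    by (simp add: X22_def d_def cofactor_def algebra_simps)
qed

text \<open>
  A singular matrix is perturbed by a multiple \<open>t\<close> of the identity, where \<open>t\<close> is
  transcendental; the identity is then specialised to \<open>t = 0\<close>.
\<close>

lemma Desnanot_Jacobi:
  fixes X :: "'a::idom mat"
  assumes X: "X \<in> carrier_mat (2 + n) (2 + n)"
  shows "det X * det (mat n n (\<lambda>(i, j). X $$ (i + 2, j + 2)))
    = det (mat_delete X 0 0) * det (mat_delete X 1 1) - det (mat_delete X 0 1) * det (mat_delete X 1 0)"
proof -
  note hom_det = comm_ring_hom.hom_det[OF comm_ring_hom_poly, of 0]
  let ?h = "map_mat (\<lambda>p. poly p (0 :: 'a))"
  define X' where "X' = char_poly_matrix (- X)"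
  have X': "X' \<in> carrier_mat (2 + n) (2 + n)" using X by (simp add: X'_def)
  have "coeff (det X') (2 + n) = 1"
    using degree_monic_char_poly[of "- X" "2 + n"] X by (simp add: X'_def char_poly_def)
  then have nz: "det X' \<noteq> 0" by auto
  have hX: "?h X' = X"
    using X by (intro eq_matI) (auto simp: X'_def char_poly_matrix_def)
  have hdel: "?h (mat_delete X' i j) = mat_delete X i j" if "i < 2" "j < 2" for i j
    unfolding hX[symmetric] using X' that
    by (intro eq_matI) (auto simp: mat_delete_def)
  have hdels: "?h (mat_delete X' 0 0) = mat_delete X 0 0" "?h (mat_delete X' 1 1) = mat_delete X 1 1"
    "?h (mat_delete X' 0 1) = mat_delete X 0 1" "?h (mat_delete X' 1 0) = mat_delete X 1 0"
    by (rule hdel; simp)+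
  have h22: "?h (mat n n (\<lambda>(i, j). X' $$ (i + 2, j + 2))) = mat n n (\<lambda>(i, j). X $$ (i + 2, j + 2))"
    unfolding hX[symmetric] using X' by (intro eq_matI) auto
  have "poly (det X' * det (mat n n (\<lambda>(i, j). X' $$ (i + 2, j + 2)))) 0
    = poly (det (mat_delete X' 0 0) * det (mat_delete X' 1 1)
      - det (mat_delete X' 0 1) * det (mat_delete X' 1 0)) 0"
    unfolding Desnanot_Jacobi_nonsingular[OF X' nz] ..
  then show ?thesis
    by (simp only: poly_mult poly_diff hom_det[symmetric] hX hdels h22)
qed

lemma minor_Desnanot_Jacobi_front:
  fixes g :: "'a \<Rightarrow> 'b \<Rightarrow> 'f::idom"
  assumes "length A = length A'"
  shows "minor g (r # s # A) (r' # s' # A') * minor g A A'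
    = minor g (s # A) (s' # A') * minor g (r # A) (r' # A')
      - minor g (s # A) (r' # A') * minor g (r # A) (s' # A')"
proof -
  let ?n = "length A" let ?rs = "r # s # A" let ?cs = "r' # s' # A'"
  let ?X = "mat (length ?rs) (length ?cs) (\<lambda>(i, j). g (?rs ! i) (?cs ! j))"
  have X: "?X \<in> carrier_mat (2 + ?n) (2 + ?n)" using assms by auto
  have del: "det (mat_delete ?X i j)
      = minor g (take i ?rs @ drop (Suc i) ?rs) (take j ?cs @ drop (Suc j) ?cs)"
    if "i < 2" "j < 2" for i j
    unfolding minor_def using that by (subst mat_delete_lists) auto
  have X22: "mat ?n ?n (\<lambda>(i, j). ?X $$ (i + 2, j + 2))
      = mat (length A) (length A') (\<lambda>(i, j). g (A ! i) (A' ! j))"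
    using assms by (intro eq_matI) auto
  have "det (mat_delete ?X 0 0) = minor g (s # A) (s' # A')"
    "det (mat_delete ?X 1 1) = minor g (r # A) (r' # A')"
    "det (mat_delete ?X 0 1) = minor g (s # A) (r' # A')"
    "det (mat_delete ?X 1 0) = minor g (r # A) (s' # A')"
    by (subst del; simp)+
  then show ?thesis
    using Desnanot_Jacobi[OF X]
    unfolding minor_def[of g ?rs ?cs] minor_def[of g A A'] X22 by metis
qed

text \<open>
  Moving the two rows and the two columns to the front multiplies each of the three products by the
  same sign.
\<close>

lemma minor_Desnanot_Jacobi:
  fixes g :: "'a \<Rightarrow> 'b \<Rightarrow> 'f::idom"
  assumes len: "length (A @ B @ C) = length (A' @ B' @ C')"
  shows "minor g (A @ r # B @ s # C) (A' @ r' # B' @ s' # C') * minor g (A @ B @ C) (A' @ B' @ C')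
    = minor g (A @ B @ s # C) (A' @ B' @ s' # C') * minor g (A @ r # B @ C) (A' @ r' # B' @ C')
      - minor g (A @ B @ s # C) (A' @ r' # B' @ C') * minor g (A @ r # B @ C) (A' @ B' @ s' # C')"
proof -
  let ?R = "A @ B @ C" let ?R' = "A' @ B' @ C'"
  let ?e = "\<lambda>n. (- 1) ^ n :: 'f"
  have r1: "minor g (A @ r # B @ s # C) cs = ?e (length B) * minor g (r # s # ?R) cs"
    if "length cs = Suc (Suc (length ?R))" for cs
    using that minor_front_row[of A r "B @ s # C" cs g] minor_front_row[of "r # A @ B" s C cs g]
      minor_front_row[of "[s]" r ?R cs g]
    by (simp add: power_add)
  have c1: "minor g rs (A' @ r' # B' @ s' # C') = ?e (length B') * minor g rs (r' # s' # ?R')"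
    if "length rs = Suc (Suc (length ?R'))" for rs
    using that minor_front_col[of rs A' r' "B' @ s' # C'" g] minor_front_col[of rs "r' # A' @ B'" s' C' g]
      minor_front_col[of rs "[s']" r' ?R' g]
    by (simp add: power_add)
  have r2: "minor g (A @ B @ s # C) cs = ?e (length A + length B) * minor g (s # ?R) cs"
    if "length cs = Suc (length ?R)" for cs
    using that minor_front_row[of "A @ B" s C cs g] by simp
  have c2: "minor g rs (A' @ B' @ s' # C') = ?e (length A' + length B') * minor g rs (s' # ?R')"
    if "length rs = Suc (length ?R')" for rs
    using that minor_front_col[of rs "A' @ B'" s' C' g] by simp
  have r3: "minor g (A @ r # B @ C) cs = ?e (length A) * minor g (r # ?R) cs"
    if "length cs = Suc (length ?R)" for cs
    using that minor_front_row[of A r "B @ C" cs g] by simp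
  have c3: "minor g rs (A' @ r' # B' @ C') = ?e (length A') * minor g rs (r' # ?R')"
    if "length rs = Suc (length ?R')" for rs
    using that minor_front_col[of rs A' r' "B' @ C'" g] by simp
  have sq: "?e n * ?e n = 1" for n
    by (simp add: power_mult_distrib[symmetric])
  have sq': "?e n * (?e n * z) = z" for n z
    by (simp add: mult.assoc[symmetric] sq)
  show ?thesis
    using minor_Desnanot_Jacobi_front[OF len, of g r s r' s'] len
    by (simp add: r1 r2 r3 c1 c2 c3 power_add sq sq' mult_ac right_diff_distrib[symmetric])
qed

section \<open>Configuration matrices and Dodgson polynomials\<close>

text \<open>
  The matrix \<open>M\<close> of a graph with an arbitrary matrix \<open>E\<close> in place of the incidence matrix. The ring is
  arbitrary as well: it is the ring of polynomials, a finite field, or a univariate polynomial ring.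
\<close>

fun config_entry :: "('e \<Rightarrow> 'v \<Rightarrow> 'r::comm_ring_1) \<Rightarrow> ('e \<Rightarrow> 'r) \<Rightarrow> 'e + 'v \<Rightarrow> 'e + 'v \<Rightarrow> 'r" where
  "config_entry E x (Inl e) (Inl f) = (if e = f then x e else 0)"
| "config_entry E x (Inl e) (Inr v) = E e v"
| "config_entry E x (Inr v) (Inl e) = - E e v"
| "config_entry E x (Inr v) (Inr w) = 0"

definition labels :: "'e list \<Rightarrow> 'v list \<Rightarrow> 'e set \<Rightarrow> ('e + 'v) list" where
  "labels es vs I = map Inl (filter (\<lambda>e. e \<notin> I) es) @ map Inr vs"

definition config_minor ::
  "('e \<Rightarrow> 'v \<Rightarrow> 'r::comm_ring_1) \<Rightarrow> 'e list \<Rightarrow> 'v list \<Rightarrow> 'e set \<Rightarrow> 'e set \<Rightarrow> ('e \<Rightarrow> 'r) \<Rightarrow> 'r" where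
  "config_minor E es vs I J x = minor (config_entry E x) (labels es vs I) (labels es vs J)"

text \<open>
  The image of the incidence matrix in an arbitrary ring.
\<close>

definition incidence_value :: "('v, 'e) pre_digraph \<Rightarrow> 'e \<Rightarrow> 'v \<Rightarrow> 'r::comm_ring_1" where
  "incidence_value G e v = (if tail G e = v \<and> head G e \<noteq> v then 1
     else if head G e = v \<and> tail G e \<noteq> v then - 1 else 0)"

lemma eval_dodgson:
  "eval_mpoly x (dodgson G es vs I J K)
    = config_minor (incidence_value G) es vs I J (\<lambda>e. if e \<in> K then 0 else x e)"
proof -
  have "eval_mpoly x (graph_entry G K r c)
    = config_entry (incidence_value G) (\<lambda>e. if e \<in> K then 0 else x e) r c" for r c
    by (cases r rule: sum.exhaust; cases c rule: sum.exhaust) (auto simp: incidence_def incidence_value_def eval_mpoly.hom_uminus eval_mpoly_0 eval_mpoly_1)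
  moreover have "dodgson G es vs I J K = minor (graph_entry G K) (labels es vs I) (labels es vs J)"
    unfolding dodgson_def minor_def labels_def Let_def ..
  ultimately show ?thesis
    by (simp add: minor_hom[OF eval_mpoly.comm_ring_hom_axioms] config_minor_def)
qed

lemma set_labels: "set (labels es vs I) = Inl ` (set es - I) \<union> Inr ` set vs"
  by (auto simp: labels_def)

lemma distinct_labels: "distinct es \<Longrightarrow> distinct vs \<Longrightarrow> distinct (labels es vs I)"
  by (auto simp: labels_def distinct_map)

lemma length_labels:
  assumes "distinct es" "I \<subseteq> set es"
  shows "length (labels es vs I) = length es - card I + length vs"
proof -
  have "length (filter (\<lambda>e. e \<notin> I) es) = card (set es - I)"
    using assms(1) distinct_card[of "filter (\<lambda>e. e \<notin> I) es"] by (simp add: set_diff_eq)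
  also have "\<dots> = length es - card I"
    using assms by (simp add: card_Diff_subset finite_subset[OF assms(2)] distinct_card)
  finally show ?thesis by (simp add: labels_def)
qed

text \<open>
  The coefficient of the product of the variables of \<open>I\<close> is the polynomial of the graph without the edges \<open>I\<close>.
\<close>

lemma config_minor_delete:
  "config_minor E es vs I I x = config_minor E (filter (\<lambda>e. e \<notin> I) es) vs {} {} x"
  by (simp add: config_minor_def labels_def)

lemma config_minor_cong:
  assumes "\<And>e. e \<in> set es - (I \<union> J) \<Longrightarrow> x e = y e"
  shows "config_minor E es vs I J x = config_minor E es vs I J y"
  unfolding config_minor_def
proof (rule minor_cong)
  fix r c assume "r \<in> set (labels es vs I)" "c \<in> set (labels es vs J)"
  then show "config_entry E x r c = config_entry E y r c"
    using assms by (cases r rule: sum.exhaust; cases c rule: sum.exhaust) (auto simp: set_labels)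
qed

text \<open>
  The position of \<open>m\<close> among the rows \<open>I\<close> and columns \<open>J\<close> removed before it decides the sign with
  which the diagonal entry of \<open>m\<close> contributes.
\<close>

definition position_sign :: "'e list \<Rightarrow> 'e set \<Rightarrow> 'e set \<Rightarrow> 'e \<Rightarrow> 'r::comm_ring_1" where
  "position_sign es I J m = (let B = set (takeWhile (\<lambda>e. e \<noteq> m) es)
     in (- 1) ^ (card (I \<inter> B) + card (J \<inter> B)))"

lemma position_sign_same [simp]: "position_sign es I I m = 1"
  by (simp add: position_sign_def Let_def)

lemma position_sign_square: "position_sign es I J m * position_sign es I J m = 1"
  by (simp add: position_sign_def Let_def power_mult_distrib[symmetric])

lemma position_sign_cases: "position_sign es I J m \<in> {1, - 1}"
  by (simp add: position_sign_def Let_def minus_one_power_iff)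

lemma labels_split:
  assumes "es = xs @ m # ys" "m \<notin> I" "distinct es"
  shows "labels es vs I = map Inl (filter (\<lambda>e. e \<notin> I) xs) @ Inl m # (map Inl (filter (\<lambda>e. e \<notin> I) ys) @ map Inr vs)"
    "labels es vs (insert m I) = map Inl (filter (\<lambda>e. e \<notin> I) xs) @ (map Inl (filter (\<lambda>e. e \<notin> I) ys) @ map Inr vs)"
proof -
  have "filter (\<lambda>e. e \<notin> insert m I) ws = filter (\<lambda>e. e \<notin> I) ws" if "m \<notin> set ws" for ws
    using that by (intro filter_cong) auto
  moreover have "m \<notin> set xs" "m \<notin> set ys" using assms by auto
  ultimately show "labels es vs I = map Inl (filter (\<lambda>e. e \<notin> I) xs) @ Inl m # (map Inl (filter (\<lambda>e. e \<notin> I) ys) @ map Inr vs)"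
    "labels es vs (insert m I) = map Inl (filter (\<lambda>e. e \<notin> I) xs) @ (map Inl (filter (\<lambda>e. e \<notin> I) ys) @ map Inr vs)"
    using assms by (simp_all add: labels_def)
qed

text \<open>
  The variable of \<open>m\<close> occurs in one entry only.
\<close>

lemma config_minor_expand:
  fixes E :: "'e \<Rightarrow> 'v \<Rightarrow> 'r::comm_ring_1"
  assumes es: "distinct es" and IJ: "I \<subseteq> set es" "J \<subseteq> set es" "card I = card J"
    and m: "m \<in> set es" "m \<notin> I" "m \<notin> J"
  shows "config_minor E es vs I J x
    = position_sign es I J m * x m * config_minor E es vs (insert m I) (insert m J) x
      + config_minor E es vs I J (x(m := 0))"
proof -
  obtain xs ys where split: "es = xs @ m # ys" using m(1) by (auto simp: in_set_conv_decomp)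
  have xs: "takeWhile (\<lambda>e. e \<noteq> m) es = xs"
    using es by (auto simp: split takeWhile_append)
  let ?f = "\<lambda>I xs. map Inl (filter (\<lambda>e. e \<notin> I) xs) :: ('e + 'v) list"
  note lI = labels_split[OF split m(2) es, of vs] and lJ = labels_split[OF split m(3) es, of vs]
  have len: "length (labels es vs I) = length (labels es vs J)"
    using length_labels[OF es IJ(1), of vs] length_labels[OF es IJ(2), of vs] IJ(3) by simp
  have notin: "Inl m \<notin> set (?f I xs @ (?f I ys @ map Inr vs))" for I
    using es by (auto simp: split)
  have same: "config_entry E x r c = config_entry E (x(m := 0)) r c" if "\<not> (r = Inl m \<and> c = Inl m)" for r c
    using that by (cases r; cases c) auto
  have "config_minor E es vs I J x = config_minor E es vs I J (x(m := 0))
    + (- 1) ^ (length (?f I xs) + length (?f J xs)) * (x m - 0)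
      * config_minor E es vs (insert m I) (insert m J) (x(m := 0))"
    unfolding config_minor_def lI lJ
    by (subst minor_change_entry[OF len[unfolded lI lJ] same notin notin]) simp_all
  moreover have "config_minor E es vs (insert m I) (insert m J) (x(m := 0))
      = config_minor E es vs (insert m I) (insert m J) x"
    by (rule config_minor_cong) auto
  moreover have "(- 1) ^ (length (?f I xs) + length (?f J xs)) = (position_sign es I J m :: 'r)"
  proof -
    have dx: "distinct xs" using es by (simp add: split)
    have "length (filter (\<lambda>e. e \<notin> I) xs) + card (I \<inter> set xs) = length xs" for I
    proof -
      have "length (filter (\<lambda>e. e \<notin> I) xs) = card (set xs - I)"
        using dx distinct_card[of "filter (\<lambda>e. e \<notin> I) xs"] by (simp add: set_diff_eq)
      moreover have "card (set xs - I) + card (I \<inter> set xs) = card (set xs)"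
        by (metis List.finite_set Int_commute add.commute card_Int_Diff)
      ultimately show ?thesis using distinct_card[OF dx] by simp
    qed
    from this[of I] this[of J]
    have "even (length (filter (\<lambda>e. e \<notin> I) xs) + length (filter (\<lambda>e. e \<notin> J) xs))
      \<longleftrightarrow> even (card (I \<inter> set xs) + card (J \<inter> set xs))" by presburger
    then show ?thesis
      by (simp add: position_sign_def Let_def xs minus_one_power_iff)
  qed
  ultimately show ?thesis by (simp add: algebra_simps)
qed

text \<open>
  Replacing the edge \<open>m\<close> by a self-loop turns its row of the incidence matrix into zero and
  isolates the leading coefficient in \<open>x m\<close>.
\<close>

lemma config_minor_loop:
  assumes es: "distinct es" and IJ: "I \<subseteq> set es" "J \<subseteq> set es" "card I = card J"
    and m: "m \<in> set es" "m \<notin> I" "m \<notin> J"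
  shows "config_minor (E(m := \<lambda>_. 0)) es vs I J x
    = position_sign es I J m * x m * config_minor E es vs (insert m I) (insert m J) x"
proof -
  let ?E = "E(m := \<lambda>_. 0)"
  obtain xs ys where split: "es = xs @ m # ys" using m(1) by (auto simp: in_set_conv_decomp)
  have len: "length (labels es vs I) = length (labels es vs J)"
    using length_labels[OF es IJ(1), of vs] length_labels[OF es IJ(2), of vs] IJ(3) by simp
  have row: "config_entry ?E (x(m := 0)) (Inl m) c = 0" for c
    by (cases c) auto
  have "config_minor ?E es vs I J (x(m := 0)) = 0"
    using len unfolding config_minor_def labels_split(1)[OF split m(2) es]
    by (subst minor_expand_row) (auto simp: row)
  moreover have "config_minor ?E es vs (insert m I) (insert m J) x
      = config_minor E es vs (insert m I) (insert m J) x"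
    unfolding config_minor_def
  proof (rule minor_cong)
    fix r c assume "r \<in> set (labels es vs (insert m I))" "c \<in> set (labels es vs (insert m J))"
    then show "config_entry ?E x r c = config_entry E x r c"
      by (cases r rule: sum.exhaust; cases c rule: sum.exhaust) (auto simp: set_labels)
  qed
  ultimately show ?thesis
    using config_minor_expand[OF assms, of ?E vs x] by simp
qed

text \<open>
  The edges \<open>a\<close> and \<open>b\<close> occur in the same order among the rows and among the columns; the identity is
  symmetric in \<open>a\<close> and \<open>b\<close>, so that \<open>a\<close> may be assumed to come first.
\<close>

lemma config_minor_Dodgson:
  fixes E :: "'e \<Rightarrow> 'v \<Rightarrow> 'f::idom"
  assumes es: "distinct es" and IJ: "I \<subseteq> set es" "J \<subseteq> set es" "card I = card J"
    and ab: "a \<in> set es - (I \<union> J)" "b \<in> set es - (I \<union> J)" "a \<noteq> b"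
  shows "config_minor E es vs I J x * config_minor E es vs (insert a (insert b I)) (insert a (insert b J)) x
    = config_minor E es vs (insert a I) (insert a J) x * config_minor E es vs (insert b I) (insert b J) x
      - config_minor E es vs (insert a I) (insert b J) x * config_minor E es vs (insert b I) (insert a J) x"
proof -
  have main: "config_minor E es vs I J x * config_minor E es vs (insert a (insert b I)) (insert a (insert b J)) x
    = config_minor E es vs (insert a I) (insert a J) x * config_minor E es vs (insert b I) (insert b J) x
      - config_minor E es vs (insert a I) (insert b J) x * config_minor E es vs (insert b I) (insert a J) x"
    if ab: "a \<notin> I" "a \<notin> J" "b \<notin> I" "b \<notin> J" "a \<noteq> b"
      and split: "es = xs @ a # ys @ b # zs" for a b xs ys zs
  proof -
    let ?f = "\<lambda>I xs. map Inl (filter (\<lambda>e. e \<notin> I) xs) :: ('e + 'v) list"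
    have d: "a \<notin> set xs" "a \<notin> set ys" "a \<notin> set zs" "b \<notin> set xs" "b \<notin> set ys" "b \<notin> set zs"
      using es by (auto simp: split)
    have l: "labels es vs I = ?f I xs @ Inl a # ?f I ys @ Inl b # (?f I zs @ map Inr vs)"
      "labels es vs (insert a I) = ?f I xs @ ?f I ys @ Inl b # (?f I zs @ map Inr vs)"
      "labels es vs (insert b I) = ?f I xs @ Inl a # ?f I ys @ (?f I zs @ map Inr vs)"
      "labels es vs (insert a (insert b I)) = ?f I xs @ ?f I ys @ (?f I zs @ map Inr vs)"
      if "a \<notin> I" "b \<notin> I" for I
    proof -
      have "filter (\<lambda>e. e \<noteq> a \<and> e \<notin> I) ws = filter (\<lambda>e. e \<notin> I) ws"
        "filter (\<lambda>e. e \<noteq> b \<and> e \<notin> I) ws = filter (\<lambda>e. e \<notin> I) ws"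
        "filter (\<lambda>e. e \<noteq> a \<and> e \<noteq> b \<and> e \<notin> I) ws = filter (\<lambda>e. e \<notin> I) ws"
        if "a \<notin> set ws" "b \<notin> set ws" for ws
        using that by (auto intro!: filter_cong)
      note this[of xs] this[of ys] this[of zs]
      then show "labels es vs I = ?f I xs @ Inl a # ?f I ys @ Inl b # (?f I zs @ map Inr vs)"
        "labels es vs (insert a I) = ?f I xs @ ?f I ys @ Inl b # (?f I zs @ map Inr vs)"
        "labels es vs (insert b I) = ?f I xs @ Inl a # ?f I ys @ (?f I zs @ map Inr vs)"
        "labels es vs (insert a (insert b I)) = ?f I xs @ ?f I ys @ (?f I zs @ map Inr vs)"
        using that ab(5) d by (simp_all add: labels_def split)
    qed
    have len: "length (?f I xs @ ?f I ys @ (?f I zs @ map Inr vs))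
      = length (?f J xs @ ?f J ys @ (?f J zs @ map Inr vs))"
      using length_labels[OF es IJ(1), of vs] length_labels[OF es IJ(2), of vs] IJ(3)
      unfolding l(1)[OF ab(1,3)] l(1)[OF ab(2,4)] by simp
    show ?thesis
      unfolding config_minor_def l[OF ab(1,3)] l[OF ab(2,4)]
      using minor_Desnanot_Jacobi[OF len, of "config_entry E x" "Inl a" "Inl b" "Inl a" "Inl b"]
      by (simp only: mult.commute)
  qed
  obtain xs ys where split: "es = xs @ a # ys" using ab(1) by (auto simp: in_set_conv_decomp)
  with ab have "b \<in> set xs \<or> b \<in> set ys" by auto
  then show ?thesis
  proof
    assume "b \<in> set ys"
    then obtain us ws where "ys = us @ b # ws" by (auto simp: in_set_conv_decomp)
    then show ?thesis using main[of a b xs us ws] ab split by auto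
  next
    assume "b \<in> set xs"
    then obtain us ws where "xs = us @ b # ws" by (auto simp: in_set_conv_decomp)
    then show ?thesis using main[of b a us ws ys] ab split
      by (auto simp: insert_commute mult.commute)
  qed
qed

text \<open>
  The kernel vectors have an edge part \<open>y\<close> and a vertex part \<open>z\<close>.
\<close>

lemma config_minor_eq_0_iff:
  fixes E :: "'e \<Rightarrow> 'v \<Rightarrow> 'f::field"
  assumes es: "distinct es" and vs: "distinct vs" and IJ: "I \<subseteq> set es" "J \<subseteq> set es" "card I = card J"
  shows "config_minor E es vs I J x = 0 \<longleftrightarrow>
    (\<exists>y z. ((\<exists>e\<in>set es - J. y e \<noteq> 0) \<or> (\<exists>v\<in>set vs. z v \<noteq> 0)) \<and>
      (\<forall>e\<in>set es - I. (if e \<in> J then 0 else x e * y e) + (\<Sum>v\<in>set vs. E e v * z v) = 0) \<and>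
      (\<forall>v\<in>set vs. (\<Sum>e\<in>set es - J. E e v * y e) = 0))"
proof -
  have len: "length (labels es vs I) = length (labels es vs J)"
    using length_labels[OF es IJ(1), of vs] length_labels[OF es IJ(2), of vs] IJ(3) by simp
  have sum: "(\<Sum>c\<in>set (labels es vs J). h c) = (\<Sum>e\<in>set es - J. h (Inl e)) + (\<Sum>v\<in>set vs. h (Inr v))"
    for h :: "'e + 'v \<Rightarrow> 'f"
    unfolding set_labels by (subst sum.union_disjoint) (auto simp: sum.reindex)
  have diag: "(\<Sum>f\<in>set es - J. config_entry E x (Inl e) (Inl f) * y f)
      = (if e \<in> J then 0 else x e * y e)" if "e \<in> set es" for e y
  proof -
    have "(\<Sum>f\<in>set es - J. config_entry E x (Inl e) (Inl f) * y f)
        = (\<Sum>f\<in>set es - J. if f = e then x e * y e else 0)"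
      by (intro sum.cong) auto
    then show ?thesis using that by auto
  qed
  have "config_minor E es vs I J x = 0 \<longleftrightarrow> (\<exists>v. (\<exists>c\<in>set (labels es vs J). v c \<noteq> 0) \<and>
    (\<forall>r\<in>set (labels es vs I). (\<Sum>c\<in>set (labels es vs J). config_entry E x r c * v c) = 0))"
    unfolding config_minor_def by (rule minor_eq_0_iff[OF len distinct_labels[OF es vs]])
  also have "\<dots> \<longleftrightarrow> (\<exists>v. ((\<exists>e\<in>set es - J. v (Inl e) \<noteq> 0) \<or> (\<exists>w\<in>set vs. v (Inr w) \<noteq> 0)) \<and>
    (\<forall>e\<in>set es - I. (if e \<in> J then 0 else x e * v (Inl e)) + (\<Sum>w\<in>set vs. E e w * v (Inr w)) = 0) \<and>
    (\<forall>w\<in>set vs. (\<Sum>e\<in>set es - J. E e w * v (Inl e)) = 0))" (is "_ \<longleftrightarrow> (\<exists>v. ?P (\<lambda>e. v (Inl e)) (\<lambda>w. v (Inr w)))")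
    unfolding sum unfolding set_labels by (simp add: diag ball_Un bex_Un sum_negf del: config_entry.simps(1))
  also have "\<dots> \<longleftrightarrow> (\<exists>y z. ?P y z)"
  proof
    assume "\<exists>y z. ?P y z"
    then obtain y z where "?P y z" by blast
    then have "?P (\<lambda>e. case_sum y z (Inl e)) (\<lambda>w. case_sum y z (Inr w))" unfolding sum.case .
    then show "\<exists>v. ?P (\<lambda>e. v (Inl e)) (\<lambda>w. v (Inr w))" by (rule exI[of _ "case_sum y z"])
  next
    assume "\<exists>v. ?P (\<lambda>e. v (Inl e)) (\<lambda>w. v (Inr w))"
    then obtain v where "?P (\<lambda>e. v (Inl e)) (\<lambda>w. v (Inr w))" ..
    then have "\<exists>z. ?P (\<lambda>e. v (Inl e)) z" by (rule exI[of _ "\<lambda>w. v (Inr w)"])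
    then show "\<exists>y z. ?P y z" by (rule exI[of _ "\<lambda>e. v (Inl e)"])
  qed
  finally show ?thesis .
qed

text \<open>
  The configuration matrix is symmetric up to the signs of the rows and columns of the vertices.
\<close>

lemma config_minor_sym:
  fixes E :: "'e \<Rightarrow> 'v \<Rightarrow> 'f::field"
  assumes es: "distinct es" and vs: "distinct vs" and IJ: "I \<subseteq> set es" "J \<subseteq> set es" "card I = card J"
  shows "config_minor E es vs J I x = 0 \<longleftrightarrow> config_minor E es vs I J x = 0"
proof -
  define s :: "'e + 'v \<Rightarrow> 'f" where "s = case_sum (\<lambda>_. 1) (\<lambda>_. - 1)"
  let ?g = "config_entry E x" let ?R = "labels es vs I" let ?C = "labels es vs J"
  have s: "s r * (s r * a) = a" "s r \<noteq> 0" for r a by (cases r; simp add: s_def)+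
  have g: "?g r c = s r * s c * ?g c r" for r c
    by (cases r rule: sum.exhaust; cases c rule: sum.exhaust) (auto simp: s_def)
  have len: "length ?C = length ?R"
    using length_labels[OF es IJ(1), of vs] length_labels[OF es IJ(2), of vs] IJ(3) by simp
  have row: "(\<Sum>r\<in>A. ?g r c * v r) = s c * (\<Sum>r\<in>A. ?g c r * (s r * v r))" for A c v
    unfolding sum_distrib_left
  proof (intro sum.cong refl)
    fix r show "?g r c * v r = s c * (?g c r * (s r * v r))"
      by (subst g) (simp add: mult_ac)
  qed
  have "minor ?g ?R ?C = 0 \<longleftrightarrow> minor (\<lambda>c r. ?g r c) ?C ?R = 0"
    using minor_transpose[of ?R ?C ?g] len by simp
  also have "\<dots> \<longleftrightarrow> (\<exists>v. (\<exists>r\<in>set ?R. v r \<noteq> 0) \<and> (\<forall>c\<in>set ?C. (\<Sum>r\<in>set ?R. ?g r c * v r) = 0))"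
    by (rule minor_eq_0_iff[OF len distinct_labels[OF es vs]])
  also have "\<dots> \<longleftrightarrow> (\<exists>v. (\<exists>r\<in>set ?R. v r \<noteq> 0) \<and> (\<forall>c\<in>set ?C. (\<Sum>r\<in>set ?R. ?g c r * v r) = 0))"
  proof
    assume "\<exists>v. (\<exists>r\<in>set ?R. v r \<noteq> 0) \<and> (\<forall>c\<in>set ?C. (\<Sum>r\<in>set ?R. ?g r c * v r) = 0)"
    then obtain v where "\<exists>r\<in>set ?R. v r \<noteq> 0" "\<forall>c\<in>set ?C. (\<Sum>r\<in>set ?R. ?g r c * v r) = 0" by blast
    then show "\<exists>v. (\<exists>r\<in>set ?R. v r \<noteq> 0) \<and> (\<forall>c\<in>set ?C. (\<Sum>r\<in>set ?R. ?g c r * v r) = 0)"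
      by (intro exI[of _ "\<lambda>r. s r * v r"]) (simp add: row s)
  next
    assume "\<exists>v. (\<exists>r\<in>set ?R. v r \<noteq> 0) \<and> (\<forall>c\<in>set ?C. (\<Sum>r\<in>set ?R. ?g c r * v r) = 0)"
    then obtain v where "\<exists>r\<in>set ?R. v r \<noteq> 0" "\<forall>c\<in>set ?C. (\<Sum>r\<in>set ?R. ?g c r * v r) = 0" by blast
    then show "\<exists>v. (\<exists>r\<in>set ?R. v r \<noteq> 0) \<and> (\<forall>c\<in>set ?C. (\<Sum>r\<in>set ?R. ?g r c * v r) = 0)"
      by (intro exI[of _ "\<lambda>r. s r * v r"]) (simp add: row s)
  qed
  also have "\<dots> \<longleftrightarrow> minor ?g ?C ?R = 0"
    by (rule minor_eq_0_iff[OF len distinct_labels[OF es vs], symmetric])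
  finally show ?thesis by (simp add: config_minor_def)
qed

section \<open>Homogeneous linear equations over a finite field\<close>

text \<open>
  Vectors with coordinates in \<open>I\<close> are functions that vanish outside of \<open>I\<close>. They are closed under
  pointwise operations, and a vector for a smaller index set is one for a larger index set.
\<close>

definition vectors :: "'i set \<Rightarrow> ('i \<Rightarrow> 'f::zero) set" where
  "vectors I = {v. \<forall>i. i \<notin> I \<longrightarrow> v i = 0}"

lemma bij_betw_restrict_vectors:
  "bij_betw (\<lambda>v. restrict v I) (vectors I) (I \<rightarrow>\<^sub>E (UNIV :: 'f::zero set))"
  by (rule bij_betw_byWitness[where f' = "\<lambda>v i. if i \<in> I then v i else 0"])
    (auto simp: vectors_def fun_eq_iff PiE_def extensional_def)

lemma card_vectors:
  assumes "finite I"
  shows "card (vectors I :: ('i \<Rightarrow> 'f::{zero,finite}) set) = CARD('f) ^ card I"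
  using bij_betw_same_card[OF bij_betw_restrict_vectors[of I, where ?'f = 'f]] card_PiE[OF assms, of "\<lambda>_. UNIV :: 'f set"]
  by simp

lemma finite_vectors:
  assumes "finite I"
  shows "finite (vectors I :: ('i \<Rightarrow> 'f::{zero,finite}) set)"
  using bij_betw_finite[OF bij_betw_restrict_vectors[of I, where ?'f = 'f]] finite_PiE[OF assms, of "\<lambda>_. UNIV :: 'f set"]
  by simp

lemma card_field_ge_2: "2 \<le> CARD('f::{field,finite})"
proof -
  have "card {0, 1 :: 'f} \<le> CARD('f)" by (rule card_mono) auto
  then show ?thesis by simp
qed

definition linear_functional :: "(('i \<Rightarrow> 'f::comm_ring_1) \<Rightarrow> 'f) \<Rightarrow> bool" where
  "linear_functional l \<longleftrightarrow> (\<forall>v w. l (\<lambda>i. v i + w i) = l v + l w) \<and> (\<forall>c v. l (\<lambda>i. c * v i) = c * l v)"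

definition function_space :: "('i \<Rightarrow> 'f::comm_ring_1) set \<Rightarrow> bool" where
  "function_space V \<longleftrightarrow> (\<lambda>_. 0) \<in> V \<and> (\<forall>v\<in>V. \<forall>w\<in>V. (\<lambda>i. v i + w i) \<in> V) \<and> (\<forall>c. \<forall>v\<in>V. (\<lambda>i. c * v i) \<in> V)"

text \<open>
  As \<open>u\<close> lies outside of the hyperplane, its multiples form a complement.
\<close>

lemma card_hyperplane:
  fixes V :: "('i \<Rightarrow> 'f::{field,finite}) set"
  assumes V: "function_space V" and l: "linear_functional l" and u: "u \<in> V" "l u \<noteq> 0"
  shows "card V = CARD('f) * card {v \<in> V. l v = 0}"
proof -
  let ?H = "{v \<in> V. l v = 0}"
  have add: "l (\<lambda>i. v i + c * w i) = l v + c * l w" for v w c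
    using l unfolding linear_functional_def by metis
  have "bij_betw (\<lambda>(v, c) i. v i + c * u i) (?H \<times> UNIV) V"
  proof (rule bij_betw_byWitness[where f' = "\<lambda>v. (\<lambda>i. v i + (- (l v / l u)) * u i, l v / l u)"])
    show "\<forall>a\<in>?H \<times> UNIV. (\<lambda>v. (\<lambda>i. v i + - (l v / l u) * u i, l v / l u)) ((\<lambda>(v, c) i. v i + c * u i) a) = a"
      using u(2) by (auto simp: add fun_eq_iff)
    show "\<forall>a\<in>V. (\<lambda>(v, c) i. v i + c * u i) (\<lambda>i. a i + - (l a / l u) * u i, l a / l u) = a"
      by (auto simp: fun_eq_iff)
    show "(\<lambda>(v, c) i. v i + c * u i) ` (?H \<times> UNIV) \<subseteq> V"
      using V u(1) by (auto simp: function_space_def)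
    have scale: "(\<lambda>i. c * w i) \<in> V" if "w \<in> V" for c w
      using V that by (simp add: function_space_def)
    have plus: "(\<lambda>i. v i + w i) \<in> V" if "v \<in> V" "w \<in> V" for v w
      using V that by (simp add: function_space_def)
    have "(\<lambda>i. v i + - (l v / l u) * u i) \<in> V" if "v \<in> V" for v
      by (rule plus[OF that scale[OF u(1)]])
    moreover have zero: "l (\<lambda>i. v i + - (l v / l u) * u i) = 0" for v
      unfolding add using u(2) by simp
    ultimately show "(\<lambda>v. (\<lambda>i. v i + - (l v / l u) * u i, l v / l u)) ` V \<subseteq> ?H \<times> UNIV"
      using zero by (auto simp del: mult_minus_left)
  qed
  then have "card (?H \<times> (UNIV :: 'f set)) = card V"
    by (rule bij_betw_same_card)
  then show ?thesis by (simp add: card_cartesian_product mult.commute)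
qed

text \<open>Each homogeneous linear equation lowers the dimension by at most one.\<close>

lemma card_solutions:
  fixes l :: "'j \<Rightarrow> ('i \<Rightarrow> 'f::{field,finite}) \<Rightarrow> 'f"
  assumes "finite I" "finite J" "\<And>j. j \<in> J \<Longrightarrow> linear_functional (l j)"
  shows "\<exists>k. card {v \<in> vectors I. \<forall>j\<in>J. l j v = 0} = CARD('f) ^ k \<and> card I \<le> k + card J"
  using assms(2,3)
proof (induction J)
  case empty
  then show ?case by (intro exI[of _ "card I"]) (simp add: card_vectors assms(1))
next
  case (insert j J)
  let ?V = "{v \<in> vectors I. \<forall>j\<in>J. l j v = 0}"
  obtain k where k: "card ?V = CARD('f) ^ k" "card I \<le> k + card J"
    using insert by auto
  have "l i (\<lambda>_. 0) = 0" if "i \<in> J" for i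
  proof -
    have "\<forall>c v. l i (\<lambda>a. c * v a) = c * l i v"
      using insert.prems[of i] that by (simp add: linear_functional_def)
    from this[rule_format, of 0 "\<lambda>_. 0"] show ?thesis by simp
  qed
  moreover have "l i (\<lambda>a. v a + w a) = l i v + l i w" "l i (\<lambda>a. c * v a) = c * l i v" if "i \<in> J" for i v w c
    using insert.prems[of i] that unfolding linear_functional_def by auto
  ultimately have V: "function_space ?V"
    by (auto simp: function_space_def vectors_def)
  have eq: "{v \<in> vectors I. \<forall>i\<in>insert j J. l i v = 0} = {v \<in> ?V. l j v = 0}" by auto
  show ?case
  proof (cases "\<forall>v\<in>?V. l j v = 0")
    case True
    then have "{v \<in> ?V. l j v = 0} = ?V" by blast
    then show ?thesis unfolding eq using k insert.hyps by (intro exI[of _ k]) simp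
  next
    case False
    then obtain u where u: "u \<in> ?V" "l j u \<noteq> 0" by blast
    have card: "CARD('f) ^ k = CARD('f) * card {v \<in> ?V. l j v = 0}"
      using card_hyperplane[of ?V "l j" u] V u insert.prems[of j] k(1) by simp
    moreover have "k \<noteq> 0"
      using card card_field_ge_2[where ?'f = 'f] by (cases k) auto
    ultimately have "card {v \<in> ?V. l j v = 0} = CARD('f) ^ (k - 1)"
      using card_field_ge_2[where ?'f = 'f] by (cases k) auto
    then show ?thesis unfolding eq using k(2) insert.hyps \<open>k \<noteq> 0\<close> by (intro exI[of _ "k - 1"]) simp
  qed
qed

lemma vectors_sum_iff: "v \<in> vectors (Inl ` A \<union> Inr ` B)
    \<longleftrightarrow> (\<lambda>a. v (Inl a)) \<in> vectors A \<and> (\<lambda>b. v (Inr b)) \<in> vectors B"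
  by (auto simp: vectors_def split_sum_all image_iff)

lemma sum_vectors_pair:
  fixes h :: "('a \<Rightarrow> 'f::{zero,finite}) \<Rightarrow> ('b \<Rightarrow> 'f) \<Rightarrow> int"
  assumes "finite A" "finite B"
  shows "(\<Sum>y\<in>vectors A. \<Sum>z\<in>vectors B. h y z)
    = (\<Sum>v\<in>vectors (Inl ` A \<union> Inr ` B). h (\<lambda>a. v (Inl a)) (\<lambda>b. v (Inr b)))"
proof -
  have "bij_betw (\<lambda>v. (\<lambda>a. v (Inl a), \<lambda>b. v (Inr b))) (vectors (Inl ` A \<union> Inr ` B)) (vectors A \<times> (vectors B :: ('b \<Rightarrow> 'f) set))"
  proof (rule bij_betw_byWitness[where f' = "\<lambda>(y, z). case_sum y z"])
    show "\<forall>v\<in>vectors (Inl ` A \<union> Inr ` B). (\<lambda>(y, z). case_sum y z) (\<lambda>a. v (Inl a), \<lambda>b. v (Inr b)) = v"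
      by (auto simp: fun_eq_iff split: sum.splits)
  qed (auto simp: vectors_sum_iff)
  from sum.reindex_bij_betw[OF this, of "\<lambda>(y, z). h y z"]
  show ?thesis by (simp add: sum.cartesian_product)
qed

lemma sum_solutions:
  fixes l :: "'j \<Rightarrow> ('a \<Rightarrow> 'f::{field,finite}) \<Rightarrow> ('b \<Rightarrow> 'f) \<Rightarrow> 'f"
  assumes "finite A" "finite B" "finite J"
    and add: "\<And>j v w v' w'. j \<in> J \<Longrightarrow> l j (\<lambda>i. v i + v' i) (\<lambda>i. w i + w' i) = l j v w + l j v' w'"
    and mult: "\<And>j c v w. j \<in> J \<Longrightarrow> l j (\<lambda>i. c * v i) (\<lambda>i. c * w i) = c * l j v w"
  shows "\<exists>k. (\<Sum>y\<in>vectors A. \<Sum>z\<in>vectors B. of_bool (\<forall>j\<in>J. l j y z = 0)) = int CARD('f) ^ k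
    \<and> card A + card B \<le> k + card J"
proof -
  let ?I = "Inl ` A \<union> Inr ` B :: ('a + 'b) set"
  have I: "finite ?I" "card ?I = card A + card B"
    using assms(1,2) by (simp, subst card_Un_disjoint) (auto simp: card_image)
  have "\<exists>k. card {v \<in> vectors ?I. \<forall>j\<in>J. l j (\<lambda>a. v (Inl a)) (\<lambda>b. v (Inr b)) = 0} = CARD('f) ^ k
    \<and> card ?I \<le> k + card J"
    by (rule card_solutions[OF I(1) assms(3)]) (auto simp: linear_functional_def add mult)
  then obtain k where k: "card {v \<in> vectors ?I. \<forall>j\<in>J. l j (\<lambda>a. v (Inl a)) (\<lambda>b. v (Inr b)) = 0} = CARD('f) ^ k"
    "card ?I \<le> k + card J" by blast
  have "(\<Sum>y\<in>vectors A. \<Sum>z\<in>vectors B. of_bool (\<forall>j\<in>J. l j y z = 0))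
    = int (card {v \<in> vectors ?I. \<forall>j\<in>J. l j (\<lambda>a. v (Inl a)) (\<lambda>b. v (Inr b)) = 0})"
    unfolding sum_vectors_pair[OF assms(1,2)]
    by (subst sum_of_bool_eq) (auto simp: finite_vectors assms(1,2) intro!: arg_cong[of _ _ card])
  then show ?thesis using k I(2) by (intro exI[of _ k]) simp
qed

text \<open>
  The rows of the configuration matrix at \<open>x\<close>, applied to the vector \<open>(y, z)\<close>; the sign of the rows of
  the vertices is dropped.
\<close>

definition edge_equation :: "('e \<Rightarrow> 'v \<Rightarrow> 'f::comm_ring_1) \<Rightarrow> 'v set \<Rightarrow> ('e \<Rightarrow> 'f) \<Rightarrow> ('e \<Rightarrow> 'f) \<Rightarrow> ('v \<Rightarrow> 'f) \<Rightarrow> 'e \<Rightarrow> 'f" where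
  "edge_equation E W x y z e = x e * y e + (\<Sum>w\<in>W. E e w * z w)"

definition vertex_equation :: "('e \<Rightarrow> 'v \<Rightarrow> 'f::comm_ring_1) \<Rightarrow> 'e set \<Rightarrow> ('e \<Rightarrow> 'f) \<Rightarrow> 'v \<Rightarrow> 'f" where
  "vertex_equation E S y w = (\<Sum>e\<in>S. E e w * y e)"

lemma vertex_equation_add: "vertex_equation E S (\<lambda>e. y e + c * y' e) w
    = vertex_equation E S y w + c * vertex_equation E S y' w"
  by (simp add: vertex_equation_def sum.distrib sum_distrib_left algebra_simps)

definition in_kernel :: "('e \<Rightarrow> 'v \<Rightarrow> 'f::comm_ring_1) \<Rightarrow> 'e set \<Rightarrow> 'v set \<Rightarrow> ('e \<Rightarrow> 'f) \<Rightarrow> ('e \<Rightarrow> 'f) \<Rightarrow> ('v \<Rightarrow> 'f) \<Rightarrow> bool" where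
  "in_kernel E S W x y z \<longleftrightarrow> (\<forall>e\<in>S. edge_equation E W x y z e = 0) \<and> (\<forall>w\<in>W. vertex_equation E S y w = 0)"

text \<open>
  Only the kernel vectors with edge part supported in \<open>R\<close> are counted.
\<close>

definition kernel_size :: "('e \<Rightarrow> 'v \<Rightarrow> 'f::{field,finite}) \<Rightarrow> 'e set \<Rightarrow> 'v set \<Rightarrow> 'e set \<Rightarrow> ('e \<Rightarrow> 'f) \<Rightarrow> int" where
  "kernel_size E S W R x = (\<Sum>y\<in>vectors R. \<Sum>z\<in>vectors W. of_bool (in_kernel E S W x y z))"

lemma kernel_size_power:
  fixes E :: "'e \<Rightarrow> 'v \<Rightarrow> 'f::{field,finite}"
  assumes "finite R" "finite S" "finite W"
  shows "\<exists>k. kernel_size E S W R x = int CARD('f) ^ k"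
proof -
  have "\<exists>k. (\<Sum>y\<in>vectors R. \<Sum>z\<in>vectors W. of_bool (\<forall>j\<in>Inl ` S \<union> Inr ` W.
      case_sum (edge_equation E W x y z) (vertex_equation E S y) j = 0)) = int CARD('f) ^ k
    \<and> card R + card W \<le> k + card (Inl ` S \<union> Inr ` W :: ('e + 'v) set)"
    by (rule sum_solutions)
      (use assms in \<open>auto simp: edge_equation_def vertex_equation_def sum.distrib sum_distrib_left algebra_simps
        split: sum.splits\<close>)
  then show ?thesis by (auto simp: kernel_size_def in_kernel_def ball_Un)
qed

lemma kernel_size_eq_1_iff:
  fixes E :: "'e \<Rightarrow> 'v \<Rightarrow> 'f::{field,finite}"
  assumes "finite R" "finite W"
  shows "kernel_size E S W R x = 1 \<longleftrightarrow>
    (\<forall>y z. y \<in> vectors R \<longrightarrow> z \<in> vectors W \<longrightarrow> in_kernel E S W x y z \<longrightarrow> y = (\<lambda>_. 0) \<and> z = (\<lambda>_. 0))"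
proof -
  let ?K = "{(y, z) \<in> vectors R \<times> vectors W. in_kernel E S W x y z}"
  have "kernel_size E S W R x = int (card ?K)"
  proof -
    have "kernel_size E S W R x
        = (\<Sum>p\<in>vectors R \<times> vectors W. of_bool (in_kernel E S W x (fst p) (snd p)))"
      by (simp add: kernel_size_def sum.cartesian_product case_prod_unfold)
    also have "\<dots> = int (card (vectors R \<times> vectors W \<inter> {p. in_kernel E S W x (fst p) (snd p)}))"
      using assms by (intro sum_of_bool_eq finite_cartesian_product finite_vectors)
    finally show ?thesis
      by (auto intro!: arg_cong[of _ _ card])
  qed
  moreover have zero: "((\<lambda>_. 0), (\<lambda>_. 0)) \<in> ?K"
    by (auto simp: vectors_def in_kernel_def edge_equation_def vertex_equation_def)
  moreover have "card ?K = 1 \<longleftrightarrow> ?K = {((\<lambda>_. 0), (\<lambda>_. 0))}"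
    using zero by (metis (lifting) card_1_singletonE is_singletonI is_singleton_altdef singletonD)
  ultimately show ?thesis by auto
qed

section \<open>Zeros of configuration polynomials\<close>

text \<open>
  For a fixed edge part \<open>y\<close> the equations are linear in the point \<open>x\<close> and the vertex part \<open>z\<close>
  together: there are \<open>card R + card W\<close> unknowns and \<open>card S\<close> equations.
\<close>

lemma sum_kernel_size_dvd:
  fixes E :: "'e \<Rightarrow> 'v \<Rightarrow> 'f::{field,finite}"
  assumes fin: "finite R" "finite S" "finite W" and j: "j + card S \<le> card R + card W"
  shows "int CARD('f) ^ j dvd (\<Sum>x\<in>vectors R. kernel_size E S W R x)"
proof -
  have "(\<Sum>x\<in>vectors R. kernel_size E S W R x)
      = (\<Sum>y\<in>vectors R. \<Sum>x\<in>vectors R. \<Sum>z\<in>vectors W. of_bool (in_kernel E S W x y z))"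
    unfolding kernel_size_def by (rule sum.swap)
  moreover have "int CARD('f) ^ j dvd (\<Sum>x\<in>vectors R. \<Sum>z\<in>vectors W. of_bool (in_kernel E S W x y z))" for y
  proof (cases "\<forall>w\<in>W. vertex_equation E S y w = 0")
    case True
    have "\<exists>k. (\<Sum>x\<in>vectors R. \<Sum>z\<in>vectors W. of_bool (\<forall>e\<in>S. edge_equation E W x y z e = 0)) = int CARD('f) ^ k
      \<and> card R + card W \<le> k + card S"
      by (rule sum_solutions)
        (use fin in \<open>auto simp: edge_equation_def sum.distrib sum_distrib_left algebra_simps\<close>)
    then obtain k where "(\<Sum>x\<in>vectors R. \<Sum>z\<in>vectors W. of_bool (\<forall>e\<in>S. edge_equation E W x y z e = 0)) = int CARD('f) ^ k"
      "card R + card W \<le> k + card S" by blast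
    then show ?thesis using True j by (auto simp: in_kernel_def intro: le_imp_power_dvd)
  next
    case False
    then have "\<not> in_kernel E S W x y z" for x z by (auto simp: in_kernel_def)
    then show ?thesis by simp
  qed
  ultimately show ?thesis by (auto intro: dvd_sum)
qed

text \<open>
  The configuration matrix is symmetric up to signs. For two vectors that satisfy the equations of the
  vertices this is a linear relation between their edge equations, which saves one equation
  when pairs of kernel vectors are counted.
\<close>

lemma edge_equation_pairing:
  assumes "finite S" "finite W"
    and "\<forall>w\<in>W. vertex_equation E S y w = 0" "\<forall>w\<in>W. vertex_equation E S y' w = 0"
  shows "(\<Sum>e\<in>S. y' e * edge_equation E W x y z e) = (\<Sum>e\<in>S. y e * edge_equation E W x y' z' e)"
proof -
  have *: "(\<Sum>e\<in>S. y' e * (\<Sum>w\<in>W. E e w * z w)) = 0"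
    if "\<forall>w\<in>W. vertex_equation E S y' w = 0" for y' z
  proof -
    have "(\<Sum>e\<in>S. y' e * (\<Sum>w\<in>W. E e w * z w)) = (\<Sum>e\<in>S. \<Sum>w\<in>W. z w * (E e w * y' e))"
      by (simp add: sum_distrib_left mult_ac)
    also have "\<dots> = (\<Sum>w\<in>W. z w * vertex_equation E S y' w)"
      by (subst sum.swap) (simp add: vertex_equation_def sum_distrib_left)
    finally show ?thesis using that by simp
  qed
  show ?thesis
    using *[OF assms(4), of z] *[OF assms(3), of z']
    by (simp add: edge_equation_def distrib_left sum.distrib mult_ac)
qed

text \<open>
  Pairs of kernel vectors are counted for fixed edge parts \<open>y\<close> and \<open>y'\<close>; the equations are linear in the
  point and the two vertex parts. For \<open>y = 0\<close> the equations of the first vertex part separate from the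
  others, and \<open>card W\<close> free parameters remain. For \<open>y \<noteq> 0\<close> there are \<open>card S + 2 * card W\<close> unknowns and
  \<open>2 * card S\<close> equations with one relation. A further factor \<open>q\<close> arises because the number of
  solutions does not change when a multiple of \<open>y\<close> is added to \<open>y'\<close>.
\<close>

lemma sum_kernel_size_square_dvd:
  fixes E :: "'e \<Rightarrow> 'v \<Rightarrow> 'f::{field,finite}"
  assumes fin: "finite S" "finite W" and le: "card S \<le> 2 * card W"
    and j: "j \<le> card W" "j + card S \<le> 2 * card W + 2"
  shows "int CARD('f) ^ j dvd (\<Sum>x\<in>vectors S. kernel_size E S W S x ^ 2)"
proof -
  let ?q = "int CARD('f)" let ?N = "card S" let ?r = "card W"
  define c where "c y = (of_bool (\<forall>w\<in>W. vertex_equation E S y w = 0) :: int)" for y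
  define k where "k x y = (\<Sum>z\<in>vectors W. of_bool (\<forall>e\<in>S. edge_equation E W x y z e = 0) :: int)" for x y
  define B where "B y y' = (\<Sum>x\<in>vectors S. k x y * k x y')" for y y'
  have size: "kernel_size E S W S x = (\<Sum>y\<in>vectors S. c y * k x y)" for x
    by (simp add: kernel_size_def in_kernel_def c_def k_def of_bool_conj sum_distrib_left mult.commute)
  have "(\<Sum>x\<in>vectors S. kernel_size E S W S x ^ 2)
      = (\<Sum>x\<in>vectors S. \<Sum>y\<in>vectors S. \<Sum>y'\<in>vectors S. c y * c y' * (k x y * k x y'))"
    by (simp add: size power2_eq_square sum_product mult_ac)
  also have "\<dots> = (\<Sum>y\<in>vectors S. \<Sum>y'\<in>vectors S. c y * c y' * B y y')"
    by (subst sum.swap, rule sum.cong[OF refl], subst sum.swap) (simp add: B_def sum_distrib_left)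
  finally have square: "(\<Sum>x\<in>vectors S. kernel_size E S W S x ^ 2)
      = (\<Sum>y\<in>vectors S. c y * (\<Sum>y'\<in>vectors S. c y' * B y y'))"
    by (simp add: sum_distrib_left mult_ac)
  have B_zero: "?q ^ j dvd B (\<lambda>_. 0) y'" for y'
  proof -
    have k0: "k x (\<lambda>_. 0) = k (\<lambda>_. 0) (\<lambda>_. 0)" for x
      by (simp add: k_def edge_equation_def)
    have "\<exists>i. (\<Sum>x\<in>vectors S. \<Sum>z\<in>vectors W. of_bool (\<forall>e\<in>S. edge_equation E W x y' z e = 0)) = ?q ^ i
      \<and> ?N + ?r \<le> i + ?N"
      by (rule sum_solutions)
        (use fin in \<open>auto simp: edge_equation_def sum.distrib sum_distrib_left algebra_simps\<close>)
    then obtain i where i: "(\<Sum>x\<in>vectors S. k x y') = ?q ^ i" "?r \<le> i"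
      unfolding k_def by auto
    have "B (\<lambda>_. 0) y' = k (\<lambda>_. 0) (\<lambda>_. 0) * (\<Sum>x\<in>vectors S. k x y')"
      unfolding B_def by (subst k0) (simp add: sum_distrib_left)
    moreover have "?q ^ j dvd ?q ^ i" using i(2) j(1) by (intro le_imp_power_dvd) simp
    ultimately show ?thesis by (simp only: i(1) dvd_mult)
  qed
  have B_nonzero: "?q ^ (j - 1) dvd B y y'"
    if e0: "e0 \<in> S" "y e0 \<noteq> 0"
      and y: "\<forall>w\<in>W. vertex_equation E S y w = 0" "\<forall>w\<in>W. vertex_equation E S y' w = 0" for y y' e0
  proof -
    let ?J = "Inl ` S \<union> Inr ` (S - {e0}) :: ('e + 'e) set"
    let ?W = "Inl ` W \<union> Inr ` W :: ('v + 'v) set"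
    define l where "l i x u = (case i of
      Inl e \<Rightarrow> edge_equation E W x y (\<lambda>w. u (Inl w)) e
    | Inr e \<Rightarrow> edge_equation E W x y' (\<lambda>w. u (Inr w)) e)" for i x and u :: "'v + 'v \<Rightarrow> 'f"
    \<comment> \<open>the equation of \<open>e0\<close> for \<open>y'\<close> is omitted, as it follows from the others\<close>
    have card: "card ?J = 2 * ?N - 1" "card ?W = 2 * ?r"
      using fin e0(1) by (subst card_Un_disjoint; auto simp: card_image card_Diff_singleton)+
    have "\<exists>i. (\<Sum>x\<in>vectors S. \<Sum>u\<in>vectors ?W. of_bool (\<forall>i\<in>?J. l i x u = 0)) = ?q ^ i
      \<and> ?N + card ?W \<le> i + card ?J"
      by (rule sum_solutions)
        (use fin in \<open>auto simp: l_def edge_equation_def sum.distrib sum_distrib_left algebra_simps\<close>)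
    then obtain i where i: "(\<Sum>x\<in>vectors S. \<Sum>u\<in>vectors ?W. of_bool (\<forall>i\<in>?J. l i x u = 0)) = ?q ^ i"
      "?N + card ?W \<le> i + card ?J" by blast
    have equiv: "(\<forall>i\<in>?J. l i x u = 0) \<longleftrightarrow> (\<forall>e\<in>S. edge_equation E W x y (\<lambda>w. u (Inl w)) e = 0)
        \<and> (\<forall>e\<in>S. edge_equation E W x y' (\<lambda>w. u (Inr w)) e = 0)" (is "?L \<longleftrightarrow> ?R") for x u
    proof
      assume ?L
      then have L: "\<forall>e\<in>S. edge_equation E W x y (\<lambda>w. u (Inl w)) e = 0"
        "\<forall>e\<in>S - {e0}. edge_equation E W x y' (\<lambda>w. u (Inr w)) e = 0"
        by (auto simp: l_def ball_Un)
      have "0 = (\<Sum>e\<in>S. y' e * edge_equation E W x y (\<lambda>w. u (Inl w)) e)"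
        using L(1) by simp
      also have "\<dots> = (\<Sum>e\<in>S. y e * edge_equation E W x y' (\<lambda>w. u (Inr w)) e)"
        by (rule edge_equation_pairing[OF fin y])
      also have "\<dots> = y e0 * edge_equation E W x y' (\<lambda>w. u (Inr w)) e0"
        using L(2) by (simp add: sum.remove[OF fin(1) e0(1)])
      finally show ?R using L e0 by auto
    qed (auto simp: l_def)
    have "B y y' = (\<Sum>x\<in>vectors S. \<Sum>z\<in>vectors W. \<Sum>z'\<in>vectors W.
        of_bool (\<forall>e\<in>S. edge_equation E W x y z e = 0) * of_bool (\<forall>e\<in>S. edge_equation E W x y' z' e = 0))"
      by (simp add: B_def k_def sum_product)
    also have "\<dots> = (\<Sum>x\<in>vectors S. \<Sum>u\<in>vectors ?W. of_bool (\<forall>i\<in>?J. l i x u = 0))"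
      unfolding equiv of_bool_conj by (simp add: sum_vectors_pair[OF fin(2) fin(2)])
    finally have "B y y' = ?q ^ i" using i(1) by simp
    moreover have "j - 1 \<le> i" using i(2) j le e0(1) fin(1) unfolding card by (cases "?N") auto
    ultimately show ?thesis by (simp add: le_imp_power_dvd)
  qed
  have B_shift: "k x y * k x (\<lambda>e. y' e + t * y e) = k x y * k x y'" for x y y' t
  proof (cases "\<exists>z0\<in>vectors W. \<forall>e\<in>S. edge_equation E W x y z0 e = 0")
    case True
    then obtain z0 where z0: "z0 \<in> vectors W" "\<forall>e\<in>S. edge_equation E W x y z0 e = 0" by blast
    have bij: "bij_betw (\<lambda>z w. z w + t * z0 w) (vectors W) (vectors W)"
      by (rule bij_betw_byWitness[where f' = "\<lambda>z w. z w - t * z0 w"])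
        (use z0(1) in \<open>auto simp: vectors_def\<close>)
    have "edge_equation E W x (\<lambda>e. y' e + t * y e) (\<lambda>w. z w + t * z0 w) e
        = edge_equation E W x y' z e + t * edge_equation E W x y z0 e" for z e
      by (simp add: edge_equation_def sum.distrib sum_distrib_left algebra_simps)
    then have "k x y' = (\<Sum>z\<in>vectors W. of_bool (\<forall>e\<in>S.
        edge_equation E W x (\<lambda>e. y' e + t * y e) (\<lambda>w. z w + t * z0 w) e = 0))"
      unfolding k_def using z0(2) by (intro sum.cong arg_cong[of _ _ of_bool] ball_cong) auto
    also have "\<dots> = k x (\<lambda>e. y' e + t * y e)"
      unfolding k_def by (rule sum.reindex_bij_betw[OF bij])
    finally show ?thesis by simp
  next
    case False
    then have "k x y = 0" unfolding k_def by (intro sum.neutral) auto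
    then show ?thesis by simp
  qed
  have "?q ^ j dvd c y * (\<Sum>y'\<in>vectors S. c y' * B y y')" if yS: "y \<in> vectors S" for y
  proof (cases "y = (\<lambda>_. 0)")
    case True
    then show ?thesis by (auto intro!: dvd_mult dvd_sum B_zero)
  next
    case False
    then obtain e0 where e0: "e0 \<in> S" "y e0 \<noteq> 0" using yS by (auto simp: vectors_def)
    show ?thesis
    proof (cases "\<forall>w\<in>W. vertex_equation E S y w = 0")
      case True
      \<comment> \<open>sort the vectors \<open>y'\<close> by their classes modulo \<open>y\<close>, represented by the vectors with \<open>y' e0 = 0\<close>\<close>
      have c: "c (\<lambda>e. u e + t * y e) = c u" for u t
        using True by (simp add: c_def vertex_equation_add)
      have bij: "bij_betw (\<lambda>(u, t) e. u e + t * y e) (vectors (S - {e0}) \<times> UNIV) (vectors S)"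
        by (rule bij_betw_byWitness[where f' = "\<lambda>v. (\<lambda>e. v e - v e0 / y e0 * y e, v e0 / y e0)"])
          (use e0 yS in \<open>auto simp: vectors_def fun_eq_iff\<close>)
      have "(\<Sum>y'\<in>vectors S. c y' * B y y')
          = (\<Sum>(u, t)\<in>vectors (S - {e0}) \<times> UNIV. c (\<lambda>e. u e + t * y e) * B y (\<lambda>e. u e + t * y e))"
        by (subst sum.reindex_bij_betw[OF bij, symmetric]) (simp add: case_prod_unfold)
      also have "\<dots> = (\<Sum>u\<in>vectors (S - {e0}). \<Sum>t\<in>(UNIV :: 'f set). c u * B y u)"
        unfolding c B_def B_shift by (rule sum.cartesian_product[symmetric])
      also have "\<dots> = ?q * (\<Sum>u\<in>vectors (S - {e0}). c u * B y u)"
        by (simp add: sum_distrib_left)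
      finally have eq: "(\<Sum>y'\<in>vectors S. c y' * B y y') = ?q * (\<Sum>u\<in>vectors (S - {e0}). c u * B y u)" .
      have "?q ^ (j - 1) dvd c u * B y u" for u
        using B_nonzero[OF e0 True, of u] by (cases "\<forall>w\<in>W. vertex_equation E S u w = 0") (auto simp: c_def)
      then have "?q * ?q ^ (j - 1) dvd (\<Sum>y'\<in>vectors S. c y' * B y y')"
        unfolding eq by (intro mult_dvd_mono dvd_sum) auto
      then have "?q ^ j dvd (\<Sum>y'\<in>vectors S. c y' * B y y')"
        by (cases j) auto
      then show ?thesis by simp
    next
      case False
      then have "c y = 0" by (auto simp: c_def)
      then show ?thesis by simp
    qed
  qed
  then show ?thesis unfolding square by (rule dvd_sum)
qed

definition zero_count :: "'e set \<Rightarrow> (('e \<Rightarrow> 'f::{zero,finite}) \<Rightarrow> bool) \<Rightarrow> int" where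
  "zero_count S P = (\<Sum>x\<in>vectors S. of_bool (P x))"

abbreviation config_zeros :: "('e \<Rightarrow> 'v \<Rightarrow> 'f::{field,finite}) \<Rightarrow> 'e list \<Rightarrow> 'v list \<Rightarrow> int" where
  "config_zeros E es vs \<equiv> zero_count (set es) (\<lambda>x. config_minor E es vs {} {} x = 0)"

lemma principal_minor_eq_0_iff:
  fixes E :: "'e \<Rightarrow> 'v \<Rightarrow> 'f::field"
  assumes es: "distinct es" and vs: "distinct vs" and I: "I \<subseteq> set es"
  shows "config_minor E es vs I I x = 0 \<longleftrightarrow>
    (\<exists>y z. y \<in> vectors (set es - I) \<and> z \<in> vectors (set vs) \<and> (y \<noteq> (\<lambda>_. 0) \<or> z \<noteq> (\<lambda>_. 0)) \<and>
      (\<forall>e\<in>set es - I. edge_equation E (set vs) x y z e = 0) \<and>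
      (\<forall>w\<in>set vs. vertex_equation E (set es) y w = 0))" (is "_ \<longleftrightarrow> ?R")
proof
  assume "config_minor E es vs I I x = 0"
  then obtain y z where yz: "(\<exists>e\<in>set es - I. y e \<noteq> 0) \<or> (\<exists>v\<in>set vs. z v \<noteq> 0)"
    "\<forall>e\<in>set es - I. (if e \<in> I then 0 else x e * y e) + (\<Sum>v\<in>set vs. E e v * z v) = 0"
    "\<forall>v\<in>set vs. (\<Sum>e\<in>set es - I. E e v * y e) = 0"
    unfolding config_minor_eq_0_iff[OF es vs I I refl] by blast
  let ?y = "\<lambda>e. if e \<in> set es - I then y e else 0" let ?z = "\<lambda>v. if v \<in> set vs then z v else 0"
  have "vertex_equation E (set es) ?y w = (\<Sum>e\<in>set es - I. E e w * y e)" for w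
    unfolding vertex_equation_def by (rule sum.mono_neutral_cong_right) auto
  moreover have "edge_equation E (set vs) x ?y ?z e = x e * y e + (\<Sum>v\<in>set vs. E e v * z v)"
    if "e \<in> set es - I" for e
    using that by (simp add: edge_equation_def)
  ultimately have "?y \<in> vectors (set es - I) \<and> ?z \<in> vectors (set vs) \<and> (?y \<noteq> (\<lambda>_. 0) \<or> ?z \<noteq> (\<lambda>_. 0)) \<and>
      (\<forall>e\<in>set es - I. edge_equation E (set vs) x ?y ?z e = 0) \<and>
      (\<forall>w\<in>set vs. vertex_equation E (set es) ?y w = 0)"
    using yz by (auto simp: vectors_def fun_eq_iff)
  then show ?R by blast
next
  assume ?R
  then obtain y z where yz: "y \<in> vectors (set es - I)" "z \<in> vectors (set vs)" "y \<noteq> (\<lambda>_. 0) \<or> z \<noteq> (\<lambda>_. 0)"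
    "\<forall>e\<in>set es - I. edge_equation E (set vs) x y z e = 0"
    "\<forall>w\<in>set vs. vertex_equation E (set es) y w = 0" by blast
  have v: "(\<Sum>e\<in>set es - I. E e w * y e) = vertex_equation E (set es) y w" for w
    unfolding vertex_equation_def using yz(1) by (intro sum.mono_neutral_cong_left) (auto simp: vectors_def)
  have "(\<exists>e\<in>set es - I. y e \<noteq> 0) \<or> (\<exists>v\<in>set vs. z v \<noteq> 0)"
    using yz(1-3) unfolding vectors_def fun_eq_iff by blast
  then show "config_minor E es vs I I x = 0"
    unfolding config_minor_eq_0_iff[OF es vs I I refl]
    by (intro exI[of _ y] exI[of _ z]) (use yz(4,5) in \<open>auto simp: v edge_equation_def\<close>)
qed

lemma kernel_size_neq_1_iff:
  fixes E :: "'e \<Rightarrow> 'v \<Rightarrow> 'f::{field,finite}"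
  assumes "distinct es" "distinct vs"
  shows "kernel_size E (set es) (set vs) (set es) x \<noteq> 1 \<longleftrightarrow> config_minor E es vs {} {} x = 0"
  unfolding kernel_size_eq_1_iff[OF finite_set finite_set]
    principal_minor_eq_0_iff[OF assms empty_subsetI] in_kernel_def Diff_empty
  by blast

text \<open>
  The quadratic polynomial vanishes at \<open>m = 1\<close>, takes the same value \<open>(q - 1) * (q ^ 2 - 1)\<close> at \<open>q\<close> and
  at \<open>q ^ 2\<close>, and a value congruent to it at every multiple of \<open>q ^ 3\<close>.
\<close>

lemma indicator_mod_cube:
  fixes q :: int
  assumes "m = q ^ c"
  shows "q ^ 3 dvd (q - 1) * (q ^ 2 - 1) * of_bool (m \<noteq> 1) - (m - 1) * (q ^ 2 + q - 1 - m)"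
proof -
  consider "m = 1" | "m \<noteq> 1" "c = 1" | "m \<noteq> 1" "c = 2" | "m \<noteq> 1" "3 \<le> c"
    using assms by (cases "c = 0"; cases "c = 1"; cases "c = 2") auto
  then show ?thesis
  proof cases
    case 4
    then have dvd: "q ^ 3 dvd m" using assms by (simp add: le_imp_power_dvd)
    have "(q - 1) * (q ^ 2 - 1) * of_bool (m \<noteq> 1) - (m - 1) * (q ^ 2 + q - 1 - m)
        = q ^ 3 + m * (m - q ^ 2 - q)"
      using 4 by (simp add: algebra_simps power3_eq_cube power2_eq_square)
    with dvd show ?thesis by simp
  qed (use assms in \<open>auto simp: algebra_simps power2_eq_square\<close>)
qed

text \<open>
  By \<open>indicator_mod_cube\<close> the count is, up to the unit \<open>u\<close>, a combination of the sums of \<open>m\<close> and \<open>m ^ 2\<close>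
  and of the number of points, whose coefficient is congruent to \<open>u\<close>.
\<close>

lemma zero_count_config_minor:
  fixes E :: "'e \<Rightarrow> 'v \<Rightarrow> 'f::{field,finite}"
  assumes es: "distinct es" and vs: "distinct vs"
    and le: "length es \<le> 2 * length vs" and r: "3 \<le> length vs"
    and j: "j \<le> 3" "j + length es \<le> 2 * length vs + 2"
  shows "[config_zeros E es vs = int CARD('f) ^ length es]
    (mod int CARD('f) ^ j)"
proof -
  let ?q = "int CARD('f)" let ?S = "set es" let ?W = "set vs"
  define m where "m = kernel_size E ?S ?W ?S"
  define Z where "Z = config_zeros E es vs"
  define u where "u = (?q - 1) * (?q ^ 2 - 1)"
  define S1 where "S1 = (\<Sum>x\<in>vectors ?S. m x)"
  define S2 where "S2 = (\<Sum>x\<in>vectors ?S. m x ^ 2)"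
  have N: "card ?S = length es" and W: "card ?W = length vs"
    using es vs by (simp_all add: distinct_card)
  have one: "(\<Sum>x\<in>(vectors ?S :: ('e \<Rightarrow> 'f) set). 1) = ?q ^ length es"
    by (simp add: card_vectors N)
  have Z: "Z = (\<Sum>x\<in>vectors ?S. of_bool (m x \<noteq> 1))"
    unfolding Z_def zero_count_def m_def kernel_size_neq_1_iff[OF es vs] ..
  have "?q ^ 3 dvd (\<Sum>x\<in>vectors ?S. u * of_bool (m x \<noteq> 1) - (m x - 1) * (?q ^ 2 + ?q - 1 - m x))"
    unfolding u_def
  proof (rule dvd_sum)
    fix x
    obtain c where "m x = ?q ^ c" using kernel_size_power[of ?S ?S ?W E x] by (auto simp: m_def)
    then show "?q ^ 3 dvd (?q - 1) * (?q ^ 2 - 1) * of_bool (m x \<noteq> 1) - (m x - 1) * (?q ^ 2 + ?q - 1 - m x)"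
      by (rule indicator_mod_cube)
  qed
  also have "(\<Sum>x\<in>vectors ?S. u * of_bool (m x \<noteq> 1) - (m x - 1) * (?q ^ 2 + ?q - 1 - m x))
      = (\<Sum>x\<in>vectors ?S. u * of_bool (m x \<noteq> 1) + (m x ^ 2 + ((?q ^ 2 + ?q - 1) * 1 - (?q ^ 2 + ?q) * m x)))"
    by (intro sum.cong) (auto simp: algebra_simps power2_eq_square)
  also have "\<dots> = u * Z + (S2 + ((?q ^ 2 + ?q - 1) * ?q ^ length es - (?q ^ 2 + ?q) * S1))"
    unfolding sum.distrib sum_subtractf sum_distrib_left[symmetric] one S1_def S2_def Z ..
  finally have *: "?q ^ 3 dvd u * Z + (S2 + ((?q ^ 2 + ?q - 1) * ?q ^ length es - (?q ^ 2 + ?q) * S1))" .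
  have S1: "?q ^ j dvd S1"
    unfolding S1_def m_def by (rule sum_kernel_size_dvd) (use j r N W in auto)
  have S2: "?q ^ j dvd S2"
    unfolding S2_def m_def by (rule sum_kernel_size_square_dvd) (use j r le N W in auto)
  have q3: "?q ^ j dvd ?q ^ 3" by (rule le_imp_power_dvd) (use j in auto)
  have "u * (Z - ?q ^ length es) = (u * Z + (S2 + ((?q ^ 2 + ?q - 1) * ?q ^ length es - (?q ^ 2 + ?q) * S1)))
      - S2 + (?q ^ 2 + ?q) * S1 - ?q ^ 3 * ?q ^ length es"
    by (simp add: u_def algebra_simps power2_eq_square power3_eq_cube)
  moreover have "?q ^ j dvd \<dots>"
    by (rule dvd_diff[OF dvd_add[OF dvd_diff[OF dvd_trans[OF q3 *] S2] dvd_mult[OF S1]] dvd_mult2[OF q3]])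
  ultimately have "?q ^ j dvd u * (Z - ?q ^ length es)" by (simp only:)
  moreover have "coprime (?q ^ j) u"
  proof -
    have "coprime ?q (?q - 1)" using coprime_doff_one_right by blast
    moreover have "coprime ?q (?q ^ 2 - 1)"
    proof -
      have "coprime (?q ^ 2) (?q ^ 2 - 1)" using coprime_doff_one_right by blast
      then show ?thesis unfolding coprime_power_left_iff by simp
    qed
    ultimately show ?thesis by (simp add: u_def)
  qed
  ultimately have "?q ^ j dvd Z - ?q ^ length es"
    by (simp add: coprime_dvd_mult_right_iff)
  then show ?thesis by (simp add: cong_iff_dvd_diff Z_def)
qed

section \<open>Points where all coefficients of two edges vanish\<close>

abbreviation two_edge_minors_vanish ::
  "('e \<Rightarrow> 'v \<Rightarrow> 'f::field) \<Rightarrow> 'e list \<Rightarrow> 'v list \<Rightarrow> 'e \<Rightarrow> 'e \<Rightarrow> ('e \<Rightarrow> 'f) \<Rightarrow> bool" where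
  "two_edge_minors_vanish E es vs a b x \<equiv> config_minor E es vs {} {} x = 0 \<and> config_minor E es vs {a} {a} x = 0 \<and>
      config_minor E es vs {b} {b} x = 0 \<and> config_minor E es vs {a, b} {a, b} x = 0"

text \<open>
  Each vanishing minor gives a vector that vanishes at the removed edges and violates at most their
  equations. If no nonzero kernel vector vanishes at \<open>a\<close> and \<open>b\<close>, the symmetric pairing of
  these vectors produces vectors vanishing at \<open>a\<close> and \<open>b\<close> that violate the equation of \<open>a\<close> only, respectively of \<open>b\<close> only. Paired with them, a
  kernel vector of the whole matrix vanishes at \<open>a\<close> and \<open>b\<close>, a contradiction.
\<close>

lemma two_edges_singular_iff:
  fixes E :: "'e \<Rightarrow> 'v \<Rightarrow> 'f::{field,finite}"
  assumes es: "distinct es" and vs: "distinct vs" and ab: "a \<in> set es" "b \<in> set es" "a \<noteq> b"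
    and x: "x a = 0" "x b = 0"
  shows "two_edge_minors_vanish E es vs a b x
    \<longleftrightarrow> kernel_size E (set es) (set vs) (set es - {a, b}) x \<noteq> 1" (is "?L \<longleftrightarrow> ?R")
proof
  let ?S = "set es" let ?W = "set vs"
  let ?eq = "edge_equation E ?W x"
  assume ?R
  then obtain y z where yz: "y \<in> vectors (?S - {a, b})" "z \<in> vectors ?W" "in_kernel E ?S ?W x y z"
    "y \<noteq> (\<lambda>_. 0) \<or> z \<noteq> (\<lambda>_. 0)"
    by (auto simp: kernel_size_eq_1_iff)
  have "config_minor E es vs I I x = 0" if I: "I \<subseteq> {a, b}" for I
  proof -
    have "I \<subseteq> ?S" using I ab by auto
    moreover have "y \<in> vectors (?S - I)" using yz(1) I by (auto simp: vectors_def)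
    ultimately show ?thesis
      using yz(2-4) unfolding principal_minor_eq_0_iff[OF es vs \<open>I \<subseteq> ?S\<close>] in_kernel_def by blast
  qed
  then show ?L by auto
next
  let ?S = "set es" let ?W = "set vs"
  let ?eq = "edge_equation E ?W x"
  assume ?L
  show ?R
  proof
    assume one: "kernel_size E ?S ?W (?S - {a, b}) x = 1"
    define good where "good y z \<longleftrightarrow> (y \<noteq> (\<lambda>_. 0) \<or> z \<noteq> (\<lambda>_. 0)) \<and> y \<in> vectors ?S \<and> z \<in> vectors ?W \<and>
      (\<forall>e\<in>?S - {a, b}. ?eq y z e = 0) \<and> (\<forall>w\<in>?W. vertex_equation E ?S y w = 0)" for y z
    have sing: "\<exists>y z. good y z \<and> (\<forall>e\<in>I. y e = 0) \<and> (\<forall>e\<in>{a, b} - I. ?eq y z e = 0)"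
      if sing: "config_minor E es vs I I x = 0" "I \<subseteq> {a, b}" for I
    proof -
      have I: "I \<subseteq> ?S" using sing ab by auto
      obtain y z where "y \<in> vectors (?S - I)" "z \<in> vectors ?W" "y \<noteq> (\<lambda>_. 0) \<or> z \<noteq> (\<lambda>_. 0)"
        "\<forall>e\<in>?S - I. ?eq y z e = 0" "\<forall>w\<in>?W. vertex_equation E ?S y w = 0"
        using sing(1) unfolding principal_minor_eq_0_iff[OF es vs I] by blast
      then show ?thesis
        using sing(2) ab by (intro exI[of _ y] exI[of _ z]) (auto simp: good_def vectors_def)
    qed
    have pair: "y' a * ?eq y z a + y' b * ?eq y z b = y a * ?eq y' z' a + y b * ?eq y' z' b"
      if "good y z" "good y' z'" for y z y' z'
    proof -
      have two: "(\<Sum>e\<in>?S. h e) = h a + h b" if "\<forall>e\<in>?S - {a, b}. h e = 0" for h :: "'e \<Rightarrow> 'f"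
      proof -
        have "(\<Sum>e\<in>?S. h e) = (\<Sum>e\<in>{a, b}. h e)"
          using that ab by (intro sum.mono_neutral_right) auto
        then show ?thesis using ab(3) by simp
      qed
      have "(\<Sum>e\<in>?S. y' e * ?eq y z e) = (\<Sum>e\<in>?S. y e * ?eq y' z' e)"
        by (rule edge_equation_pairing) (use that in \<open>auto simp: good_def\<close>)
      then show ?thesis
        using that by (simp add: two good_def)
    qed
    have nonzero: "?eq y z a \<noteq> 0 \<or> ?eq y z b \<noteq> 0" if "good y z" "y a = 0" "y b = 0" for y z
    proof (rule ccontr)
      assume *: "\<not> ?thesis"
      have "in_kernel E ?S ?W x y z"
        using that(1) * unfolding in_kernel_def good_def by blast
      moreover have "y \<in> vectors (?S - {a, b})" using that by (auto simp: good_def vectors_def)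
      ultimately show False
        using one that(1) by (auto simp: kernel_size_eq_1_iff good_def)
    qed
    obtain y0 z0 where 0: "good y0 z0" "y0 a = 0" "y0 b = 0"
      using sing[of "{a, b}"] \<open>?L\<close> by auto
    obtain y1 z1 where 1: "good y1 z1" "y1 a = 0" "?eq y1 z1 b = 0"
      using sing[of "{a}"] \<open>?L\<close> ab(3) by auto
    obtain y2 z2 where 2: "good y2 z2" "y2 b = 0" "?eq y2 z2 a = 0"
      using sing[of "{b}"] \<open>?L\<close> ab(3) by auto
    obtain y3 z3 where 3: "good y3 z3" "?eq y3 z3 a = 0" "?eq y3 z3 b = 0"
      using sing[of "{}"] \<open>?L\<close> by auto
    obtain u v where uv: "good u v" "u a = 0" "u b = 0" "?eq u v b = 0"
    proof (cases "y1 b = 0")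
      case False
      then have "?eq y0 z0 b = 0" using pair[OF 0(1) 1(1)] 0 1 by simp
      then show ?thesis using that 0 by blast
    qed (use that 1 in blast)
    obtain u' v' where uv': "good u' v'" "u' a = 0" "u' b = 0" "?eq u' v' a = 0"
    proof (cases "y2 a = 0")
      case False
      then have "?eq y0 z0 a = 0" using pair[OF 0(1) 2(1)] 0 2 by simp
      then show ?thesis using that 0 by blast
    qed (use that 2 in blast)
    have "y3 a = 0" using pair[OF uv(1) 3(1)] nonzero[OF uv(1-3)] uv 3 by simp
    moreover have "y3 b = 0" using pair[OF uv'(1) 3(1)] nonzero[OF uv'(1-3)] uv' 3 by simp
    ultimately show False using nonzero[OF 3(1)] 3 by blast
  qed
qed

text \<open>
  Modulo \<open>q\<close> the indicator of \<open>m \<noteq> 1\<close> is \<open>1 - m\<close> for a power \<open>m\<close> of \<open>q\<close>.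
\<close>

lemma two_edges_singular_count:
  fixes E :: "'e \<Rightarrow> 'v \<Rightarrow> 'f::{field,finite}"
  assumes es: "distinct es" and vs: "distinct vs" and ab: "a \<in> set es" "b \<in> set es" "a \<noteq> b"
    and r: "3 \<le> length vs"
  shows "[zero_count (set es - {a, b}) (\<lambda>x. two_edge_minors_vanish E es vs a b x)
    = int CARD('f) ^ (length es - 2)] (mod int CARD('f))"
proof -
  let ?q = "int CARD('f)" let ?A = "set es - {a, b}"
  let ?m = "kernel_size E (set es) (set vs) ?A"
  have card: "card ?A = length es - 2" "card (set es) = length es" "card (set vs) = length vs"
    using ab es vs by (simp_all add: card_Diff_subset distinct_card)
  have two: "2 \<le> length es"
  proof -
    have "card {a, b} \<le> card (set es)" using ab by (intro card_mono) auto
    then show ?thesis using ab(3) card by simp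
  qed
  have "zero_count ?A (\<lambda>x. two_edge_minors_vanish E es vs a b x)
    = (\<Sum>x\<in>vectors ?A. of_bool (?m x \<noteq> 1))"
    unfolding zero_count_def
  proof (intro sum.cong refl arg_cong[of _ _ of_bool])
    fix x :: "'e \<Rightarrow> 'f" assume "x \<in> vectors ?A"
    then have "x a = 0" "x b = 0" by (auto simp: vectors_def)
    then show "(two_edge_minors_vanish E es vs a b x) \<longleftrightarrow> ?m x \<noteq> 1"
      by (rule two_edges_singular_iff[OF es vs ab])
  qed
  moreover have "[(\<Sum>x\<in>vectors ?A. of_bool (?m x \<noteq> 1)) = (\<Sum>x\<in>vectors ?A. 1 - ?m x)] (mod ?q)"
  proof (rule cong_sum)
    fix x
    obtain k where "?m x = ?q ^ k"
      using kernel_size_power[of ?A "set es" "set vs" E x] by auto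
    then show "[of_bool (?m x \<noteq> 1) = 1 - ?m x] (mod ?q)"
      by (cases k) (auto simp: cong_iff_dvd_diff)
  qed
  moreover have "(\<Sum>x\<in>vectors ?A. 1 - ?m x) = ?q ^ (length es - 2) - (\<Sum>x\<in>vectors ?A. ?m x)"
    by (simp add: sum_subtractf card_vectors card)
  moreover have "?q ^ 1 dvd (\<Sum>x\<in>vectors ?A. ?m x)"
    by (rule sum_kernel_size_dvd) (use r card two in auto)
  then have "[?q ^ (length es - 2) - (\<Sum>x\<in>vectors ?A. ?m x) = ?q ^ (length es - 2)] (mod ?q)"
    by (simp add: cong_iff_dvd_diff)
  ultimately show ?thesis by (auto intro: cong_trans)
qed

lemma sum_zero_linear:
  fixes a b :: "'f::{field,finite}"
  shows "(\<Sum>t\<in>UNIV. of_bool (a * t + b = 0)) = int CARD('f) * of_bool (a = 0 \<and> b = 0) + 1 - of_bool (a = 0)"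
proof (cases "a = 0")
  case False
  then have "of_bool (a * t + b = 0) = (if t = - b / a then 1 else 0 :: int)" for t
    by (auto simp: field_simps add_eq_0_iff)
  then show ?thesis using False by simp
qed auto

text \<open>
  If one of the slopes is nonzero, a common zero is unique, and exists iff the resultant vanishes.
\<close>

lemma sum_zero_two_linear:
  fixes a b c d :: "'f::{field,finite}"
  shows "(\<Sum>t\<in>UNIV. of_bool (a * t + b = 0 \<and> c * t + d = 0))
    = int CARD('f) * of_bool (a = 0 \<and> b = 0 \<and> c = 0 \<and> d = 0) + of_bool (a * d = b * c) - of_bool (a = 0 \<and> c = 0)"
proof -
  consider "a = 0" "c = 0" | "a \<noteq> 0" | "a = 0" "c \<noteq> 0" by blast
  then show ?thesis
  proof cases
    case 2
    have "a * t + b = 0 \<longleftrightarrow> t = - b / a" for t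
      using 2 by (auto simp: field_simps add_eq_0_iff)
    moreover have "c * (- b / a) + d = 0 \<longleftrightarrow> a * d = b * c"
      using 2 by (auto simp: field_simps)
    ultimately have "of_bool (a * t + b = 0 \<and> c * t + d = 0) = (if t = - b / a then of_bool (a * d = b * c) else 0 :: int)" for t
      by auto
    then show ?thesis using 2 by simp
  next
    case 3
    then have "of_bool (a * t + b = 0 \<and> c * t + d = 0) = (if t = - d / c then of_bool (a * d = b * c) else 0 :: int)" for t
      by (auto simp: field_simps add_eq_0_iff)
    then show ?thesis using 3 by simp
  qed auto
qed

lemma zero_count_insert:
  fixes P :: "('e \<Rightarrow> 'f::{zero,finite}) \<Rightarrow> bool"
  assumes "finite A" "e \<notin> A"
  shows "zero_count (insert e A) P = (\<Sum>x\<in>vectors A. \<Sum>t\<in>UNIV. of_bool (P (x(e := t))))"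
proof -
  have "bij_betw (\<lambda>(x, t). x(e := t)) (vectors A \<times> (UNIV :: 'f set)) (vectors (insert e A))"
    by (rule bij_betw_byWitness[where f' = "\<lambda>x. (x(e := 0), x e)"])
      (use assms(2) in \<open>auto simp: vectors_def fun_eq_iff\<close>)
  from sum.reindex_bij_betw[OF this, of "\<lambda>x. of_bool (P x) :: int", symmetric]
  show ?thesis
    unfolding zero_count_def sum.cartesian_product by (simp only: case_prod_unfold)
qed

lemma zero_count_cong:
  assumes "\<And>x. x \<in> vectors A \<Longrightarrow> P x \<longleftrightarrow> Q x"
  shows "zero_count A P = zero_count A Q"
  unfolding zero_count_def using assms by (intro sum.cong) auto

lemma zero_count_disj:
  "zero_count A (\<lambda>x. P x \<or> Q x) = zero_count A P + zero_count A Q - zero_count A (\<lambda>x. P x \<and> Q x)"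
  unfolding zero_count_def sum.distrib[symmetric] sum_subtractf[symmetric]
  by (intro sum.cong) (auto simp: of_bool_def)

lemma zero_count_True:
  "finite A \<Longrightarrow> zero_count A (\<lambda>_ :: 'e \<Rightarrow> 'f::{zero,finite}. True) = int CARD('f) ^ card A"
  by (simp add: zero_count_def card_vectors)

lemma zero_count_linear:
  fixes f a b :: "('e \<Rightarrow> 'f::{field,finite}) \<Rightarrow> 'f"
  assumes A: "finite A" "e \<notin> A" and f: "\<And>x t. x \<in> vectors A \<Longrightarrow> f (x(e := t)) = a x * t + b x"
  shows "zero_count (insert e A) (\<lambda>x. f x = 0)
    = int CARD('f) * zero_count A (\<lambda>x. a x = 0 \<and> b x = 0) + int CARD('f) ^ card A - zero_count A (\<lambda>x. a x = 0)"
proof -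
  have "zero_count (insert e A) (\<lambda>x. f x = 0) = (\<Sum>x\<in>vectors A. \<Sum>t\<in>UNIV. of_bool (a x * t + b x = 0))"
    unfolding zero_count_insert[OF A] by (intro sum.cong refl) (simp add: f)
  then show ?thesis
    by (simp add: sum_zero_linear zero_count_def sum.distrib sum_subtractf sum_distrib_left card_vectors A(1))
qed

lemma zero_count_two_linear:
  fixes f g a b c d :: "('e \<Rightarrow> 'f::{field,finite}) \<Rightarrow> 'f"
  assumes A: "finite A" "e \<notin> A" and f: "\<And>x t. x \<in> vectors A \<Longrightarrow> f (x(e := t)) = a x * t + b x"
    and g: "\<And>x t. x \<in> vectors A \<Longrightarrow> g (x(e := t)) = c x * t + d x"
  shows "zero_count (insert e A) (\<lambda>x. f x = 0 \<and> g x = 0)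
    = int CARD('f) * zero_count A (\<lambda>x. a x = 0 \<and> b x = 0 \<and> c x = 0 \<and> d x = 0)
      + zero_count A (\<lambda>x. a x * d x = b x * c x) - zero_count A (\<lambda>x. a x = 0 \<and> c x = 0)"
proof -
  have "zero_count (insert e A) (\<lambda>x. f x = 0 \<and> g x = 0)
      = (\<Sum>x\<in>vectors A. \<Sum>t\<in>UNIV. of_bool (a x * t + b x = 0 \<and> c x * t + d x = 0))"
    unfolding zero_count_insert[OF A] by (intro sum.cong refl) (simp add: f g)
  then show ?thesis
    by (simp add: sum_zero_two_linear zero_count_def sum.distrib sum_subtractf sum_distrib_left)
qed

text \<open>
  The zeros of \<open>f * g\<close> are those of \<open>f\<close> and of \<open>g\<close>, and the common ones are counted by the resultant. Fibres on
  which \<open>f\<close> or \<open>g\<close> vanishes identically contribute multiples of \<open>q\<close>.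
\<close>

lemma zero_count_product:
  fixes f g a b c d :: "('e \<Rightarrow> 'f::{field,finite}) \<Rightarrow> 'f"
  assumes A: "finite A" "e \<notin> A" and f: "\<And>x t. x \<in> vectors A \<Longrightarrow> f (x(e := t)) = a x * t + b x"
    and g: "\<And>x t. x \<in> vectors A \<Longrightarrow> g (x(e := t)) = c x * t + d x"
  shows "[zero_count (insert e A) (\<lambda>x. f x * g x = 0)
    = 2 * int CARD('f) ^ card A - zero_count A (\<lambda>x. a x * c x = 0) - zero_count A (\<lambda>x. a x * d x = b x * c x)]
      (mod int CARD('f))"
proof -
  let ?q = "int CARD('f)"
  have "zero_count (insert e A) (\<lambda>x. f x * g x = 0)
      = zero_count (insert e A) (\<lambda>x. f x = 0) + zero_count (insert e A) (\<lambda>x. g x = 0)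
        - zero_count (insert e A) (\<lambda>x. f x = 0 \<and> g x = 0)"
    using zero_count_disj[of "insert e A" "\<lambda>x. f x = 0" "\<lambda>x. g x = 0"] by simp
  moreover have "zero_count A (\<lambda>x. a x * c x = 0)
      = zero_count A (\<lambda>x. a x = 0) + zero_count A (\<lambda>x. c x = 0) - zero_count A (\<lambda>x. a x = 0 \<and> c x = 0)"
    using zero_count_disj[of A "\<lambda>x. a x = 0" "\<lambda>x. c x = 0"] by simp
  ultimately have "zero_count (insert e A) (\<lambda>x. f x * g x = 0)
    - (2 * ?q ^ card A - zero_count A (\<lambda>x. a x * c x = 0) - zero_count A (\<lambda>x. a x * d x = b x * c x))
    = ?q * (zero_count A (\<lambda>x. a x = 0 \<and> b x = 0) + zero_count A (\<lambda>x. c x = 0 \<and> d x = 0)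
      - zero_count A (\<lambda>x. a x = 0 \<and> b x = 0 \<and> c x = 0 \<and> d x = 0))"
    by (simp add: zero_count_linear[OF A f] zero_count_linear[OF A g] zero_count_two_linear[OF A f g] algebra_simps)
  then show ?thesis by (simp add: cong_iff_dvd_diff)
qed

section \<open>Elimination of four edges\<close>

lemma cong_int_ex:
  fixes a b m :: int
  shows "[a = b] (mod m) \<Longrightarrow> \<exists>k. a = b + m * k"
  by (metis cong_iff_lin cong_sym)

lemma config_minor_upd:
  fixes E :: "'e \<Rightarrow> 'v \<Rightarrow> 'r::comm_ring_1"
  assumes "distinct es" "I \<subseteq> set es" "J \<subseteq> set es" "card I = card J" "m \<in> set es" "m \<notin> I" "m \<notin> J"
    and "x m = 0"
  shows "config_minor E es vs I J (x(m := t))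
    = (position_sign es I J m * config_minor E es vs (insert m I) (insert m J) x) * t + config_minor E es vs I J x"
proof -
  have "config_minor E es vs (insert m I) (insert m J) (x(m := t)) = config_minor E es vs (insert m I) (insert m J) x"
    by (rule config_minor_cong) auto
  moreover have "x(m := t, m := 0) = x" using assms(8) by auto
  ultimately show ?thesis
    using config_minor_expand[OF assms(1-7), of E vs "x(m := t)"] by (simp add: mult_ac)
qed

lemma config_minor_loop_upd:
  fixes E :: "'e \<Rightarrow> 'v \<Rightarrow> 'r::comm_ring_1"
  assumes "distinct es" "I \<subseteq> set es" "J \<subseteq> set es" "card I = card J" "m \<in> set es" "m \<notin> I" "m \<notin> J"
  shows "config_minor (E(m := \<lambda>_. 0)) es vs I J (x(m := t))
    = (position_sign es I J m * config_minor E es vs (insert m I) (insert m J) x) * t + 0"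
proof -
  have "config_minor E es vs (insert m I) (insert m J) (x(m := t)) = config_minor E es vs (insert m I) (insert m J) x"
    by (rule config_minor_cong) auto
  then show ?thesis
    using config_minor_loop[OF assms(1-7), of E vs "x(m := t)"] by (simp add: mult_ac)
qed

lemma position_sign_neq_0 [simp]: "position_sign es I J m \<noteq> (0 :: 'r::comm_ring_1)"
  using position_sign_square[of es I J m, where ?'a = 'r] by auto

lemma position_sign_extra:
  assumes "j \<notin> I" "j \<notin> J" "finite I" "finite J"
  shows "position_sign es (insert j I) (insert j J) m = position_sign es I J m"
proof -
  have "card (insert j I \<inter> B) = of_bool (j \<in> B) + card (I \<inter> B)" if "j \<notin> I" "finite I" for I B
    using that by (auto simp: Int_insert_left)
  then show ?thesis
    using assms by (simp add: position_sign_def Let_def power_add)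
qed

text \<open>
  The factors of the product of which the five-invariant is the resultant carry the same sign.
\<close>

lemma position_sign_exchange:
  fixes i j k l m :: 'e
  assumes "distinct [i, j, k, l]"
  shows "position_sign es {i, k} {j, l} m = position_sign es {i, j} {k, l} m"
proof -
  have "card ({a, b} \<inter> B) = of_bool (a \<in> B) + of_bool (b \<in> B)" if "a \<noteq> b" for a b :: 'e and B
    using that by (auto simp: Int_insert_left)
  then show ?thesis
    using assms by (simp add: position_sign_def Let_def power_add mult_ac)
qed

context
  fixes es :: "'e list" and vs :: "'v list"
  assumes es: "distinct es" and vs: "distinct vs"
    and le: "length es \<le> 2 * length vs" and r: "3 \<le> length vs"
begin

lemma card_edges: "card (set es) = length es"
  using es by (simp add: distinct_card)

text \<open>
  A graph with fewer edges and the same number of vertices satisfies the strict inequality.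
\<close>

lemma zero_count_deleted:
  fixes E :: "'e \<Rightarrow> 'v \<Rightarrow> 'f::{field,finite}"
  assumes I: "I \<subseteq> set es" "I \<noteq> {}"
  shows "[zero_count (set es - I) (\<lambda>x. config_minor E es vs I I x = 0) = int CARD('f) ^ (length es - card I)]
    (mod int CARD('f) ^ 3)"
proof -
  let ?es = "filter (\<lambda>e. e \<notin> I) es"
  have set: "set ?es = set es - I" by auto
  have "length ?es = card (set es - I)"
    using distinct_card[of ?es] es unfolding set by simp
  then have len: "length ?es = length es - card I"
    using I by (simp add: card_Diff_subset finite_subset[OF I(1)] card_edges)
  have "card I \<noteq> 0" using I finite_subset[OF I(1)] by auto
  moreover have "card I \<le> length es"
    using card_mono[OF _ I(1)] by (simp add: card_edges)
  ultimately show ?thesis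
    using zero_count_config_minor[of ?es vs 3 E] es vs le r
    by (simp add: config_minor_delete[symmetric] set len[symmetric]) (simp add: len set set_diff_eq)
qed

text \<open>
  The polynomial is the product of the variable of \<open>m\<close> and the polynomial of the graph without \<open>m\<close>.
\<close>

lemma zero_count_loop:
  fixes E :: "'e \<Rightarrow> 'v \<Rightarrow> 'f::{field,finite}"
  assumes m: "m \<in> set es" and N: "3 \<le> length es"
  shows "int CARD('f) ^ 3 dvd config_zeros (E(m := \<lambda>_. 0)) es vs"
proof -
  let ?q = "int CARD('f)" let ?A = "set es - {m}"
  have S: "set es = insert m ?A" using m by auto
  have card: "card ?A = length es - 1" using m by (simp add: card_edges)
  have "config_zeros (E(m := \<lambda>_. 0)) es vs
    = zero_count (insert m ?A) (\<lambda>x. config_minor (E(m := \<lambda>_. 0)) es vs {} {} x = 0)"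
    using S by simp
  also have "\<dots> = ?q * zero_count ?A (\<lambda>x. config_minor E es vs {m} {m} x = 0) + ?q ^ (length es - 1)
      - zero_count ?A (\<lambda>x. config_minor E es vs {m} {m} x = 0)"
    by (subst zero_count_linear[where a = "\<lambda>x. config_minor E es vs {m} {m} x" and b = "\<lambda>_. 0"])
      (use m in \<open>auto simp: config_minor_loop_upd[OF es] card\<close>)
  finally have eq: "config_zeros (E(m := \<lambda>_. 0)) es vs
    = ?q * zero_count ?A (\<lambda>x. config_minor E es vs {m} {m} x = 0) + ?q ^ (length es - 1)
      - zero_count ?A (\<lambda>x. config_minor E es vs {m} {m} x = 0)" .
  obtain k where k: "zero_count ?A (\<lambda>x. config_minor E es vs {m} {m} x = 0) = ?q ^ (length es - 1) + ?q ^ 3 * k"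
    using cong_int_ex[OF zero_count_deleted[of "{m}" E]] m by auto
  obtain M where M: "length es = M + 3" using N by (metis add.commute le_Suc_ex)
  have "config_zeros (E(m := \<lambda>_. 0)) es vs
    = ?q ^ 3 * (?q ^ M + ?q * k - k)"
    unfolding eq k M by (simp add: algebra_simps power_add eval_nat_numeral)
  then show ?thesis by simp
qed

text \<open>
  By Dodgson's identity the resultant of the coefficients of \<open>a\<close> with respect to \<open>b\<close> is the negative
  product of the minors for \<open>a, b\<close> and \<open>b, a\<close>, which vanish at the same points. The other terms
  are counts for the graphs without \<open>a\<close>, without \<open>b\<close> and without both, and \<open>two_edges_singular_count\<close>.
\<close>

lemma zero_count_eliminate_two:
  fixes E :: "'e \<Rightarrow> 'v \<Rightarrow> 'f::{field,finite}"
  assumes ab: "a \<in> set es" "b \<in> set es" "a \<noteq> b" and N: "4 \<le> length es"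
  shows "[config_zeros E es vs
    = int CARD('f) * zero_count (set es - {a, b}) (\<lambda>x. config_minor E es vs {a} {b} x = 0)] (mod int CARD('f) ^ 3)"
proof -
  let ?q = "int CARD('f)"
  define A where "A = set es - {a, b}"
  let ?D = "config_minor E es vs"
  have S: "set es = insert a (insert b A)" and Sa: "set es - {a} = insert b A" and Sb: "set es - {b} = insert a A"
    using ab by (auto simp: A_def)
  obtain M where M: "length es = M + 4" using N by (metis add.commute le_Suc_ex)
  have card: "card A = M + 2" "card (insert b A) = M + 3"
    using ab M by (simp_all add: A_def card_Diff_subset card_edges)
  define Z where "Z = zero_count (set es) (\<lambda>x. ?D {} {} x = 0)"
  define T where "T = zero_count (insert b A) (\<lambda>x. ?D {a} {a} x = 0 \<and> ?D {} {} x = 0)"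
  define Pa where "Pa = zero_count (set es - {a}) (\<lambda>x. ?D {a} {a} x = 0)"
  define Pb where "Pb = zero_count (set es - {b}) (\<lambda>x. ?D {b} {b} x = 0)"
  define Pab where "Pab = zero_count A (\<lambda>x. ?D {a, b} {a, b} x = 0)"
  define W where "W = zero_count A (\<lambda>x. ?D {a, b} {a, b} x = 0 \<and> ?D {b} {b} x = 0)"
  define V where "V = zero_count A (\<lambda>x. ?D {} {} x = 0 \<and> ?D {a} {a} x = 0 \<and>
      ?D {b} {b} x = 0 \<and> ?D {a, b} {a, b} x = 0)"
  define P where "P = zero_count A (\<lambda>x. ?D {a} {b} x = 0)"
  have zero: "x a = 0" "x b = 0" if "x \<in> vectors A" for x :: "'e \<Rightarrow> 'f"
    using that by (auto simp: vectors_def A_def)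
  have zero': "x a = 0" if "x \<in> vectors (insert b A)" for x :: "'e \<Rightarrow> 'f"
    using that ab by (auto simp: vectors_def A_def)
  have 1: "Z = ?q * T + ?q ^ (M + 3) - Pa"
    unfolding Z_def T_def Pa_def S Sa card(2)[symmetric]
    by (subst zero_count_linear[where a = "?D {a} {a}" and b = "?D {} {}"])
      (use ab zero' in \<open>auto simp: A_def config_minor_upd[OF es]\<close>)
  have "T = ?q * zero_count A (\<lambda>x. ?D {a, b} {a, b} x = 0 \<and> ?D {a} {a} x = 0 \<and> ?D {b} {b} x = 0 \<and> ?D {} {} x = 0)
    + zero_count A (\<lambda>x. ?D {a, b} {a, b} x * ?D {} {} x = ?D {a} {a} x * ?D {b} {b} x)
    - zero_count A (\<lambda>x. ?D {a, b} {a, b} x = 0 \<and> ?D {b} {b} x = 0)"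
    unfolding T_def
    by (subst zero_count_two_linear[where a = "?D {a, b} {a, b}" and b = "?D {a} {a}" and c = "?D {b} {b}" and d = "?D {} {}"])
      (use ab zero in \<open>auto simp: A_def config_minor_upd[OF es] insert_commute\<close>)
  moreover have "zero_count A (\<lambda>x. ?D {a, b} {a, b} x = 0 \<and> ?D {a} {a} x = 0 \<and> ?D {b} {b} x = 0 \<and> ?D {} {} x = 0) = V"
    unfolding V_def by (rule zero_count_cong) auto
  moreover have "zero_count A (\<lambda>x. ?D {a, b} {a, b} x * ?D {} {} x = ?D {a} {a} x * ?D {b} {b} x) = P"
    unfolding P_def
  proof (rule zero_count_cong)
    fix x
    have "?D {} {} x * ?D {a, b} {a, b} x = ?D {a} {a} x * ?D {b} {b} x - ?D {a} {b} x * ?D {b} {a} x"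
      using config_minor_Dodgson[OF es, of "{}" "{}" a b E vs x] ab by simp
    moreover have "?D {b} {a} x = 0 \<longleftrightarrow> ?D {a} {b} x = 0"
      using config_minor_sym[OF es vs, of "{a}" "{b}" E x] ab by simp
    ultimately show "?D {a, b} {a, b} x * ?D {} {} x = ?D {a} {a} x * ?D {b} {b} x \<longleftrightarrow> ?D {a} {b} x = 0"
      by (auto simp: mult.commute)
  qed
  ultimately have 2: "T = ?q * V + P - W" by (simp add: W_def)
  have 3: "Pb = ?q * W + ?q ^ (M + 2) - Pab"
    unfolding Pb_def W_def Pab_def Sb card(1)[symmetric]
    by (subst zero_count_linear[where a = "?D {a, b} {a, b}" and b = "?D {b} {b}"])
      (use ab zero in \<open>auto simp: A_def config_minor_upd[OF es]\<close>)
  have exk1: "length es - card {a} = M + 3" and exk2: "length es - card {b} = M + 3"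
    and exk3: "length es - card {a, b} = M + 2"
    using M ab(3) by simp_all
  have ck1: "[Pa = ?q ^ (M + 3)] (mod ?q ^ 3)"
    unfolding Pa_def exk1[symmetric] by (rule zero_count_deleted) (use ab in auto)
  obtain k1 where k1: "Pa = ?q ^ (M + 3) + ?q ^ 3 * k1"
    using cong_int_ex[OF ck1] by blast
  have ck2: "[Pb = ?q ^ (M + 3)] (mod ?q ^ 3)"
    unfolding Pb_def exk2[symmetric] by (rule zero_count_deleted) (use ab in auto)
  obtain k2 where k2: "Pb = ?q ^ (M + 3) + ?q ^ 3 * k2"
    using cong_int_ex[OF ck2] by blast
  have ck3: "[Pab = ?q ^ (M + 2)] (mod ?q ^ 3)"
    unfolding Pab_def A_def exk3[symmetric] by (rule zero_count_deleted) (use ab in auto)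
  obtain k3 where k3: "Pab = ?q ^ (M + 2) + ?q ^ 3 * k3"
    using cong_int_ex[OF ck3] by blast
  obtain k4 where k4: "V = ?q ^ (M + 2) + ?q * k4"
    using cong_int_ex[OF two_edges_singular_count[OF es vs ab r, of E]] M by (auto simp: V_def A_def)
  have qW: "?q * W = ?q ^ (M + 3) + ?q ^ 3 * (k2 + k3)"
    using 3 unfolding k2 k3 by (simp add: algebra_simps)
  have "Z - ?q * P = ?q * ?q * V - ?q * W + ?q ^ (M + 3) - Pa"
    unfolding 1 2 by (simp add: algebra_simps)
  also have "\<dots> = ?q ^ 3 * (?q * ?q ^ M - ?q ^ M + k4 - k2 - k3 - k1)"
    unfolding qW k1 k4 by (simp add: algebra_simps power_add eval_nat_numeral)
  finally show ?thesis
    unfolding cong_iff_dvd_diff Z_def[symmetric] A_def[symmetric] P_def[symmetric] by simp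
qed

text \<open>
  The number \<open>Q\<close> of zeros of the leading coefficient follows from the elimination of two edges
  in the graph in which \<open>j\<close> is a self-loop.
\<close>

lemma zero_count_eliminate_three:
  fixes E :: "'e \<Rightarrow> 'v \<Rightarrow> 'f::{field,finite}"
  assumes ilj: "{i, l, j} \<subseteq> set es" "distinct [i, l, j]" and N: "4 \<le> length es"
  shows "[config_zeros E es vs
    = int CARD('f) ^ 2 * zero_count (set es - {i, l, j})
      (\<lambda>x. config_minor E es vs {i, j} {l, j} x = 0 \<and> config_minor E es vs {i} {l} x = 0)] (mod int CARD('f) ^ 3)"
proof -
  let ?q = "int CARD('f)" let ?B = "set es - {i, l, j}"
  let ?D = "config_minor E es vs" let ?L = "config_minor (E(j := \<lambda>_. 0)) es vs"
  have S: "set es - {i, l} = insert j ?B" using ilj by auto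
  obtain M where M: "length es = M + 4" using N by (metis add.commute le_Suc_ex)
  have card: "card ?B = M + 1"
    using ilj M by (simp add: card_Diff_subset card_edges)
  define C where "C = zero_count ?B (\<lambda>x. ?D {i, j} {l, j} x = 0 \<and> ?D {i} {l} x = 0)"
  define Q where "Q = zero_count ?B (\<lambda>x. ?D {i, j} {l, j} x = 0)"
  let ?s = "position_sign es {i} {l} j :: 'f"
  have zero: "x j = 0" if "x \<in> vectors ?B" for x :: "'e \<Rightarrow> 'f"
    using that by (auto simp: vectors_def)
  have comm: "insert j {i} = {i, j}" "insert j {l} = {l, j}" by auto
  have P: "zero_count (set es - {i, l}) (\<lambda>x. ?D {i} {l} x = 0) = ?q * C + ?q ^ (M + 1) - Q"
    unfolding C_def Q_def S card[symmetric]
    by (subst zero_count_linear[where a = "\<lambda>x. ?s * ?D {i, j} {l, j} x" and b = "?D {i} {l}"])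
      (use ilj zero in \<open>auto simp: config_minor_upd[OF es] comm\<close>)
  have PL: "zero_count (set es - {i, l}) (\<lambda>x. ?L {i} {l} x = 0) = ?q * Q + ?q ^ (M + 1) - Q"
    unfolding Q_def S card[symmetric]
    by (subst zero_count_linear[where a = "\<lambda>x. ?s * ?D {i, j} {l, j} x" and b = "\<lambda>_. 0"])
      (use ilj in \<open>auto simp: config_minor_loop_upd[OF es] comm\<close>)
  obtain k1 where k1: "zero_count (set es) (\<lambda>x. ?D {} {} x = 0) = ?q * (?q * C + ?q ^ (M + 1) - Q) + ?q ^ 3 * k1"
    using cong_int_ex[OF zero_count_eliminate_two[of i l E]] ilj N unfolding P by auto
  obtain k2 where k2: "zero_count (set es) (\<lambda>x. ?L {} {} x = 0) = ?q * (?q * Q + ?q ^ (M + 1) - Q) + ?q ^ 3 * k2"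
    using cong_int_ex[OF zero_count_eliminate_two[of i l "E(j := \<lambda>_. 0)"]] ilj N unfolding PL by auto
  have "?q ^ 3 dvd zero_count (set es) (\<lambda>x. ?L {} {} x = 0)"
    by (rule zero_count_loop) (use ilj N in auto)
  then obtain k3 where "zero_count (set es) (\<lambda>x. ?L {} {} x = 0) = ?q ^ 3 * k3" by (elim dvdE)
  then have "?q * (?q * Q + ?q ^ (M + 1) - Q) = ?q * (?q ^ 2 * (k3 - k2))"
    unfolding k2 by (simp add: algebra_simps eval_nat_numeral)
  then have loop: "?q * Q + ?q ^ (M + 1) - Q = ?q ^ 2 * (k3 - k2)"
    by simp
  define n where "n = k3 - k2 + ?q * (k3 - k2) - Q - ?q ^ M"
  \<comment> \<open>the factor \<open>1 + q\<close> inverts the coefficient \<open>q - 1\<close> of \<open>Q\<close> up to sign, modulo \<open>q ^ 2\<close>\<close>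
  have Q: "?q ^ (M + 1) - Q = ?q ^ 2 * n"
  proof -
    have "(1 + ?q) * (?q * Q + ?q ^ (M + 1) - Q) = (1 + ?q) * (?q ^ 2 * (k3 - k2))"
      unfolding loop ..
    then show ?thesis by (simp add: n_def algebra_simps eval_nat_numeral)
  qed
  have "zero_count (set es) (\<lambda>x. ?D {} {} x = 0) - ?q ^ 2 * C = ?q * (?q ^ (M + 1) - Q) + ?q ^ 3 * k1"
    unfolding k1 by (simp add: algebra_simps power2_eq_square)
  also have "\<dots> = ?q ^ 3 * (n + k1)"
    unfolding Q by (simp add: algebra_simps eval_nat_numeral)
  finally show ?thesis
    unfolding cong_iff_dvd_diff C_def[symmetric] by simp
qed

text \<open>
  The resultant of the two minors with respect to \<open>k\<close> factorizes by Dodgson's identity. The common zeros \<open>Y\<close> of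
  the leading coefficients are counted in the graph in which \<open>k\<close> is a self-loop.
\<close>

lemma zero_count_eliminate_four:
  fixes E :: "'e \<Rightarrow> 'v \<Rightarrow> 'f::{field,finite}"
  assumes ijkl: "{i, j, k, l} \<subseteq> set es" "distinct [i, j, k, l]"
  shows "[config_zeros E es vs
    = int CARD('f) ^ 2 * (zero_count (set es - {i, j, k, l})
      (\<lambda>x. config_minor E es vs {i, j} {k, l} x * config_minor E es vs {i, k} {j, l} x = 0)
        - int CARD('f) ^ (length es - 4))] (mod int CARD('f) ^ 3)"
proof -
  let ?q = "int CARD('f)" let ?B = "set es - {i, j, k, l}"
  let ?D = "config_minor E es vs" let ?L = "config_minor (E(k := \<lambda>_. 0)) es vs"
  have S: "set es - {i, l, j} = insert k ?B" using ijkl by auto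
  have "card {i, j, k, l} \<le> card (set es)" using ijkl by (intro card_mono) auto
  then have N: "4 \<le> length es" using ijkl by (simp add: card_edges)
  then obtain M where M: "length es = M + 4" by (metis add.commute le_Suc_ex)
  have card: "card ?B = M"
    using ijkl M by (simp add: card_Diff_subset card_edges)
  let ?s = "position_sign es {i} {l} k :: 'f"
  have sign: "position_sign es {i, j} {l, j} k = ?s"
  proof -
    have "insert j {i} = {i, j}" "insert j {l} = {l, j}" by auto
    with position_sign_extra[of j "{i}" "{l}" es k] ijkl show ?thesis by auto
  qed
  have zero: "x k = 0" if "x \<in> vectors ?B" for x :: "'e \<Rightarrow> 'f"
    using that by (auto simp: vectors_def)
  define C where "C = zero_count (set es - {i, l, j}) (\<lambda>x. ?D {i, j} {l, j} x = 0 \<and> ?D {i} {l} x = 0)"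
  define CL where "CL = zero_count (set es - {i, l, j}) (\<lambda>x. ?L {i, j} {l, j} x = 0 \<and> ?L {i} {l} x = 0)"
  define X where "X = zero_count ?B (\<lambda>x. ?D {i, j} {k, l} x * ?D {i, k} {j, l} x = 0)"
  define Y where "Y = zero_count ?B (\<lambda>x. ?D {k, i, j} {k, l, j} x = 0 \<and> ?D {k, i} {k, l} x = 0)"
  have Y: "zero_count ?B (\<lambda>x. ?s * ?D {k, i, j} {k, l, j} x = 0 \<and> ?s * ?D {k, i} {k, l} x = 0) = Y"
    by (simp add: Y_def)
  have X: "zero_count ?B (\<lambda>x. (?s * ?D {k, i, j} {k, l, j} x) * ?D {i} {l} x = ?D {i, j} {l, j} x * (?s * ?D {k, i} {k, l} x)) = X"
    unfolding X_def
  proof (rule zero_count_cong)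
    fix x
    have D: "?D {i} {l} x * ?D {k, i, j} {k, l, j} x = ?D {i, j} {l, j} x * ?D {k, i} {k, l} x - ?D {i, j} {k, l} x * ?D {i, k} {j, l} x"
      using config_minor_Dodgson[OF es, of "{i}" "{l}" j k E vs x] ijkl by (auto simp: insert_commute)
    have "?s * ?D {k, i, j} {k, l, j} x * ?D {i} {l} x - ?D {i, j} {l, j} x * (?s * ?D {k, i} {k, l} x)
        = ?s * (?D {i} {l} x * ?D {k, i, j} {k, l, j} x - ?D {i, j} {l, j} x * ?D {k, i} {k, l} x)"
      by (simp add: algebra_simps)
    also have "\<dots> = - ?s * (?D {i, j} {k, l} x * ?D {i, k} {j, l} x)"
      unfolding D by simp
    finally have "?s * ?D {k, i, j} {k, l, j} x * ?D {i} {l} x - ?D {i, j} {l, j} x * (?s * ?D {k, i} {k, l} x)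
        = - ?s * (?D {i, j} {k, l} x * ?D {i, k} {j, l} x)" .
    then have "?s * ?D {k, i, j} {k, l, j} x * ?D {i} {l} x = ?D {i, j} {l, j} x * (?s * ?D {k, i} {k, l} x)
      \<longleftrightarrow> - ?s * (?D {i, j} {k, l} x * ?D {i, k} {j, l} x) = 0"
      by (metis eq_iff_diff_eq_0)
    then show "(?s * ?D {k, i, j} {k, l, j} x) * ?D {i} {l} x = ?D {i, j} {l, j} x * (?s * ?D {k, i} {k, l} x)
      \<longleftrightarrow> ?D {i, j} {k, l} x * ?D {i, k} {j, l} x = 0"
      by simp
  qed
  have C: "\<exists>n. C = ?q * n + X - Y"
    unfolding C_def S X[symmetric] Y[symmetric]
    by (subst zero_count_two_linear[where a = "\<lambda>x. ?s * ?D {k, i, j} {k, l, j} x" and b = "?D {i, j} {l, j}"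
          and c = "\<lambda>x. ?s * ?D {k, i} {k, l} x" and d = "?D {i} {l}"])
      (use ijkl zero in \<open>auto simp: config_minor_upd[OF es] sign\<close>)
  have CL: "CL = ?q * Y + ?q ^ M - Y"
    unfolding CL_def S Y[symmetric] card[symmetric]
    by (subst zero_count_two_linear[where a = "\<lambda>x. ?s * ?D {k, i, j} {k, l, j} x" and b = "\<lambda>_. 0"
          and c = "\<lambda>x. ?s * ?D {k, i} {k, l} x" and d = "\<lambda>_. 0"])
      (use ijkl zero in \<open>auto simp: config_minor_loop_upd[OF es] sign zero_count_True\<close>)
  obtain n where n: "C = ?q * n + X - Y" using C by blast
  obtain k1 where k1: "zero_count (set es) (\<lambda>x. ?D {} {} x = 0) = ?q ^ 2 * C + ?q ^ 3 * k1"
    using cong_int_ex[OF zero_count_eliminate_three[of i l j E]] ijkl N by (auto simp: C_def)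
  obtain k2 where k2: "zero_count (set es) (\<lambda>x. ?L {} {} x = 0) = ?q ^ 2 * CL + ?q ^ 3 * k2"
    using cong_int_ex[OF zero_count_eliminate_three[of i l j "E(k := \<lambda>_. 0)"]] ijkl N by (auto simp: CL_def)
  have "?q ^ 3 dvd zero_count (set es) (\<lambda>x. ?L {} {} x = 0)"
    by (rule zero_count_loop) (use ijkl N in auto)
  then obtain k3 where "zero_count (set es) (\<lambda>x. ?L {} {} x = 0) = ?q ^ 3 * k3" by (elim dvdE)
  then have "?q ^ 2 * CL = ?q ^ 2 * (?q * (k3 - k2))"
    unfolding k2 by (simp add: algebra_simps eval_nat_numeral)
  then have "CL = ?q * (k3 - k2)" by simp
  then have Yeq: "Y = ?q * Y + ?q ^ M - ?q * (k3 - k2)" using CL by simp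
  have "C - (X - ?q ^ M) = ?q * n - Y + ?q ^ M" using n by simp
  also have "\<dots> = ?q * (n - Y + k3 - k2)"
    by (subst Yeq) (simp add: algebra_simps)
  finally have Ceq: "C = X - ?q ^ M + ?q * (n - Y + k3 - k2)" by simp
  have "zero_count (set es) (\<lambda>x. ?D {} {} x = 0) - ?q ^ 2 * (X - ?q ^ M) = ?q ^ 3 * (n - Y + k3 - k2 + k1)"
    unfolding k1 Ceq by (simp add: algebra_simps eval_nat_numeral)
  then show ?thesis
    unfolding cong_iff_dvd_diff X_def[symmetric] M by simp
qed

text \<open>
  The function \<open>h\<close> is the product that belongs to the graph in which \<open>e\<close> is a self-loop: its zeros are
  those of the variable of \<open>e\<close> and of the leading coefficient \<open>a * c\<close>. As the polynomial of that graph has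
  \<open>0\<close> zeros modulo \<open>q ^ 3\<close>, the number of zeros of \<open>a * c\<close> is determined.
\<close>

lemma zero_count_reduction_step:
  fixes E :: "'e \<Rightarrow> 'v \<Rightarrow> 'f::{field,finite}" and f g a b c d :: "('e \<Rightarrow> 'f) \<Rightarrow> 'f"
  assumes A: "insert e A \<subseteq> set es" "e \<notin> A" and N: "3 \<le> length es"
    and f: "\<And>x t. x \<in> vectors A \<Longrightarrow> f (x(e := t)) = a x * t + b x"
    and g: "\<And>x t. x \<in> vectors A \<Longrightarrow> g (x(e := t)) = c x * t + d x"
    and h: "\<And>x t. x \<in> vectors A \<Longrightarrow> h (x(e := t)) = 0 \<longleftrightarrow> t = 0 \<or> a x * c x = 0"
    and prod: "[config_zeros E es vs
      = s * int CARD('f) ^ 2 * (zero_count (insert e A) (\<lambda>x. f x * g x = 0) - int CARD('f) ^ Suc (card A))]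
      (mod int CARD('f) ^ 3)"
    and loop: "[config_zeros (E(e := \<lambda>_. 0)) es vs
      = s * int CARD('f) ^ 2 * (zero_count (insert e A) (\<lambda>x. h x = (0::'f)) - int CARD('f) ^ Suc (card A))]
      (mod int CARD('f) ^ 3)"
    and s: "s \<in> {1, - 1}"
  shows "[config_zeros E es vs
      = - s * int CARD('f) ^ 2 * (zero_count A (\<lambda>x. a x * d x = b x * c x) - int CARD('f) ^ card A)]
      (mod int CARD('f) ^ 3)"
proof -
  let ?q = "int CARD('f)"
  define Z where "Z = config_zeros E es vs"
  define ZL where "ZL = config_zeros (E(e := \<lambda>_. 0)) es vs"
  define X where "X = zero_count (insert e A) (\<lambda>x. f x * g x = 0)"
  define Y where "Y = zero_count A (\<lambda>x. a x * c x = 0)"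
  define R where "R = zero_count A (\<lambda>x. a x * d x = b x * c x)"
  have A': "finite A" using A(1) finite_subset by auto
  have XL: "zero_count (insert e A) (\<lambda>x. h x = 0) = ?q * Y + ?q ^ card A - Y"
  proof -
    have "(\<Sum>t\<in>UNIV. of_bool (h (x(e := t)) = 0)) = ?q * of_bool (a x * c x = 0) + 1 - of_bool (a x * c x = 0)"
      if "x \<in> vectors A" for x
    proof -
      have "(\<Sum>t\<in>UNIV. of_bool (h (x(e := t)) = 0)) = (\<Sum>t\<in>UNIV. of_bool (a x * c x * t + 0 = 0) :: int)"
        using h[OF that] by (intro sum.cong) auto
      then show ?thesis unfolding sum_zero_linear by simp
    qed
    then have "zero_count (insert e A) (\<lambda>x. h x = 0)
        = (\<Sum>x\<in>vectors A. ?q * of_bool (a x * c x = 0) + 1 - of_bool (a x * c x = 0))"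
      unfolding zero_count_insert[OF A' A(2)] by (intro sum.cong refl)
    then show ?thesis
      unfolding Y_def zero_count_def
      by (simp add: sum.distrib sum_subtractf sum_distrib_left card_vectors A' del: mult_eq_0_iff)
  qed
  obtain k1 where k1: "Z = s * ?q ^ 2 * (X - ?q ^ Suc (card A)) + ?q ^ 3 * k1"
    using cong_int_ex[OF prod] by (auto simp: Z_def X_def)
  obtain k2 where k2: "ZL = s * ?q ^ 2 * (?q * Y + ?q ^ card A - Y - ?q ^ Suc (card A)) + ?q ^ 3 * k2"
    using cong_int_ex[OF loop] unfolding XL by (auto simp: ZL_def)
  have "?q ^ 3 dvd ZL"
    unfolding ZL_def by (rule zero_count_loop) (use A N in auto)
  then obtain k3 where "ZL = ?q ^ 3 * k3" by (elim dvdE)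
  with k2 have "?q ^ 2 * (s * (?q * Y + ?q ^ card A - Y - ?q ^ Suc (card A))) = ?q ^ 2 * (?q * (k3 - k2))"
    by (simp add: algebra_simps eval_nat_numeral)
  then have "s * (?q * Y + ?q ^ card A - Y - ?q ^ Suc (card A)) = ?q * (k3 - k2)" by simp
  then have "s * (s * (?q * Y + ?q ^ card A - Y - ?q ^ Suc (card A))) = s * (?q * (k3 - k2))"
    by simp
  then have "s * s * (?q * Y + ?q ^ card A - Y - ?q ^ Suc (card A)) = ?q * (s * (k3 - k2))"
    by (simp only: mult_ac)
  moreover have "s * s = 1" using s by auto
  ultimately have Yeq: "Y = ?q ^ card A + ?q * (Y - ?q ^ card A - s * (k3 - k2))"
    by (simp add: algebra_simps)
  obtain k4 where k4: "X = 2 * ?q ^ card A - Y - R + ?q * k4"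
    using cong_int_ex[OF zero_count_product[OF A' A(2) f g]] unfolding X_def Y_def R_def by auto
  define n where "n = Y - ?q ^ card A - s * (k3 - k2)"
  have Yn: "Y = ?q ^ card A + ?q * n" using Yeq by (simp add: n_def)
  have "Z - (- s * ?q ^ 2 * (R - ?q ^ card A)) = ?q ^ 3 * (s * (k4 - n - ?q ^ card A) + k1)"
    unfolding k1 k4 Yn by (simp add: algebra_simps eval_nat_numeral)
  then show ?thesis
    unfolding cong_iff_dvd_diff Z_def[symmetric] R_def[symmetric] by simp
qed

end

section \<open>Denominator reduction\<close>

definition loop_at :: "'e \<Rightarrow> ('v, 'e) pre_digraph \<Rightarrow> ('v, 'e) pre_digraph" where
  "loop_at e G = G\<lparr>head := (head G)(e := tail G e)\<rparr>"

lemma arcs_loop_at [simp]: "arcs (loop_at e G) = arcs G"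
  by (simp add: loop_at_def)

lemma incidence_value_loop_at: "incidence_value (loop_at e G) = (incidence_value G)(e := \<lambda>_. 0)"
  by (auto simp: incidence_value_def loop_at_def fun_eq_iff)

lemma dodgson_eq_config_minor:
  "dodgson G es vs I J K = config_minor (incidence_value G) es vs I J (\<lambda>e. if e \<in> K then 0 else Var e)"
  using eval_dodgson[of Var G es vs I J K] by (simp add: eval_mpoly_Var_id)

lemma dodgson_loop_at:
  assumes "distinct es" "I \<subseteq> set es" "J \<subseteq> set es" "card I = card J" "e \<in> set es" "e \<notin> I" "e \<notin> J" "e \<notin> K"
  shows "dodgson (loop_at e G) es vs I J K
    = position_sign es I J e * Var e * dodgson G es vs (insert e I) (insert e J) K"
  using config_minor_loop[OF assms(1-7), of "incidence_value G" vs "\<lambda>e. if e \<in> K then 0 else Var e"] assms(8)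
  by (simp add: dodgson_eq_config_minor incidence_value_loop_at)

lemma poly_in_dodgson:
  assumes "distinct es" "I \<subseteq> set es" "J \<subseteq> set es" "card I = card J" "e \<in> set es" "e \<notin> I" "e \<notin> J" "e \<notin> K"
  shows "poly_in e (dodgson G es vs I J K)
    = [:dodgson G es vs I J (insert e K), position_sign es I J e * dodgson G es vs (insert e I) (insert e J) K:]"
proof -
  let ?x = "\<lambda>f. if f \<in> K then 0 else if f = e then [:0, 1:] else [:Var f:]"
  let ?E = "incidence_value G" 
  have const: "[:dodgson G es vs I J K:] = config_minor (incidence_value G) es vs I J (\<lambda>f. if f \<in> K then 0 else [:Var f:])"
    for I J K
    using eval_dodgson[of "\<lambda>f. [:Var f:]" G es vs I J K]
      hom_eval_mpoly[OF comm_ring_hom_const_poly, of Var "dodgson G es vs I J K"]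
    by (simp add: eval_mpoly_Var_id)
  have "poly_in e (dodgson G es vs I J K) = config_minor ?E es vs I J ?x"
    unfolding poly_in_def eval_dodgson ..
  also have "\<dots> = position_sign es I J e * ?x e * config_minor ?E es vs (insert e I) (insert e J) ?x
      + config_minor ?E es vs I J (?x(e := 0))"
    by (rule config_minor_expand[OF assms(1-7)])
  also have "config_minor ?E es vs (insert e I) (insert e J) ?x = [:dodgson G es vs (insert e I) (insert e J) K:]"
    unfolding const by (rule config_minor_cong) auto
  also have "config_minor ?E es vs I J (?x(e := 0)) = [:dodgson G es vs I J (insert e K):]"
    unfolding const by (rule config_minor_cong) auto
  finally show ?thesis
    using assms(8) position_sign_cases[of es I J e, where ?'a = "'a int_mpoly poly"]
    by (auto simp: position_sign_def Let_def minus_one_power_iff)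
qed

lemma five_invariant_eq:
  "five_invariant G es vs i j k l m
    = dodgson G es vs {i, j} {k, l} {m} * dodgson G es vs {i, k, m} {j, l, m} {}
      - dodgson G es vs {i, k} {j, l} {m} * dodgson G es vs {i, j, m} {k, l, m} {}"
proof -
  let ?A = "mat_of_rows_list 2
       [[dodgson G es vs {i, j} {k, l} {m}, dodgson G es vs {i, k} {j, l} {m}],
        [dodgson G es vs {i, j, m} {k, l, m} {}, dodgson G es vs {i, k, m} {j, l, m} {}]]"
  have "?A \<in> carrier_mat 2 2" by (rule carrier_matI) (simp_all add: mat_of_rows_list_def)
  then show ?thesis
    unfolding five_invariant_def by (subst det_2x2) (auto simp: mat_of_rows_list_def)
qed

lemma eval_five_invariant:
  "eval_mpoly x (five_invariant G es vs i j k l m)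
    = (let D = config_minor (incidence_value G) es vs; x0 = x(m := 0) in
      D {i, j} {k, l} x0 * D {i, k, m} {j, l, m} x - D {i, k} {j, l} x0 * D {i, j, m} {k, l, m} x)"
proof -
  have "(\<lambda>e. if e \<in> {m} then 0 else x e) = x(m := 0)" by auto
  then show ?thesis
    by (simp add: five_invariant_eq eval_mpoly.hom_minus eval_mpoly_mult eval_dodgson Let_def)
qed

text \<open>
  Each of the four Dodgson polynomials is of degree at most one in \<open>e\<close>, and for the self-loop only its
  leading term remains.
\<close>

lemma five_invariant_loop_at:
  assumes es: "distinct es" and d: "distinct [i, j, k, l, m]" "{i, j, k, l, m} \<subseteq> set es"
    and e: "e \<in> set es - {i, j, k, l, m}"
  shows "degree (poly_in e (five_invariant G es vs i j k l m)) \<le> 2"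
    "five_invariant (loop_at e G) es vs i j k l m
      = Var e ^ 2 * coeff (poly_in e (five_invariant G es vs i j k l m)) 2"
proof -
  let ?D = "dodgson G es vs" let ?s = "\<lambda>I J. position_sign es I J e :: 'a int_mpoly"
  have u: "poly_in e (five_invariant G es vs i j k l m)
    = poly_in e (?D {i, j} {k, l} {m}) * poly_in e (?D {i, k, m} {j, l, m} {})
      - poly_in e (?D {i, k} {j, l} {m}) * poly_in e (?D {i, j, m} {k, l, m} {})"
    unfolding five_invariant_eq by (simp add: poly_in.hom_minus poly_in.hom_mult)
  have u': "poly_in e (?D {i, j} {k, l} {m}) = [:?D {i, j} {k, l} {e, m}, ?s {i, j} {k, l} * ?D {e, i, j} {e, k, l} {m}:]"
    "poly_in e (?D {i, k, m} {j, l, m} {}) = [:?D {i, k, m} {j, l, m} {e}, ?s {i, k, m} {j, l, m} * ?D {e, i, k, m} {e, j, l, m} {}:]"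
    "poly_in e (?D {i, k} {j, l} {m}) = [:?D {i, k} {j, l} {e, m}, ?s {i, k} {j, l} * ?D {e, i, k} {e, j, l} {m}:]"
    "poly_in e (?D {i, j, m} {k, l, m} {}) = [:?D {i, j, m} {k, l, m} {e}, ?s {i, j, m} {k, l, m} * ?D {e, i, j, m} {e, k, l, m} {}:]"
    using d e by (subst poly_in_dodgson[OF es]; auto)+
  have l: "dodgson (loop_at e G) es vs {i, j} {k, l} {m} = ?s {i, j} {k, l} * Var e * ?D {e, i, j} {e, k, l} {m}"
    "dodgson (loop_at e G) es vs {i, k, m} {j, l, m} {} = ?s {i, k, m} {j, l, m} * Var e * ?D {e, i, k, m} {e, j, l, m} {}"
    "dodgson (loop_at e G) es vs {i, k} {j, l} {m} = ?s {i, k} {j, l} * Var e * ?D {e, i, k} {e, j, l} {m}"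
    "dodgson (loop_at e G) es vs {i, j, m} {k, l, m} {} = ?s {i, j, m} {k, l, m} * Var e * ?D {e, i, j, m} {e, k, l, m} {}"
    using d e by (subst dodgson_loop_at[OF es]; auto)+
  have deg: "degree ([:a, b:] * [:c, d:]) \<le> 2" and coeff: "coeff ([:a, b:] * [:c, d:]) 2 = b * d"
    for a b c d :: "'a int_mpoly"
    by (rule order_trans[OF degree_mult_le]) (auto simp: numeral_2_eq_2 intro: order_trans[OF degree_pCons_le])
  show "degree (poly_in e (five_invariant G es vs i j k l m)) \<le> 2"
    unfolding u u' by (intro degree_diff_le deg)
  show "five_invariant (loop_at e G) es vs i j k l m
      = Var e ^ 2 * coeff (poly_in e (five_invariant G es vs i j k l m)) 2"
    unfolding u u' coeff_diff coeff unfolding five_invariant_eq l by (simp add: algebra_simps power2_eq_square)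
qed

lemma denom_red_edges:
  assumes "denom_red G es vs ns D"
  shows "distinct ns \<and> set ns \<subseteq> arcs G"
  using assms by (induction rule: denom_red.induct) auto

text \<open>
  Degrees in \<open>e\<close> add up in a factorization, so the coefficients of top degree of the two factors
  can be chosen with degrees of sum two; their resultant is the top coefficient of the resultant.
\<close>

lemma denom_red_loop_at:
  assumes "denom_red G es vs ns D" "distinct es" "set es = arcs G" "e \<in> arcs G - set ns"
  shows "degree (poly_in e D) \<le> 2 \<and> denom_red (loop_at e G) es vs ns (Var e ^ 2 * coeff (poly_in e D) 2)"
  using assms
proof (induction rule: denom_red.induct)
  case (five i j k l m s)
  let ?P = "five_invariant G es vs i j k l m"
  have P: "degree (poly_in e ?P) \<le> 2" "five_invariant (loop_at e G) es vs i j k l m = Var e ^ 2 * coeff (poly_in e ?P) 2"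
    using five_invariant_loop_at[of es i j k l m e G vs] five by auto
  have "poly_in e (s * ?P) = smult s (poly_in e ?P)"
    using five.hyps(3) by (auto simp: poly_in.hom_uminus)
  then have "degree (poly_in e (s * ?P)) \<le> 2"
    "Var e ^ 2 * coeff (poly_in e (s * ?P)) 2 = s * five_invariant (loop_at e G) es vs i j k l m"
    using P(1) degree_smult_le[of s "poly_in e ?P"] by (auto simp: P(2))
  then show ?case
    using denom_red.five[of i j k l m "loop_at e G" s es vs] five.hyps by auto
next
  case (step ns D f a b c d s)
  let ?P = "a * Var f + b" let ?Q = "c * Var f + d"
  have IH: "degree (poly_in e D) \<le> 2" "denom_red (loop_at e G) es vs ns (Var e ^ 2 * coeff (poly_in e D) 2)"
    using step.IH step.prems by auto
  have ef: "e \<noteq> f" "f \<in> arcs G - set ns" using step by auto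
  have f_notin: "f \<notin> vars a" "f \<notin> vars b" "f \<notin> vars c" "f \<notin> vars d"
    using step.hyps(3) by auto
  show ?case
  proof (cases "D = 0")
    \<comment> \<open>degrees do not add up for \<open>D = 0\<close>, but one of the factors vanishes, and so does the resultant\<close>
    case True
    then have "?P = 0 \<or> ?Q = 0" using step.hyps(4) mpoly_mult_eq_0[of ?P ?Q] by simp
    then have res: "a * d - b * c = 0"
      using linear_eq_0[of a f b] linear_eq_0[of c f d] f_notin by auto
    have "denom_red (loop_at e G) es vs (ns @ [f]) (s * (0 * 0 - 0 * 0))"
      by (rule denom_red.step[OF IH(2)]) (use True ef step.hyps(5) in auto)
    then show ?thesis unfolding res by simp
  next
    case False
    then have nz: "?P \<noteq> 0" "?Q \<noteq> 0" using step.hyps(4) by auto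
    have "degree (poly_in e ?P) + degree (poly_in e ?Q) \<le> 2"
      using degree_poly_in_mult[OF nz, of e] IH(1) step.hyps(4) by simp
    then have "degree (poly_in e ?P) + (2 - degree (poly_in e ?P)) = 2" "degree (poly_in e ?Q) \<le> 2 - degree (poly_in e ?P)"
      by auto
    then obtain i1 i2 where i: "i1 + i2 = 2" "degree (poly_in e ?P) \<le> i1" "degree (poly_in e ?Q) \<le> i2"
      by blast
    \<comment> \<open>no cancellation between the terms, because \<open>f\<close> occurs neither in \<open>a\<close> nor in \<open>b\<close>\<close>
    have split: "degree (poly_in e a) \<le> n \<and> degree (poly_in e b) \<le> n"
      if "degree (poly_in e (a * Var f + b)) \<le> n" "f \<notin> vars a" "f \<notin> vars b" for a b n
    proof -
      have "coeff (poly_in e a) i = 0 \<and> coeff (poly_in e b) i = 0" if "i > n" for i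
      proof (rule linear_eq_0[of _ f])
        have "coeff (poly_in e (a * Var f + b)) i = 0"
          using \<open>degree (poly_in e (a * Var f + b)) \<le> n\<close> that by (simp add: coeff_eq_0)
        then show "coeff (poly_in e a) i * Var f + coeff (poly_in e b) i = 0"
          using ef(1) by (simp add: poly_in.hom_add poly_in.hom_mult poly_in_Var mult.commute)
      qed (use vars_coeff_poly_in[of e a i] vars_coeff_poly_in[of e b i] \<open>f \<notin> vars a\<close> \<open>f \<notin> vars b\<close> in auto)
      then show ?thesis by (meson degree_le)
    qed
    have ab: "degree (poly_in e a) \<le> i1" "degree (poly_in e b) \<le> i1"
      using split[OF i(2) f_notin(1,2)] by auto
    have cd: "degree (poly_in e c) \<le> i2" "degree (poly_in e d) \<le> i2"
      using split[OF i(3) f_notin(3,4)] by auto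
    let ?t = "\<lambda>p i. coeff (poly_in e p) i"
    have V: "Var e ^ 2 = Var e ^ i1 * Var e ^ i2"
      by (simp add: i(1)[symmetric] power_add)
    have top: "?t D 2 = (?t a i1 * Var f + ?t b i1) * (?t c i2 * Var f + ?t d i2)"
    proof -
      have "?t D 2 = ?t ?P i1 * ?t ?Q i2"
        unfolding step.hyps(4) poly_in.hom_mult i(1)[symmetric] by (rule coeff_mult_top[OF i(2,3)])
      then show ?thesis
        using ef(1) by (simp add: poly_in.hom_add poly_in.hom_mult poly_in_Var mult.commute)
    qed
    have deg: "degree (poly_in e (p * q)) \<le> 2" "?t (p * q) 2 = ?t p i1 * ?t q i2"
      if "degree (poly_in e p) \<le> i1" "degree (poly_in e q) \<le> i2" for p q
      using coeff_mult_top[OF that] i(1) that degree_mult_le[of "poly_in e p" "poly_in e q"]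
      by (simp_all add: poly_in.hom_mult)
    have s: "poly_in e (s * p) = smult s (poly_in e p)" for p
      using step.hyps(5) by (auto simp: poly_in.hom_uminus)
    have "degree (poly_in e (s * (a * d - b * c))) \<le> 2"
      unfolding s poly_in.hom_minus
      by (rule order_trans[OF degree_smult_le]) (intro degree_diff_le deg ab cd)
    moreover have "Var e ^ 2 * ?t (s * (a * d - b * c)) 2
      = s * ((Var e ^ i1 * ?t a i1) * (Var e ^ i2 * ?t d i2) - (Var e ^ i1 * ?t b i1) * (Var e ^ i2 * ?t c i2))"
    proof -
      have C: "?t (s * (a * d - b * c)) 2 = s * (?t a i1 * ?t d i2 - ?t b i1 * ?t c i2)"
        unfolding s poly_in.hom_minus coeff_smult coeff_diff deg(2)[OF ab(1) cd(2)] deg(2)[OF ab(2) cd(1)] ..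
      show ?thesis unfolding C V by (simp add: algebra_simps)
    qed
    moreover have "denom_red (loop_at e G) es vs (ns @ [f])
      (s * ((Var e ^ i1 * ?t a i1) * (Var e ^ i2 * ?t d i2) - (Var e ^ i1 * ?t b i1) * (Var e ^ i2 * ?t c i2)))"
    proof (rule denom_red.step[OF IH(2)])
      show "f \<in> arcs (loop_at e G) - set ns" using ef by simp
      show "s \<in> {1, - 1}" by fact
      show "Var e ^ 2 * ?t D 2 = (Var e ^ i1 * ?t a i1 * Var f + Var e ^ i1 * ?t b i1) *
        (Var e ^ i2 * ?t c i2 * Var f + Var e ^ i2 * ?t d i2)"
        unfolding top V by (simp add: algebra_simps)
      have v: "vars (Var e ^ n * ?t p i) \<subseteq> insert e (vars p)" for n p i
        using vars_mult[of "Var e ^ n" "?t p i"] vars_power[of "Var e" n] vars_coeff_poly_in[of e p i] by auto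
      have "insert e (vars a \<union> vars b \<union> vars c \<union> vars d) \<subseteq> arcs (loop_at e G) - set (ns @ [f])"
        using step.hyps(3) step.prems by auto
      then show "vars (Var e ^ i1 * ?t a i1) \<union> vars (Var e ^ i1 * ?t b i1) \<union> vars (Var e ^ i2 * ?t c i2)
          \<union> vars (Var e ^ i2 * ?t d i2) \<subseteq> arcs (loop_at e G) - set (ns @ [f])"
        using v[of i1 a i1] v[of i1 b i1] v[of i2 c i2] v[of i2 d i2] by blast
    qed
    ultimately show ?thesis by simp
  qed
qed

text \<open>
  As the eliminated variables do not occur in the result, its zeros may be counted among points with
  any fixed values there.
\<close>

lemma denom_red_local:
  assumes "denom_red G es vs ns D" "set es = arcs G" "\<And>e. e \<in> arcs G - set ns \<Longrightarrow> x e = y e"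
  shows "eval_mpoly x D = eval_mpoly y D"
  using assms(1,3)
proof (cases rule: denom_red.cases)
  case (five i j k l m s)
  have "eval_mpoly x (five_invariant G es vs i j k l m) = eval_mpoly y (five_invariant G es vs i j k l m)"
    unfolding eval_five_invariant Let_def
    by (intro arg_cong2[of _ _ _ _ "(-)"] arg_cong2[of _ _ _ _ "(*)"] config_minor_cong)
      (use assms(2,3) five(1) in auto)
  then show ?thesis using five by (auto simp: eval_mpoly_mult eval_mpoly.hom_uminus eval_mpoly_1)
next
  case (step ns' D' e a b c d s)
  have "eval_mpoly x p = eval_mpoly y p" if "vars p \<subseteq> arcs G - set ns" for p
    by (rule eval_mpoly_cong) (use that assms(3) in auto)
  then show ?thesis using step by (auto simp: eval_mpoly.hom_minus eval_mpoly_mult eval_mpoly.hom_uminus)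
qed

text \<open>
  The correction \<open>q ^ (N - n)\<close> makes the congruence valid up to \<open>n = N\<close>, and at \<open>n = N\<close> it is \<open>1\<close>. The induction is
  over all graphs with the given edges at once, because the step for \<open>G\<close> also uses the graph with a self-loop.
\<close>

lemma denom_red_count:
  fixes F :: "'f::{field,finite} itself" and G :: "('v, 'e) pre_digraph"
  assumes es: "distinct es" and vs: "distinct vs"
    and le: "length es \<le> 2 * length vs" and r: "3 \<le> length vs"
    and red: "denom_red G es vs ns D" and arcs: "set es = arcs G"
  shows "[zero_count (set es) (\<lambda>x :: 'e \<Rightarrow> 'f. config_minor (incidence_value G) es vs {} {} x = 0)
    = (- 1) ^ length ns * int CARD('f) ^ 2 *
      (zero_count (set es - set ns) (\<lambda>x :: 'e \<Rightarrow> 'f. eval_mpoly x D = 0) - int CARD('f) ^ (length es - length ns))]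
    (mod int CARD('f) ^ 3)"
  using red arcs
proof (induction ns arbitrary: G D rule: rev_induct)
  case Nil
  from Nil.prems(1) show ?case by cases auto
next
  case (snoc e ns)
  let ?q = "int CARD('f)" let ?E = "incidence_value G :: 'e \<Rightarrow> 'v \<Rightarrow> 'f"
  let ?A = "set es - set (ns @ [e])"
  have ns: "distinct (ns @ [e])" "set (ns @ [e]) \<subseteq> set es"
    using denom_red_edges[OF snoc.prems(1)] snoc.prems(2) by auto
  have "card (set (ns @ [e])) \<le> card (set es)" using ns(2) by (intro card_mono) auto
  then have len: "Suc (length ns) \<le> length es"
    using distinct_card[OF ns(1)] distinct_card[OF es] by simp
  have card: "card ?A = length es - length (ns @ [e])"
    using ns(2) distinct_card[OF ns(1)] distinct_card[OF es] by (subst card_Diff_subset) auto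
  then have cardA: "Suc (card ?A) = length es - length ns"
    using len by simp
  have ins: "insert e ?A = set es - set ns" using ns by auto
  have E_loop: "(incidence_value (loop_at e G) :: 'e \<Rightarrow> 'v \<Rightarrow> 'f) = ?E(e := \<lambda>_. 0)"
    by (rule incidence_value_loop_at)
  have A: "insert e ?A \<subseteq> set es" "e \<notin> ?A" using ns by auto
  from snoc.prems(1) show ?case
  proof (cases rule: denom_red.cases)
    case (five i j k l m s)
    then have ijkl: "ns = [i, j, k, l]" "m = e" by auto
    let ?D = "config_minor ?E es vs" and ?L = "config_minor (?E(e := \<lambda>_. 0)) es vs"
    let ?s = "position_sign es {i, j} {k, l} e :: 'f"
    have d: "distinct [i, j, k, l]" "{i, j, k, l} \<subseteq> set es" "e \<notin> {i, j, k, l}"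
      using ns ijkl by auto
    have sign: "position_sign es {i, k} {j, l} e = ?s"
      by (rule position_sign_exchange[OF d(1)])
    have zero: "x e = 0" if "x \<in> vectors ?A" for x :: "'e \<Rightarrow> 'f"
      using that by (auto simp: vectors_def)
    have set4: "{i, j, k, l} = set ns" "length es - 4 = Suc (card ?A)"
      using ijkl cardA by auto
    have "[zero_count (set es) (\<lambda>x. ?D {} {} x = 0)
      = - 1 * ?q ^ 2 * (zero_count ?A (\<lambda>x. (?s * ?D {e, i, j} {e, k, l} x) * ?D {i, k} {j, l} x
          = ?D {i, j} {k, l} x * (?s * ?D {e, i, k} {e, j, l} x)) - ?q ^ card ?A)] (mod ?q ^ 3)"
    proof (rule zero_count_reduction_step[OF es vs le r A, where f = "?D {i, j} {k, l}" and g = "?D {i, k} {j, l}"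
          and h = "\<lambda>x. ?L {i, j} {k, l} x * ?L {i, k} {j, l} x"])
      show "3 \<le> length es" using len ijkl by simp
      fix x :: "'e \<Rightarrow> 'f" and t assume x: "x \<in> vectors ?A"
      show "?D {i, j} {k, l} (x(e := t)) = (?s * ?D {e, i, j} {e, k, l} x) * t + ?D {i, j} {k, l} x"
        using d ns(2) zero[OF x] by (subst config_minor_upd[OF es]) auto
      show "?D {i, k} {j, l} (x(e := t)) = (?s * ?D {e, i, k} {e, j, l} x) * t + ?D {i, k} {j, l} x"
        using d ns(2) zero[OF x] by (subst config_minor_upd[OF es]) (auto simp: sign)
      show "?L {i, j} {k, l} (x(e := t)) * ?L {i, k} {j, l} (x(e := t)) = 0
        \<longleftrightarrow> t = 0 \<or> (?s * ?D {e, i, j} {e, k, l} x) * (?s * ?D {e, i, k} {e, j, l} x) = 0"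
        using d ns(2) by (subst (1 2) config_minor_loop_upd[OF es]) auto
    next
      show "[zero_count (set es) (\<lambda>x. ?D {} {} x = 0)
        = 1 * ?q ^ 2 * (zero_count (insert e ?A) (\<lambda>x. ?D {i, j} {k, l} x * ?D {i, k} {j, l} x = 0) - ?q ^ Suc (card ?A))]
        (mod ?q ^ 3)"
        using zero_count_eliminate_four[OF es vs le r d(2,1), of ?E] unfolding ins set4 by simp
      show "[zero_count (set es) (\<lambda>x. ?L {} {} x = 0)
        = 1 * ?q ^ 2 * (zero_count (insert e ?A) (\<lambda>x. ?L {i, j} {k, l} x * ?L {i, k} {j, l} x = 0) - ?q ^ Suc (card ?A))]
        (mod ?q ^ 3)"
        using zero_count_eliminate_four[OF es vs le r d(2,1), of "?E(e := \<lambda>_. 0)"] unfolding ins set4 by simp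
    qed simp
    moreover have "zero_count ?A (\<lambda>x. (?s * ?D {e, i, j} {e, k, l} x) * ?D {i, k} {j, l} x
          = ?D {i, j} {k, l} x * (?s * ?D {e, i, k} {e, j, l} x)) = zero_count ?A (\<lambda>x :: 'e \<Rightarrow> 'f. eval_mpoly x D = 0)"
    proof (rule zero_count_cong)
      fix x :: "'e \<Rightarrow> 'f" assume "x \<in> vectors ?A"
      then have x: "x(e := 0) = x" using zero by auto
      have "eval_mpoly x s \<noteq> (0 :: 'f)"
        using five(5) by (auto simp: eval_mpoly_1 eval_mpoly.hom_uminus)
      then have "eval_mpoly x D = 0 \<longleftrightarrow>
        ?D {i, j} {k, l} x * ?D {e, i, k} {e, j, l} x - ?D {i, k} {j, l} x * ?D {e, i, j} {e, k, l} x = 0"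
        unfolding five(2) eval_mpoly_mult eval_five_invariant ijkl Let_def x by (simp add: insert_commute)
      also have "\<dots> \<longleftrightarrow> ?s * (?D {i, j} {k, l} x * ?D {e, i, k} {e, j, l} x - ?D {i, k} {j, l} x * ?D {e, i, j} {e, k, l} x) = 0"
        by simp
      also have "\<dots> \<longleftrightarrow> (?s * ?D {e, i, j} {e, k, l} x) * ?D {i, k} {j, l} x
          = ?D {i, j} {k, l} x * (?s * ?D {e, i, k} {e, j, l} x)"
        by (auto simp: algebra_simps)
      finally show "(?s * ?D {e, i, j} {e, k, l} x) * ?D {i, k} {j, l} x
          = ?D {i, j} {k, l} x * (?s * ?D {e, i, k} {e, j, l} x) \<longleftrightarrow> eval_mpoly x D = 0" by simp
    qed
    ultimately show ?thesis unfolding card[symmetric] using ijkl(1) by simp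
  next
    case (step ns' D' f a b c d s)
    then have eq: "ns' = ns" "f = e" by auto
    note step = step[unfolded eq]
    have loc: "eval_mpoly (x(e := t)) p = eval_mpoly x p" if "p \<in> {a, b, c, d}" for x :: "'e \<Rightarrow> 'f" and t p
      by (rule eval_mpoly_cong) (use step(5) that in auto)
    have "[config_zeros ?E es vs
      = - ((- 1) ^ length ns) * ?q ^ 2 * (zero_count ?A (\<lambda>x :: 'e \<Rightarrow> 'f. eval_mpoly x a * eval_mpoly x d
          = eval_mpoly x b * eval_mpoly x c) - ?q ^ card ?A)] (mod ?q ^ 3)"
    proof (rule zero_count_reduction_step[OF es vs le r A, where f = "\<lambda>x. eval_mpoly x (a * Var e + b)"
          and g = "\<lambda>x. eval_mpoly x (c * Var e + d)" and h = "\<lambda>x. eval_mpoly x (Var e ^ 2 * coeff (poly_in e D') 2)"])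
      have "5 \<le> length ns" using step(3) by (induction rule: denom_red.induct) auto
      then show "3 \<le> length es" using len by simp
      fix x :: "'e \<Rightarrow> 'f" and t
      show "eval_mpoly (x(e := t)) (a * Var e + b) = eval_mpoly x a * t + eval_mpoly x b"
        "eval_mpoly (x(e := t)) (c * Var e + d) = eval_mpoly x c * t + eval_mpoly x d"
        by (simp_all add: eval_mpoly_add eval_mpoly_mult loc)
      have "coeff (poly_in e D') 2 = a * c"
      proof -
        have "poly_in e (a * Var e + b) = [:b, a:]" "poly_in e (c * Var e + d) = [:d, c:]"
        proof -
          have "e \<notin> vars a" "e \<notin> vars b" "e \<notin> vars c" "e \<notin> vars d"
            using step(5) by auto
          then show "poly_in e (a * Var e + b) = [:b, a:]" "poly_in e (c * Var e + d) = [:d, c:]"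
            by (simp_all add: poly_in.hom_add poly_in.hom_mult poly_in_Var poly_in_const)
        qed
        then show ?thesis unfolding step(6) poly_in.hom_mult by (simp add: numeral_2_eq_2)
      qed
      then show "eval_mpoly (x(e := t)) (Var e ^ 2 * coeff (poly_in e D') 2) = 0 \<longleftrightarrow> t = 0 \<or> eval_mpoly x a * eval_mpoly x c = 0"
        by (simp add: eval_mpoly_mult eval_mpoly.hom_power loc)
    next
      show "[config_zeros ?E es vs
        = (- 1) ^ length ns * ?q ^ 2 * (zero_count (insert e ?A) (\<lambda>x :: 'e \<Rightarrow> 'f. eval_mpoly x (a * Var e + b) * eval_mpoly x (c * Var e + d) = 0)
          - ?q ^ Suc (card ?A))] (mod ?q ^ 3)"
        using snoc.IH[OF step(3) snoc.prems(2)] unfolding cardA ins step(6) eval_mpoly_mult .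
      have arcs_loop: "set es = arcs (loop_at e G)" using snoc.prems(2) by simp
      have "denom_red (loop_at e G) es vs ns (Var e ^ 2 * coeff (poly_in e D') 2)"
        using denom_red_loop_at[OF step(3) es snoc.prems(2)] step(4) by blast
      from snoc.IH[OF this arcs_loop] show "[config_zeros (?E(e := \<lambda>_. 0)) es vs
        = (- 1) ^ length ns * ?q ^ 2 * (zero_count (insert e ?A) (\<lambda>x :: 'e \<Rightarrow> 'f. eval_mpoly x (Var e ^ 2 * coeff (poly_in e D') 2) = 0)
          - ?q ^ Suc (card ?A))] (mod ?q ^ 3)"
        unfolding cardA ins E_loop .
      show "(- 1) ^ length ns \<in> {1, - 1 :: int}"
        by (simp add: minus_one_power_iff)
    qed
    moreover have "zero_count ?A (\<lambda>x :: 'e \<Rightarrow> 'f. eval_mpoly x a * eval_mpoly x d = eval_mpoly x b * eval_mpoly x c)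
      = zero_count ?A (\<lambda>x :: 'e \<Rightarrow> 'f. eval_mpoly x D = 0)"
      using step(7) unfolding step(2)
      by (intro zero_count_cong) (auto simp: eval_mpoly_mult eval_mpoly.hom_minus eval_mpoly.hom_uminus eval_mpoly_1)
    ultimately show ?thesis unfolding card[symmetric] by simp
  qed
qed

section \<open>The matrix-tree theorem\<close>

definition edge_rel :: "('v, 'e) pre_digraph \<Rightarrow> 'e set \<Rightarrow> ('v \<times> 'v) set" where
  "edge_rel G T = (\<Union>e\<in>T. {(tail G e, head G e), (head G e, tail G e)})"

lemma edge_rel_sym: "(u, v) \<in> (edge_rel G T)\<^sup>* \<Longrightarrow> (v, u) \<in> (edge_rel G T)\<^sup>*"
proof -
  have "sym (edge_rel G T)" by (auto simp: edge_rel_def sym_def)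
  then show "(u, v) \<in> (edge_rel G T)\<^sup>* \<Longrightarrow> (v, u) \<in> (edge_rel G T)\<^sup>*"
    by (meson sym_rtrancl symD)
qed

lemma connected_iff_edge_rel:
  assumes "fin_digraph G" "T \<subseteq> arcs G" "verts G \<noteq> {}"
  shows "Digraph_Component.connected (G\<lparr>arcs := T\<rparr>)
    \<longleftrightarrow> (\<forall>u\<in>verts G. \<forall>v\<in>verts G. (u, v) \<in> (edge_rel G T)\<^sup>*)"
proof -
  interpret fin_digraph G by fact
  have rel: "parcs (mk_symmetric (G\<lparr>arcs := T\<rparr>)) = edge_rel G T"
    by (simp add: parcs_mk_symmetric edge_rel_def)
  have "(u, v) \<in> rtrancl_on (verts G) (edge_rel G T) \<longleftrightarrow> (u, v) \<in> (edge_rel G T)\<^sup>*"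
    if "u \<in> verts G" "v \<in> verts G" for u v
  proof
    assume "(u, v) \<in> (edge_rel G T)\<^sup>*"
    then show "(u, v) \<in> rtrancl_on (verts G) (edge_rel G T)"
      by (rule rtrancl_consistent_rtrancl_on) (use that assms(2) in \<open>auto simp: edge_rel_def\<close>)
  qed (rule rtrancl_on_rtranclI)
  then show ?thesis
    using assms(3) by (simp add: connected_def strongly_connected_def reachable_def rel)
qed

text \<open>
  A path that returns to one of its vertices is cut off there.
\<close>

lemma edge_rel_path:
  assumes "(u, v) \<in> (edge_rel G T)\<^sup>*"
  shows "\<exists>us cs. us \<noteq> [] \<and> hd us = u \<and> last us = v \<and> distinct us \<and> length us = Suc (length cs) \<and>
    set cs \<subseteq> T \<and> distinct cs \<and> (\<forall>i<length cs. {tail G (cs ! i), head G (cs ! i)} = {us ! i, us ! Suc i})"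
  using assms
proof (induction rule: rtrancl_induct)
  case base
  show ?case by (intro exI[of _ "[u]"] exI[of _ "[]"]) simp
next
  case (step y z)
  then obtain us cs where p: "us \<noteq> []" "hd us = u" "last us = y" "distinct us" "length us = Suc (length cs)"
    "set cs \<subseteq> T" "distinct cs" "\<forall>i<length cs. {tail G (cs ! i), head G (cs ! i)} = {us ! i, us ! Suc i}"
    by blast
  from step.hyps(2) obtain e where e: "e \<in> T" "{tail G e, head G e} = {y, z}"
    by (auto simp: edge_rel_def)
  show ?case
  proof (cases "z \<in> set us")
    case True
    then obtain j where j: "j < length us" "us ! j = z" by (auto simp: in_set_conv_nth)
    have "last (take (Suc j) us) = z"
      using j by (simp add: take_Suc_conv_app_nth)
    moreover have "hd (take (Suc j) us) = u" using p(1,2) by (cases us) auto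
    ultimately show ?thesis
      using p j by (intro exI[of _ "take (Suc j) us"] exI[of _ "take j cs"]) (auto dest: in_set_takeD)
  next
    case False
    have "e \<notin> set cs"
    proof
      assume "e \<in> set cs"
      then obtain i where i: "i < length cs" "cs ! i = e" by (auto simp: in_set_conv_nth)
      then have "z \<in> {us ! i, us ! Suc i}" using p(8) e(2) by blast
      then show False using False p(5) i(1) by auto
    qed
    moreover have "us ! length cs = y" using p(1,3,5) by (simp add: last_conv_nth)
    ultimately show ?thesis
      using p e False
      by (intro exI[of _ "us @ [z]"] exI[of _ "cs @ [e]"]) (auto simp: nth_append less_Suc_eq)
  qed
qed

lemma incidence_value_eq: "incidence_value G e v = of_bool (tail G e = v) - of_bool (head G e = v)"
  by (auto simp: incidence_value_def)

lemma sum_of_bool_mult: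
  assumes "finite A"
  shows "(\<Sum>a\<in>A. of_bool (b = a) * f a) = (if b \<in> A then f b else (0 :: 'r::comm_ring_1))"
proof -
  have "(\<Sum>a\<in>A. of_bool (b = a) * f a) = (\<Sum>a\<in>A. if b = a then f a else 0)"
    by (intro sum.cong) auto
  then show ?thesis using assms by simp
qed

lemma sum_incidence_value:
  assumes "finite V" "tail G e \<in> V" "head G e \<in> V"
  shows "(\<Sum>v\<in>V. incidence_value G e v * z v) = z (tail G e) - (z (head G e) :: 'r::comm_ring_1)"
  using assms by (simp add: incidence_value_eq left_diff_distrib sum_subtractf sum_of_bool_mult)

text \<open>
  The signed edges of a path from \<open>v0\<close> to \<open>u\<close> have boundary \<open>u - v0\<close>; these vectors are the rows of an
  integral left inverse of the reduced incidence matrix.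
\<close>

lemma edge_rel_integral_path:
  assumes "finite T" "(v0, u) \<in> (edge_rel G T)\<^sup>*"
  shows "\<exists>p :: 'e \<Rightarrow> int. \<forall>w. w \<noteq> v0 \<longrightarrow> (\<Sum>e\<in>T. p e * incidence_value G e w) = of_bool (w = u)"
  using assms(2)
proof (induction rule: rtrancl_induct)
  case base
  show ?case by (intro exI[of _ "\<lambda>_. 0"]) auto
next
  case (step y z)
  then obtain p :: "'e \<Rightarrow> int"
    where p: "\<And>w. w \<noteq> v0 \<Longrightarrow> (\<Sum>e\<in>T. p e * incidence_value G e w) = of_bool (w = y)" by blast
  from step.hyps(2) obtain f where f: "f \<in> T" "tail G f = y \<and> head G f = z \<or> tail G f = z \<and> head G f = y"
    by (auto simp: edge_rel_def)
  define s :: int where "s = (if tail G f = y \<and> head G f = z then - 1 else 1)"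
  have "(\<Sum>e\<in>T. (p e + of_bool (f = e) * s) * incidence_value G e w) = of_bool (w = z)" if "w \<noteq> v0" for w
  proof -
    have "(\<Sum>e\<in>T. (p e + of_bool (f = e) * s) * incidence_value G e w)
      = (\<Sum>e\<in>T. p e * incidence_value G e w) + (\<Sum>e\<in>T. of_bool (f = e) * (s * incidence_value G e w))"
      by (simp add: algebra_simps sum.distrib)
    also have "\<dots> = of_bool (w = y) + s * incidence_value G f w"
      using f(1) by (simp add: p[OF that] sum_of_bool_mult assms(1))
    also have "\<dots> = of_bool (w = z)"
    proof (cases "tail G f = y \<and> head G f = z")
      case True
      then have s: "s = - 1" unfolding s_def by (rule if_P)
      show ?thesis
        unfolding s incidence_value_eq conjunct1[OF True] conjunct2[OF True]
        by (cases "w = y"; cases "w = z") auto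
    next
      case False
      then have s: "s = 1" unfolding s_def by (rule if_not_P)
      have ends: "tail G f = z" "head G f = y" using False f(2) by blast+
      show ?thesis
        unfolding s incidence_value_eq ends by (cases "w = y"; cases "w = z") auto
    qed
    finally show ?thesis .
  qed
  then show ?case by (intro exI[of _ "\<lambda>e. p e + of_bool (f = e) * s"] allI impI)
qed

context
  fixes G :: "('v, 'e) pre_digraph" and es :: "'e list" and vs :: "'v list" and v0 :: 'v
  assumes graph: "fin_digraph G"
    and es: "distinct es" "set es = arcs G"
    and vs: "v0 \<in> verts G" "distinct vs" "set vs = verts G - {v0}"
begin

interpretation fin_digraph G by (rule graph)

text \<open>
  The vertex part of a kernel vector, extended by \<open>0\<close> to \<open>v0\<close>, is constant along the edges of \<open>T\<close>;
  the edge part is a relation between the rows of the incidence matrix.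
\<close>

lemma tree_minor_eq_0_iff:
  fixes F :: "'f::field itself"
  assumes T: "T \<subseteq> arcs G"
  shows "config_minor (incidence_value G) es vs (arcs G - T) (arcs G - T) (\<lambda>_. 0 :: 'f) = 0 \<longleftrightarrow>
    (\<exists>y z. y \<in> vectors T \<and> z \<in> vectors (set vs) \<and> (y \<noteq> (\<lambda>_. 0) \<or> z \<noteq> (\<lambda>_. 0)) \<and>
      (\<forall>e\<in>T. z (tail G e) = (z (head G e) :: 'f)) \<and> (\<forall>w\<in>set vs. (\<Sum>e\<in>T. incidence_value G e w * y e) = (0 :: 'f)))"
proof -
  have "edge_equation (incidence_value G) (set vs) (\<lambda>_. 0) y z e = z (tail G e) - (z (head G e) :: 'f)"
    if "e \<in> T" "z \<in> vectors (set vs)" for y z e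
  proof -
    have "z v0 = 0" using that vs by (auto simp: vectors_def)
    moreover have "(\<Sum>v\<in>verts G. incidence_value G e v * z v)
        = incidence_value G e v0 * z v0 + (\<Sum>v\<in>set vs. incidence_value G e v * z v)"
      using vs by (simp add: sum.remove[of "verts G" v0])
    moreover have "(\<Sum>v\<in>verts G. incidence_value G e v * z v) = z (tail G e) - z (head G e)"
      by (rule sum_incidence_value) (use that(1) T in auto)
    ultimately show ?thesis by (simp add: edge_equation_def)
  qed
  moreover have "vertex_equation (incidence_value G) (arcs G) y w = (\<Sum>e\<in>T. incidence_value G e w * (y e :: 'f))"
    if "y \<in> vectors T" for y w
    unfolding vertex_equation_def using that T by (intro sum.mono_neutral_right) (auto simp: vectors_def)
  moreover have "set es - (arcs G - T) = T" using es(2) T by auto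
  ultimately show ?thesis
    unfolding principal_minor_eq_0_iff[OF es(1) vs(2) Diff_subset[of "arcs G" T, folded es(2)]] es(2)[symmetric]
    unfolding es(2) by (auto cong: conj_cong)
qed

text \<open>
  The indicator of the vertices that cannot be reached from \<open>v0\<close> is the vertex part of a kernel vector.
\<close>

lemma disconnected_minor_eq_0:
  assumes T: "T \<subseteq> arcs G" and disc: "\<not> Digraph_Component.connected (G\<lparr>arcs := T\<rparr>)"
  shows "config_minor (incidence_value G) es vs (arcs G - T) (arcs G - T) (\<lambda>_. 0 :: 'f::field) = 0"
proof -
  have ne: "verts G \<noteq> {}" using vs by auto
  obtain u where u: "u \<in> verts G" "(v0, u) \<notin> (edge_rel G T)\<^sup>*"
    using disc unfolding connected_iff_edge_rel[OF graph T ne] by (meson edge_rel_sym rtrancl_trans)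
  define z :: "'v \<Rightarrow> 'f" where "z v = of_bool (v \<in> verts G \<and> (v0, v) \<notin> (edge_rel G T)\<^sup>*)" for v
  have "z (tail G e) = z (head G e)" if e: "e \<in> T" for e
  proof -
    have "(tail G e, head G e) \<in> edge_rel G T" "(head G e, tail G e) \<in> edge_rel G T"
      using e by (auto simp: edge_rel_def)
    moreover have "tail G e \<in> verts G" "head G e \<in> verts G" using e T by auto
    ultimately show ?thesis by (auto simp: z_def intro: rtrancl_into_rtrancl)
  qed
  moreover have "z u = 1" using u by (simp add: z_def)
  then have "z \<noteq> (\<lambda>_. 0)" by auto
  moreover have "z \<in> vectors (set vs)" using vs by (auto simp: vectors_def z_def)
  ultimately show ?thesis
    unfolding tree_minor_eq_0_iff[OF T] by (intro exI[of _ "\<lambda>_. 0"] exI[of _ z]) (auto simp: vectors_def)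
qed

text \<open>
  The indicator of the edges of the cycle, with signs for their directions, is the edge part of a kernel
  vector.
\<close>

lemma cycle_minor_eq_0:
  assumes T: "T \<subseteq> arcs G" and cycle: "undirected_cycle (G\<lparr>arcs := T\<rparr>) us cs"
  shows "config_minor (incidence_value G) es vs (arcs G - T) (arcs G - T) (\<lambda>_. 0 :: 'f::field) = 0"
proof -
  let ?n = "length cs" let ?next = "\<lambda>i. us ! (Suc i mod length cs)"
  have c: "cs \<noteq> []" "length us = ?n" "distinct cs" "set cs \<subseteq> T"
    "\<And>i. i < ?n \<Longrightarrow> {tail G (cs ! i), head G (cs ! i)} = {us ! i, ?next i}"
    using cycle by (auto simp: undirected_cycle_def)
  define s :: "nat \<Rightarrow> 'f" where "s i = (if tail G (cs ! i) = us ! i \<and> head G (cs ! i) = ?next i then 1 else - 1)" for i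
  define y where "y e = (\<Sum>i<?n. of_bool (cs ! i = e) * s i)" for e
  have s: "incidence_value G (cs ! i) w * s i = of_bool (us ! i = w) - of_bool (?next i = w)" if "i < ?n" for i w
  proof (cases "tail G (cs ! i) = us ! i \<and> head G (cs ! i) = ?next i")
    case True
    then show ?thesis by (simp add: s_def incidence_value_eq)
  next
    case False
    then have "s i = - 1" unfolding s_def by (rule if_not_P)
    moreover have "tail G (cs ! i) = ?next i" "head G (cs ! i) = us ! i"
      using c(5)[OF that] False unfolding doubleton_eq_iff by blast+
    ultimately show ?thesis by (simp add: incidence_value_eq)
  qed
  have shift: "(\<Sum>i<?n. f (Suc i mod ?n)) = (\<Sum>i<?n. f i)" for f :: "nat \<Rightarrow> 'f"
  proof -
    obtain m where m: "?n = Suc m" using c(1) by (cases cs) auto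
    have "(\<Sum>i<m. f (Suc i mod Suc m)) = (\<Sum>i<m. f (Suc i))" by (intro sum.cong) auto
    then show ?thesis unfolding m by (subst sum.lessThan_Suc_shift) (simp add: add.commute)
  qed
  have "(\<Sum>e\<in>T. incidence_value G e w * y e) = 0" for w
  proof -
    have fin: "finite T" by (rule finite_subset[OF T finite_arcs])
    have "(\<Sum>e\<in>T. incidence_value G e w * y e) = (\<Sum>i<?n. \<Sum>e\<in>T. of_bool (cs ! i = e) * (incidence_value G e w * s i))"
      unfolding y_def sum_distrib_left by (subst sum.swap) (simp add: mult_ac)
    also have "\<dots> = (\<Sum>i<?n. incidence_value G (cs ! i) w * s i)"
    proof (rule sum.cong)
      fix i assume "i \<in> {..<?n}"
      then have "cs ! i \<in> T" using c(4) by auto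
      then show "(\<Sum>e\<in>T. of_bool (cs ! i = e) * (incidence_value G e w * s i)) = incidence_value G (cs ! i) w * s i"
        by (simp add: sum_of_bool_mult fin)
    qed simp
    also have "\<dots> = (\<Sum>i<?n. of_bool (us ! i = w) - of_bool (?next i = w))"
      by (intro sum.cong) (auto simp: s)
    also have "\<dots> = 0"
      using shift[of "\<lambda>i. of_bool (us ! i = w)"] by (simp add: sum_subtractf)
    finally show ?thesis .
  qed
  moreover have "y (cs ! 0) \<noteq> 0"
  proof -
    have "y (cs ! 0) = (\<Sum>i<?n. of_bool (0 = i) * s i)"
      unfolding y_def using c(1,3) by (intro sum.cong) (auto simp: nth_eq_iff_index_eq)
    also have "\<dots> = s 0" using c(1) by (subst sum_of_bool_mult) auto
    finally show ?thesis by (simp add: s_def)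
  qed
  then have "y \<noteq> (\<lambda>_. 0)" by auto
  moreover have "y \<in> vectors T"
  proof -
    have "cs ! i \<in> T" if "i < ?n" for i using c(4) that by auto
    then have "y e = 0" if "e \<notin> T" for e
      unfolding y_def using that by (intro sum.neutral) auto
    then show ?thesis by (simp add: vectors_def)
  qed
  ultimately show ?thesis
    unfolding tree_minor_eq_0_iff[OF T] by (intro exI[of _ y] exI[of _ "\<lambda>_. 0"]) (auto simp: vectors_def)
qed

text \<open>
  If \<open>e0\<close> occurs in a relation, its ends are connected by the other edges of \<open>T\<close>: otherwise the pairing of the
  relation with the indicator of the component of one end is the coefficient of \<open>e0\<close> up to sign,
  whereas it is zero for every relation. A path between the ends closes up with \<open>e0\<close> to a cycle.
\<close>

lemma acyclic_imp_independent:
  fixes y :: "'e \<Rightarrow> 'f::field"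
  assumes T: "T \<subseteq> arcs G" and acyclic: "\<nexists>us cs. undirected_cycle (G\<lparr>arcs := T\<rparr>) us cs"
    and y: "y \<in> vectors T" "\<forall>w\<in>set vs. (\<Sum>e\<in>T. incidence_value G e w * y e) = 0"
  shows "y = (\<lambda>_. 0)"
proof (rule ccontr)
  assume "y \<noteq> (\<lambda>_. 0)"
  then obtain e0 where e0: "e0 \<in> T" "y e0 \<noteq> 0" using y(1) by (auto simp: vectors_def)
  have fin: "finite T" by (rule finite_subset[OF T finite_arcs])
  let ?R = "(edge_rel G (T - {e0}))\<^sup>*"
  have "(head G e0, tail G e0) \<in> ?R"
  proof (rule ccontr)
    assume not: "(head G e0, tail G e0) \<notin> ?R"
    define z :: "'v \<Rightarrow> 'f" where "z v = of_bool ((head G e0, v) \<in> ?R)" for v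
    let ?b = "\<lambda>w. \<Sum>e\<in>T. incidence_value G e w * y e"
    have sum: "(\<Sum>v\<in>verts G. z v * ?b v) = (\<Sum>e\<in>T. y e * (z (tail G e) - z (head G e)))" for z
    proof -
      have "(\<Sum>v\<in>verts G. z v * ?b v) = (\<Sum>e\<in>T. y e * (\<Sum>v\<in>verts G. incidence_value G e v * z v))"
        unfolding sum_distrib_left by (subst sum.swap) (simp add: mult_ac)
      also have "\<dots> = (\<Sum>e\<in>T. y e * (z (tail G e) - z (head G e)))"
        by (intro sum.cong refl arg_cong2[of _ _ _ _ "(*)"] sum_incidence_value) (use T in auto)
      finally show ?thesis .
    qed
    have split: "(\<Sum>v\<in>verts G. z v * ?b v) = z v0 * ?b v0" for z
    proof -
      have "(\<Sum>v\<in>verts G. z v * ?b v) = z v0 * ?b v0 + (\<Sum>v\<in>set vs. z v * ?b v)"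
        using vs by (simp add: sum.remove[of "verts G" v0])
      then show ?thesis using y(2) by simp
    qed
    have "?b v0 = 0" using sum[of "\<lambda>_. 1"] split[of "\<lambda>_. 1"] by simp
    then have "0 = (\<Sum>e\<in>T. y e * (z (tail G e) - z (head G e)))"
      using sum[of z] split[of z] by simp
    also have "\<dots> = y e0 * (z (tail G e0) - z (head G e0)) + (\<Sum>e\<in>T - {e0}. y e * (z (tail G e) - z (head G e)))"
      by (rule sum.remove[OF fin e0(1)])
    also have "(\<Sum>e\<in>T - {e0}. y e * (z (tail G e) - z (head G e))) = 0"
    proof (rule sum.neutral, rule ballI)
      fix e assume e: "e \<in> T - {e0}"
      have "(tail G e, head G e) \<in> edge_rel G (T - {e0})" "(head G e, tail G e) \<in> edge_rel G (T - {e0})"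
        using e by (auto simp: edge_rel_def)
      then have "z (tail G e) = z (head G e)" by (auto simp: z_def intro: rtrancl_into_rtrancl)
      then show "y e * (z (tail G e) - z (head G e)) = 0" by simp
    qed
    finally show False using not e0(2) by (simp add: z_def)
  qed
  from edge_rel_path[OF this] obtain us cs where p: "us \<noteq> []" "hd us = head G e0" "last us = tail G e0"
    "distinct us" "length us = Suc (length cs)" "set cs \<subseteq> T - {e0}" "distinct cs"
    "\<forall>i<length cs. {tail G (cs ! i), head G (cs ! i)} = {us ! i, us ! Suc i}" by blast
  have "us ! 0 = head G e0" "us ! length cs = tail G e0"
    using p(1-3,5) by (simp_all add: hd_conv_nth last_conv_nth)
  moreover have "Suc i mod Suc (length cs) = Suc i" if "i < length cs" for i
    using that by simp
  ultimately have "undirected_cycle (G\<lparr>arcs := T\<rparr>) us (cs @ [e0])"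
    using p e0(1) by (auto simp: undirected_cycle_def nth_append less_Suc_eq)
  then show False using acyclic by blast
qed

text \<open>
  Rows and columns of the reduced incidence matrix \<open>B\<close> of a spanning tree are independent, so \<open>B\<close> is square. It has
  an integral left inverse, so its determinant is \<open>1\<close> or \<open>- 1\<close>; the minor is the square of the determinant.
\<close>

lemma tree_minor_eq_1:
  fixes F :: "'f::{field,finite} itself"
  assumes T: "T \<subseteq> arcs G" and conn: "Digraph_Component.connected (G\<lparr>arcs := T\<rparr>)"
    and acyclic: "\<nexists>us cs. undirected_cycle (G\<lparr>arcs := T\<rparr>) us cs"
  shows "config_minor (incidence_value G) es vs (arcs G - T) (arcs G - T) (\<lambda>_. 0 :: 'f) = 1"
proof -
  have fin: "finite T" by (rule finite_subset[OF T finite_arcs])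
  have ne: "verts G \<noteq> {}" using vs by auto
  let ?r = "length vs" let ?Ts = "filter (\<lambda>e. e \<in> T) es"
  have r: "card (set vs) = ?r" by (rule distinct_card[OF vs(2)])
  have Ts: "distinct ?Ts" "set ?Ts = T" using es T by auto
  have reach: "(v0, v) \<in> (edge_rel G T)\<^sup>*" if "v \<in> verts G" for v
    using conn that vs(1) unfolding connected_iff_edge_rel[OF graph T ne] by blast
  have card: "card T = ?r"
  proof (rule antisym)
    have "\<exists>k. card {y \<in> vectors T. \<forall>w\<in>set vs. (\<Sum>e\<in>T. incidence_value G e w * y e) = (0 :: 'f)} = CARD('f) ^ k
      \<and> card T \<le> k + card (set vs)"
      by (rule card_solutions)
        (use fin in \<open>auto simp: linear_functional_def distrib_left sum.distrib sum_distrib_left mult_ac\<close>)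
    moreover have "{y \<in> vectors T. \<forall>w\<in>set vs. (\<Sum>e\<in>T. incidence_value G e w * y e) = (0 :: 'f)} = {\<lambda>_. 0}"
      using acyclic_imp_independent[OF T acyclic] by (auto simp: vectors_def)
    ultimately obtain k where k: "card {\<lambda>_ :: 'e. 0 :: 'f} = CARD('f) ^ k" "card T \<le> k + ?r"
      unfolding r by (simp only:) blast
    have "CARD('f) ^ k = 1" using k(1)[symmetric] by simp
    with k(2) show "card T \<le> ?r" using card_field_ge_2[where ?'f = 'f] by (cases k) auto
    have "\<exists>k. card {z \<in> vectors (set vs). \<forall>e\<in>T. z (tail G e) - z (head G e) = (0 :: 'f)} = CARD('f) ^ k
      \<and> card (set vs) \<le> k + card T"
      by (rule card_solutions) (use fin in \<open>auto simp: linear_functional_def algebra_simps\<close>)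
    moreover have "{z \<in> vectors (set vs). \<forall>e\<in>T. z (tail G e) - z (head G e) = (0 :: 'f)} = {\<lambda>_. 0}"
    proof -
      have "z = (\<lambda>_. 0)" if z: "z \<in> vectors (set vs)" "\<forall>e\<in>T. z (tail G e) - z (head G e) = 0" for z :: "'v \<Rightarrow> 'f"
      proof
        fix v
        have "z v = z v0" if "(v0, v) \<in> (edge_rel G T)\<^sup>*"
          using that by (induction rule: rtrancl_induct) (use z(2) in \<open>auto simp: edge_rel_def\<close>)
        moreover have "z v0 = 0" using z(1) vs by (auto simp: vectors_def)
        ultimately show "z v = 0"
          using reach[of v] z(1) vs by (cases "v \<in> verts G") (auto simp: vectors_def)
      qed
      then show ?thesis by (auto simp: vectors_def)
    qed
    ultimately obtain k where k: "card {\<lambda>_ :: 'v. 0 :: 'f} = CARD('f) ^ k" "?r \<le> k + card T"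
      unfolding r by (simp only:) blast
    have "CARD('f) ^ k = 1" using k(1)[symmetric] by simp
    with k(2) show "?r \<le> card T" using card_field_ge_2[where ?'f = 'f] by (cases k) auto
  qed
  then have len: "length ?Ts = ?r" using distinct_card[OF Ts(1)] Ts(2) by simp
  define B where "B = mat ?r ?r (\<lambda>(i, j). incidence_value G (?Ts ! i) (vs ! j) :: int)"
  define B' where "B' = map_mat (of_int :: int \<Rightarrow> 'f) B"
  have B: "B \<in> carrier_mat ?r ?r" "B' \<in> carrier_mat ?r ?r" by (simp_all add: B_def B'_def)
  have B'_nth: "B' $$ (i, j) = incidence_value G (?Ts ! i) (vs ! j)" if "i < ?r" "j < ?r" for i j
    using that by (simp add: B'_def B_def incidence_value_eq)
  have "\<forall>v\<in>verts G. \<exists>p :: 'e \<Rightarrow> int. \<forall>w. w \<noteq> v0 \<longrightarrow> (\<Sum>e\<in>T. p e * incidence_value G e w) = of_bool (w = v)"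
    using edge_rel_integral_path[OF fin reach] by blast
  then obtain p :: "'v \<Rightarrow> 'e \<Rightarrow> int" where
    p: "\<And>v w. v \<in> verts G \<Longrightarrow> w \<noteq> v0 \<Longrightarrow> (\<Sum>e\<in>T. p v e * incidence_value G e w) = of_bool (w = v)"
    by metis
  define P where "P = mat ?r ?r (\<lambda>(i, j). p (vs ! i) (?Ts ! j))"
  have P: "P \<in> carrier_mat ?r ?r" by (simp add: P_def)
  have sumT: "(\<Sum>e\<in>T. h e) = (\<Sum>j = 0..<?r. h (?Ts ! j))" for h :: "'e \<Rightarrow> int"
    using sum.reindex_bij_betw[OF bij_betw_nth[OF Ts(1) refl refl], of h] Ts(2) len
    by (simp add: atLeast0LessThan)
  have "P * B = 1\<^sub>m ?r"
  proof (rule eq_matI)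
    fix i k assume "i < dim_row (1\<^sub>m ?r :: int mat)" "k < dim_col (1\<^sub>m ?r :: int mat)"
    then have ik: "i < ?r" "k < ?r" by auto
    have "(P * B) $$ (i, k) = (\<Sum>j = 0..<?r. p (vs ! i) (?Ts ! j) * incidence_value G (?Ts ! j) (vs ! k))"
      using ik by (simp add: P_def B_def scalar_prod_def)
    also have "\<dots> = of_bool (vs ! k = vs ! i)"
    proof -
      have "vs ! i \<in> set vs" "vs ! k \<in> set vs" using ik by simp_all
      then have "(\<Sum>e\<in>T. p (vs ! i) e * incidence_value G e (vs ! k)) = of_bool (vs ! k = vs ! i)"
        using vs by (intro p) auto
      then show ?thesis by (simp only: sumT)
    qed
    finally show "(P * B) $$ (i, k) = 1\<^sub>m ?r $$ (i, k)"
      using ik vs(2) by (auto simp: nth_eq_iff_index_eq)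
  qed (use P B in auto)
  then have "det P * det B = 1" using det_mult[OF P B(1)] by simp
  then have "det B = 1 \<or> det B = - 1" by (auto simp: zmult_eq_1_iff)
  moreover have "det B' = of_int (det B)"
    unfolding B'_def by (rule of_int_hom.hom_det)
  ultimately have sq: "det B' * det B' = 1" by auto
  have lab: "labels es vs (arcs G - T) = map Inl ?Ts @ map Inr vs"
    using es by (auto simp: labels_def intro!: filter_cong)
  let ?L = "map Inl ?Ts @ map Inr vs :: ('e + 'v) list"
  let ?M = "mat (length ?L) (length ?L) (\<lambda>(r, c). config_entry (incidence_value G) (\<lambda>_. 0 :: 'f) (?L ! r) (?L ! c))"
  have "?M = four_block_mat (0\<^sub>m ?r ?r) B' (- transpose_mat B') (0\<^sub>m ?r ?r)" (is "_ = ?N")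
  proof (rule eq_matI)
    fix i j assume "i < dim_row ?N" "j < dim_col ?N"
    then have ij: "i < ?r + ?r" "j < ?r + ?r" using B(2) by auto
    show "?M $$ (i, j) = ?N $$ (i, j)"
      using ij B(2) len by (auto simp: nth_append B'_nth)
  qed (use B(2) len in auto)
  then have "config_minor (incidence_value G) es vs (arcs G - T) (arcs G - T) (\<lambda>_. 0 :: 'f) = det ?N"
    unfolding config_minor_def minor_def lab by simp
  also have "\<dots> = det (0\<^sub>m ?r ?r * 0\<^sub>m ?r ?r - B' * - transpose_mat B')"
    by (rule det_four_block_mat) (use B(2) in auto)
  also have "0\<^sub>m ?r ?r * 0\<^sub>m ?r ?r - B' * - transpose_mat B' = B' * transpose_mat B'"
    using B(2) by (intro eq_matI) auto
  also have "det \<dots> = det B' * det B'"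
    using B(2) by (simp add: det_mult[of B' ?r "transpose_mat B'"] det_transpose[of B' ?r])
  finally show ?thesis using sq by simp
qed

text \<open>
  Iteration of \<open>config_minor_expand\<close> for \<open>I = J\<close>, where all signs are \<open>1\<close>.
\<close>

lemma config_minor_expand_all:
  fixes E :: "'e \<Rightarrow> 'v \<Rightarrow> 'r::comm_ring_1"
  assumes "finite U" "U \<inter> I = {}" "U \<union> I \<subseteq> set es" "\<And>e. e \<in> set es - I - U \<Longrightarrow> x e = 0"
  shows "config_minor E es vs I I x
    = (\<Sum>W\<in>Pow U. (\<Prod>e\<in>W. x e) * config_minor E es vs (I \<union> W) (I \<union> W) (\<lambda>_. 0))"
  using assms
proof (induction U arbitrary: I x)
  case empty
  then show ?case by (auto intro: config_minor_cong)
next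
  case (insert m U)
  have *: "config_minor E es vs I I x
    = x m * config_minor E es vs (insert m I) (insert m I) x + config_minor E es vs I I (x(m := 0))"
    using config_minor_expand[OF es(1), of I I m E vs x] insert.prems by simp
  have 1: "config_minor E es vs (insert m I) (insert m I) x
    = (\<Sum>W\<in>Pow U. (\<Prod>e\<in>W. x e) * config_minor E es vs (insert m I \<union> W) (insert m I \<union> W) (\<lambda>_. 0))"
    by (rule insert.IH) (use insert.prems insert.hyps in auto)
  have "config_minor E es vs I I (x(m := 0))
    = (\<Sum>W\<in>Pow U. (\<Prod>e\<in>W. (x(m := 0)) e) * config_minor E es vs (I \<union> W) (I \<union> W) (\<lambda>_. 0))"
    by (rule insert.IH) (use insert.prems insert.hyps in auto)
  also have "\<dots> = (\<Sum>W\<in>Pow U. (\<Prod>e\<in>W. x e) * config_minor E es vs (I \<union> W) (I \<union> W) (\<lambda>_. 0))"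
    using insert.hyps(2) by (intro sum.cong refl arg_cong2[of _ _ _ _ "(*)"] prod.cong) auto
  finally have 2: "config_minor E es vs I I (x(m := 0))
    = (\<Sum>W\<in>Pow U. (\<Prod>e\<in>W. x e) * config_minor E es vs (I \<union> W) (I \<union> W) (\<lambda>_. 0))" .
  have "(\<Sum>W\<in>insert m ` Pow U. (\<Prod>e\<in>W. x e) * config_minor E es vs (I \<union> W) (I \<union> W) (\<lambda>_. 0))
    = (\<Sum>W\<in>Pow U. (\<Prod>e\<in>insert m W. x e) * config_minor E es vs (I \<union> insert m W) (I \<union> insert m W) (\<lambda>_. 0))"
    by (rule sum.reindex_cong[OF _ refl refl]) (use insert.hyps(2) in \<open>auto simp: inj_on_def\<close>)
  also have "\<dots> = (\<Sum>W\<in>Pow U. x m * ((\<Prod>e\<in>W. x e) * config_minor E es vs (insert m I \<union> W) (insert m I \<union> W) (\<lambda>_. 0)))"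
  proof (rule sum.cong)
    fix W assume "W \<in> Pow U"
    then have "finite W" "m \<notin> W" using insert.hyps finite_subset by auto
    then show "(\<Prod>e\<in>insert m W. x e) * config_minor E es vs (I \<union> insert m W) (I \<union> insert m W) (\<lambda>_. 0)
      = x m * ((\<Prod>e\<in>W. x e) * config_minor E es vs (insert m I \<union> W) (insert m I \<union> W) (\<lambda>_. 0))"
      by (simp add: mult_ac)
  qed simp
  finally have 3: "(\<Sum>W\<in>insert m ` Pow U. (\<Prod>e\<in>W. x e) * config_minor E es vs (I \<union> W) (I \<union> W) (\<lambda>_. 0))
    = x m * config_minor E es vs (insert m I) (insert m I) x"
    unfolding 1 by (simp add: sum_distrib_left)
  have "Pow U \<inter> insert m ` Pow U = {}" using insert.hyps(2) by auto
  then show ?case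
    unfolding Pow_insert * 2 3[symmetric]
    using insert.hyps(1) by (subst sum.union_disjoint) (auto simp: add.commute)
qed

text \<open>
  In the expansion of the determinant the subsets \<open>T\<close> that are not spanning trees contribute \<open>0\<close>, since
  they are disconnected or contain a cycle.
\<close>

lemma eval_graph_poly:
  fixes x :: "'e \<Rightarrow> 'f::{field,finite}"
  shows "eval_mpoly x (graph_poly G) = config_minor (incidence_value G) es vs {} {} x"
proof -
  let ?N = "\<lambda>T. config_minor (incidence_value G) es vs (arcs G - T) (arcs G - T) (\<lambda>_. 0 :: 'f)"
  have N: "?N T = of_bool (spanning_tree_arcs G T)" if "T \<subseteq> arcs G" for T
    using tree_minor_eq_1[OF that, where ?'f = 'f] disconnected_minor_eq_0[OF that, where ?'f = 'f]
      cycle_minor_eq_0[OF that, where ?'f = 'f] that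
    unfolding spanning_tree_arcs_def by (auto simp: of_bool_def)
  have sub: "T \<subseteq> arcs G" if "spanning_tree_arcs G T" for T
    using that by (simp add: spanning_tree_arcs_def)
  have N': "?N T = 1" if "spanning_tree_arcs G T" for T
    using N[OF sub[OF that]] that by simp
  have "eval_mpoly x (graph_poly G) = (\<Sum>T | spanning_tree_arcs G T. \<Prod>e\<in>arcs G - T. x e)"
    by (simp add: graph_poly_def eval_mpoly.hom_sum eval_mpoly.hom_prod)
  also have "\<dots> = (\<Sum>T\<in>Pow (arcs G). (\<Prod>e\<in>arcs G - T. x e) * ?N T)"
    by (rule sum.mono_neutral_cong_left) (auto simp: N N' dest: sub)
  also have "\<dots> = (\<Sum>W\<in>Pow (arcs G). (\<Prod>e\<in>W. x e) * config_minor (incidence_value G) es vs W W (\<lambda>_. 0))"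
    by (rule sum.reindex_bij_witness[of _ "\<lambda>W. arcs G - W" "\<lambda>W. arcs G - W"]) (auto simp: double_diff)
  also have "\<dots> = config_minor (incidence_value G) es vs {} {} x"
    using config_minor_expand_all[of "arcs G" "{}" x "incidence_value G"] es(2) by simp
  finally show ?thesis .
qed

end

section \<open>The invariant of a graph\<close>

text \<open>
  Points of the affine space are undefined outside of \<open>S\<close>, the vectors counted above are zero there.
\<close>

lemma num_zeros_eq_zero_count:
  fixes F :: "'f::{field,finite} itself"
  assumes "\<And>x y :: 'e \<Rightarrow> 'f. (\<And>e. e \<in> S \<Longrightarrow> x e = y e) \<Longrightarrow> eval_mpoly x P = eval_mpoly y P"
    and "finite S"
  shows "int (num_zeros F S P) = zero_count S (\<lambda>x :: 'e \<Rightarrow> 'f. eval_mpoly x P = 0)"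
proof -
  have "card {v \<in> (vectors S :: ('e \<Rightarrow> 'f) set). eval_mpoly v P = 0}
      = card {x \<in> S \<rightarrow>\<^sub>E (UNIV :: 'f set). eval_mpoly x P = 0}"
  proof (rule bij_betw_same_card[of "\<lambda>v. restrict v S"])
    have inj: "inj_on (\<lambda>v. restrict v S) (vectors S :: ('e \<Rightarrow> 'f) set)"
      and img: "(\<lambda>v. restrict v S) ` vectors S = S \<rightarrow>\<^sub>E (UNIV :: 'f set)"
      using bij_betw_restrict_vectors[of S, where ?'f = 'f] by (auto simp: bij_betw_def)
    have eval: "eval_mpoly (restrict v S) P = eval_mpoly v P" for v :: "'e \<Rightarrow> 'f"
      by (rule assms(1)) simp
    show "bij_betw (\<lambda>v. restrict v S) {v \<in> (vectors S :: ('e \<Rightarrow> 'f) set). eval_mpoly v P = 0}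
        {x \<in> S \<rightarrow>\<^sub>E (UNIV :: 'f set). eval_mpoly x P = 0}"
      unfolding bij_betw_def
    proof
      show "inj_on (\<lambda>v. restrict v S) {v \<in> (vectors S :: ('e \<Rightarrow> 'f) set). eval_mpoly v P = 0}"
        by (rule inj_on_subset[OF inj]) auto
      show "(\<lambda>v. restrict v S) ` {v \<in> (vectors S :: ('e \<Rightarrow> 'f) set). eval_mpoly v P = 0}
          = {x \<in> S \<rightarrow>\<^sub>E (UNIV :: 'f set). eval_mpoly x P = 0}"
        unfolding img[symmetric] by (auto simp: eval)
    qed
  qed
  moreover have "zero_count S (\<lambda>x :: 'e \<Rightarrow> 'f. eval_mpoly x P = 0)
      = int (card (vectors S \<inter> {x :: 'e \<Rightarrow> 'f. eval_mpoly x P = 0}))"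
    unfolding zero_count_def by (rule sum_of_bool_eq; rule finite_vectors[OF assms(2)])
  moreover have "vectors S \<inter> {x :: 'e \<Rightarrow> 'f. eval_mpoly x P = 0} = {v \<in> (vectors S :: ('e \<Rightarrow> 'f) set). eval_mpoly v P = 0}"
    by auto
  ultimately show ?thesis by (simp add: num_zeros_def)
qed

text \<open>
  The factor \<open>q ^ 2\<close> can be cancelled, so the class modulo \<open>q\<close> is unique.
\<close>

lemma c2_cong:
  fixes F :: "'f::{field,finite} itself"
  assumes "has_c2 F G c"
  shows "[c2 F G = c] (mod int CARD('f))"
proof -
  let ?q = "int CARD('f)" let ?Z = "int (num_zeros F (arcs G) (graph_poly G))"
  have q: "?q > 0" using card_field_ge_2[where ?'f = 'f] by simp
  have iff: "has_c2 F G c' \<longleftrightarrow> [c' = c] (mod ?q)" for c'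
  proof -
    have "has_c2 F G c' \<longleftrightarrow> [c' * ?q ^ 2 = c * ?q ^ 2] (mod ?q ^ 3)"
      using assms unfolding has_c2_def by (meson cong_sym cong_trans)
    also have "\<dots> \<longleftrightarrow> ?q ^ 2 * ?q dvd ?q ^ 2 * (c' - c)"
      by (simp add: cong_iff_dvd_diff algebra_simps eval_nat_numeral)
    also have "\<dots> \<longleftrightarrow> [c' = c] (mod ?q)"
      using q by (simp add: cong_iff_dvd_diff)
    finally show ?thesis .
  qed
  have "c2 F G = c mod ?q"
    unfolding c2_def
  proof (rule the_equality)
    show "c mod ?q \<in> {0..<?q} \<and> has_c2 F G (c mod ?q)"
      using q by (simp add: iff)
    fix c' assume "c' \<in> {0..<?q} \<and> has_c2 F G c'"
    then show "c' = c mod ?q" by (auto simp: iff cong_def)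
  qed
  then show ?thesis by simp
qed

lemma betti_connected:
  assumes graph: "fin_digraph G" and conn: "Digraph_Component.connected G"
  shows "betti G = card (arcs G) + 1 - card (verts G)"
proof -
  let ?H = "with_proj (mk_symmetric G)"
  have reach: "u \<rightarrow>\<^sup>*\<^bsub>?H\<^esub> v" if "u \<in> verts G" "v \<in> verts G" for u v
    using conn that by (auto simp: connected_def strongly_connected_def)
  have ne: "verts G \<noteq> {}" using conn by (auto simp: connected_def strongly_connected_def)
  have inside: "u \<in> verts G \<and> v \<in> verts G" if "u \<rightarrow>\<^sup>*\<^bsub>?H\<^esub> v" for u v
    using that in_rtrancl_on_in_F[of u v] by (fastforce simp: reachable_def)
  have "pre_digraph.sccs_verts ?H = {verts G}"
  proof (intro equalityI subsetI)
    fix S assume "S \<in> pre_digraph.sccs_verts ?H"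
    then have S: "S \<noteq> {}" "\<forall>u\<in>S. \<forall>v\<in>S. u \<rightarrow>\<^sup>*\<^bsub>?H\<^esub> v"
      "\<forall>u\<in>S. \<forall>v. v \<notin> S \<longrightarrow> \<not> u \<rightarrow>\<^sup>*\<^bsub>?H\<^esub> v \<or> \<not> v \<rightarrow>\<^sup>*\<^bsub>?H\<^esub> u"
      unfolding pre_digraph.sccs_verts_def mem_Collect_eq by blast+
    have "S \<subseteq> verts G" using S(2) inside by blast
    moreover have "verts G \<subseteq> S" using S(1,3) reach \<open>S \<subseteq> verts G\<close> by blast
    ultimately show "S \<in> {verts G}" by auto
  next
    fix S assume "S \<in> {verts G}"
    then have "S = verts G" by simp
    then show "S \<in> pre_digraph.sccs_verts ?H"
      unfolding pre_digraph.sccs_verts_def mem_Collect_eq using ne reach inside by blast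
  qed
  then show ?thesis by (simp add: betti_def)
qed

theorem theorem29:
  fixes G :: "('v, 'e) pre_digraph"
    and es :: "'e list" and vs :: "'v list" and v0 :: 'v
    and F :: "'f::{field,finite} itself" and q :: nat
  assumes graph: "fin_digraph G" and connected: "Digraph_Component.connected G"
    and edge_order: "distinct es" "set es = arcs G"
    and vertex_order: "v0 \<in> verts G" "distinct vs" "set vs = verts G - {v0}"
    and q: "q = CARD('f)"
  shows
    "(2 * betti G \<le> card (arcs G) \<and> 5 \<le> card (arcs G) \<longrightarrow>
       (\<exists>c. has_c2 F G c) \<and>
       (\<forall>ns D. denom_red G es vs ns D \<and> length ns < card (arcs G) \<longrightarrow>
          [c2 F G = (- 1) ^ length ns * int (num_zeros F (arcs G - set ns) D)] (mod int q)) \<and>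
       (weight_drop G es vs \<longrightarrow> [c2 F G = 0] (mod int q))) \<and>
     (2 * betti G < card (arcs G) \<and> 4 \<le> card (arcs G) \<longrightarrow>
       (\<exists>c. has_c2 F G c) \<and> [c2 F G = 0] (mod int q))"
proof -
  interpret fin_digraph G by (rule graph)
  let ?q = "int CARD('f)" and ?N = "card (arcs G)"
  define Z where "Z = zero_count (arcs G) (\<lambda>x :: 'e \<Rightarrow> 'f. config_minor (incidence_value G) es vs {} {} x = 0)"
  have len: "length es = ?N" "card (verts G) = Suc (length vs)"
    using distinct_card[OF edge_order(1)] edge_order(2) distinct_card[OF vertex_order(2)]
      card.remove[OF finite_verts vertex_order(1)] vertex_order(3) by auto
  have betti: "betti G = ?N - length vs"
    using betti_connected[OF graph connected] len(2) by simp
  have eval: "eval_mpoly x (graph_poly G) = config_minor (incidence_value G) es vs {} {} x" for x :: "'e \<Rightarrow> 'f"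
    by (rule eval_graph_poly[OF graph edge_order vertex_order])
  have Z: "int (num_zeros F (arcs G) (graph_poly G)) = Z"
    unfolding Z_def eval[symmetric]
    by (rule num_zeros_eq_zero_count) (auto simp: eval edge_order(2) intro!: config_minor_cong)
  have has: "has_c2 F G c \<longleftrightarrow> [Z = c * ?q ^ 2] (mod ?q ^ 3)" for c
    by (simp add: has_c2_def Z)
  show ?thesis
    unfolding q
  proof (intro conjI impI allI)
    assume small: "2 * betti G \<le> ?N \<and> 5 \<le> ?N"
    then have le: "length es \<le> 2 * length vs" "3 \<le> length vs" "5 \<le> length es"
      using betti len by auto
    have "[Z = ?q ^ length es] (mod ?q ^ 2)"
      using zero_count_config_minor[of es vs 2 "incidence_value G :: 'e \<Rightarrow> 'v \<Rightarrow> 'f"] le edge_order vertex_order(2)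
      by (simp add: Z_def)
    moreover have "[?q ^ length es = 0] (mod ?q ^ 2)"
      using le by (simp add: cong_0_iff le_imp_power_dvd)
    ultimately have "?q ^ 2 dvd Z" by (metis cong_0_iff cong_trans)
    then obtain c where "Z = ?q ^ 2 * c" by (elim dvdE)
    then show "\<exists>c. has_c2 F G c" unfolding has by (intro exI[of _ c]) (simp add: mult.commute)
    have red: "has_c2 F G ((- 1) ^ length ns * (zero_count (arcs G - set ns) (\<lambda>x :: 'e \<Rightarrow> 'f. eval_mpoly x D = 0)
      - ?q ^ (?N - length ns)))" if "denom_red G es vs ns D" for ns D
      using denom_red_count[OF edge_order(1) vertex_order(2) le(1,2) that edge_order(2), where ?'f = 'f]
      unfolding has Z_def by (simp add: edge_order(2) len mult_ac)
    {
      fix ns D assume *: "denom_red G es vs ns D \<and> length ns < ?N"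
      let ?z = "zero_count (arcs G - set ns) (\<lambda>x :: 'e \<Rightarrow> 'f. eval_mpoly x D = 0)"
      have "int (num_zeros F (arcs G - set ns) D) = ?z"
        by (rule num_zeros_eq_zero_count) (use * edge_order(2) in \<open>auto intro: denom_red_local\<close>)
      moreover have "[(- 1) ^ length ns * (?z - ?q ^ (?N - length ns)) = (- 1) ^ length ns * (?z - 0)] (mod ?q)"
        using * by (intro cong_mult cong_diff cong_refl) (auto simp: cong_0_iff intro!: dvd_power)
      ultimately show "[c2 F G = (- 1) ^ length ns * int (num_zeros F (arcs G - set ns) D)] (mod ?q)"
        using c2_cong[OF red] * by (auto intro: cong_trans)
    }
    assume "weight_drop G es vs"
    then obtain ns where ns: "denom_red G es vs ns 0" by (auto simp: weight_drop_def)
    have "card (arcs G - set ns) = ?N - length ns"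
      using denom_red_edges[OF ns] by (simp add: card_Diff_subset distinct_card)
    then have "has_c2 F G 0"
      using red[OF ns] by (simp add: eval_mpoly_0 zero_count_True)
    then show "[c2 F G = 0] (mod ?q)" by (rule c2_cong)
  next
    assume small: "2 * betti G < ?N \<and> 4 \<le> ?N"
    then have le: "length es < 2 * length vs" "3 \<le> length vs" "4 \<le> length es"
      using betti len by auto
    have "[Z = ?q ^ length es] (mod ?q ^ 3)"
      using zero_count_config_minor[of es vs 3 "incidence_value G :: 'e \<Rightarrow> 'v \<Rightarrow> 'f"] le edge_order vertex_order(2)
      by (simp add: Z_def)
    moreover have "[?q ^ length es = 0] (mod ?q ^ 3)"
      using le by (simp add: cong_0_iff le_imp_power_dvd)
    ultimately have c: "has_c2 F G 0" unfolding has by (auto intro: cong_trans)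
    then show "\<exists>c. has_c2 F G c" ..
    show "[c2 F G = 0] (mod ?q)" by (rule c2_cong[OF c])
  qed
qed

end
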